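(* Let $E$ be a Banach lattice with positive cone $E_+$. (A) Let $W$ be a cone in $E$ with the following properties: (1) $E$ is a Banach lattice with respect to the cone $W$ and its original norm; (2) $E$ has the same closed ideals with respect to the cones $E_+$ and $W$. Then there is $T\in Z(E)$ with $|T|=1$ such that $T(x)=/x/_{W}$ for each $x\in E_+$, where $/\cdot/_{W}$ denotes the absolute value on $E$ with respect to the lattice structure given by the cone $W$. (B) Conversely, if $T\in Z(E)$ satisfies $|T|=1$, then $W=T(E_+)$ is a cone in $E$ such that (1) and (2) hold.
   Context: Scalars may be real or complex; the result is asserted in either case. (In the complex case, "$E$ is a Banach lattice with the cone $W$" means that $E$ is a complex Banach lattice whose positive cone is $W$, i.e. $E$ is the complexification of the real Banach lattice $W-W$ with cone $W$, with the norm given by the original norm of $E$.) Ideal center: $Z(E)$, formed with respect to the original order given by $E_+$, is the set of all bounded linear operators $T$ on $E$ for which there is $M>0$ with $|T(x)|\le Mx$ for every $x\in E_+$. $Z(E)$ is isomorphic, as an algebra and as a vector lattice, to $C(K)$ for some compact Hausdorff space $K$; $|T|$ denotes the absolute value of $T$ in the lattice $Z(E)$, and $1$ denotes the identity operator on $E$ (so $|T|=1$ means that $T$ corresponds to a function in $C(K)$ of modulus identically $1$). "Ideal" means order ideal, and "closed" means norm closed. *)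

theory Defs
  imports "HOL-Analysis.Analysis"
begin

class complex_vector = real_vector +
  fixes scaleC :: "complex \<Rightarrow> 'a \<Rightarrow> 'a"  (infixr \<open>*\<^sub>C\<close> 75)
  assumes scaleC_add_right: "c *\<^sub>C (x + y) = c *\<^sub>C x + c *\<^sub>C y"
    and scaleC_add_left: "(c + d) *\<^sub>C x = c *\<^sub>C x + d *\<^sub>C x"
    and scaleC_scaleC: "c *\<^sub>C (d *\<^sub>C x) = (c * d) *\<^sub>C x"
    and scaleR_scaleC: "r *\<^sub>R x = complex_of_real r *\<^sub>C x"

class complex_normed_vector = complex_vector + real_normed_vector +
  assumes norm_scaleC: "norm (c *\<^sub>C x) = cmod c * norm x"

class complex_banach = complex_normed_vector + banach

lemma bounded_linear_scaleC:
  "bounded_linear (\<lambda>x. c *\<^sub>C (x::'a::complex_normed_vector))"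
proof (rule bounded_linear_intro[where K = "cmod c"])
  show "c *\<^sub>C (x + y) = c *\<^sub>C x + c *\<^sub>C y" for x y :: 'a
    by (rule scaleC_add_right)
  show "c *\<^sub>C (r *\<^sub>R x) = r *\<^sub>R (c *\<^sub>C x)" for r and x :: 'a
    by (simp add: scaleR_scaleC scaleC_scaleC mult.commute)
  show "norm (c *\<^sub>C x) \<le> norm x * cmod c" for x :: 'a
    by (simp add: norm_scaleC mult.commute)
qed

instantiation blinfun :: (real_normed_vector, complex_normed_vector) complex_vector
begin

definition scaleC_blinfun :: "complex \<Rightarrow> 'a \<Rightarrow>\<^sub>L 'b \<Rightarrow> 'a \<Rightarrow>\<^sub>L 'b"
  where "c *\<^sub>C T = Blinfun (\<lambda>x. c *\<^sub>C blinfun_apply T x)"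

lemma blinfun_apply_scaleC:
  "blinfun_apply (c *\<^sub>C T) x = c *\<^sub>C blinfun_apply (T::'a \<Rightarrow>\<^sub>L 'b) x"
  unfolding scaleC_blinfun_def
  by (subst bounded_linear_Blinfun_apply)
    (auto intro: bounded_linear_compose[OF bounded_linear_scaleC]
      blinfun.bounded_linear_right)

instance
  by standard
    (auto intro!: blinfun_eqI simp: blinfun_apply_scaleC blinfun.add_left
      blinfun.scaleR_left scaleC_add_right scaleC_add_left scaleC_scaleC scaleR_scaleC)

end

definition order_cone :: "'a::real_vector set \<Rightarrow> bool" where
  "order_cone W \<longleftrightarrow> convex_cone W \<and> W \<inter> uminus ` W = {0}"

definition cone_le :: "'a::real_vector set \<Rightarrow> 'a \<Rightarrow> 'a \<Rightarrow> bool" where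
  "cone_le W x y \<longleftrightarrow> y - x \<in> W"

text \<open>
  The quantifier over upper bounds need not be relativised: if \<open>S\<close> is a nonempty subset of a
  subspace \<open>X \<supseteq> W\<close>, then every upper bound of \<open>S\<close> lies in \<open>X\<close>, so this is the supremum in the
  ordered vector space \<open>X\<close>.
\<close>

definition is_cone_sup :: "'a::real_vector set \<Rightarrow> 'a set \<Rightarrow> 'a \<Rightarrow> bool" where
  "is_cone_sup W S s \<longleftrightarrow>
     (\<forall>x\<in>S. cone_le W x s) \<and> (\<forall>u. (\<forall>x\<in>S. cone_le W x u) \<longrightarrow> cone_le W s u)"

definition is_real_abs :: "'a::real_vector set \<Rightarrow> 'a \<Rightarrow> 'a \<Rightarrow> bool" where
  "is_real_abs W x m \<longleftrightarrow> is_cone_sup W {x, - x} m"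

definition real_abs :: "'a::real_vector set \<Rightarrow> 'a \<Rightarrow> 'a" where
  "real_abs W x = (THE m. is_real_abs W x m)"

definition cone_diff :: "'a::real_vector set \<Rightarrow> 'a set" where
  "cone_diff W = {x - y |x y. x \<in> W \<and> y \<in> W}"

text \<open>
  The modulus of \<open>z = x + iy\<close> in the complexification of the real vector lattice \<open>cone_diff W\<close>
  is the supremum of the real parts of all \<open>exp (- i t) z\<close>.
\<close>

definition is_complex_abs :: "'a::complex_vector set \<Rightarrow> 'a \<Rightarrow> 'a \<Rightarrow> bool" where
  "is_complex_abs W z m \<longleftrightarrow>
     (\<exists>x\<in>cone_diff W. \<exists>y\<in>cone_diff W.
        z = x + \<i> *\<^sub>C y \<and> is_cone_sup W (range (\<lambda>t. cos t *\<^sub>R x + sin t *\<^sub>R y)) m)"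

definition complex_abs :: "'a::complex_vector set \<Rightarrow> 'a \<Rightarrow> 'a" where
  "complex_abs W z = (THE m. is_complex_abs W z m)"

text \<open>
  Existence of infima follows from that of suprema by passing to negatives.
\<close>

definition banach_lattice_on :: "'a::real_normed_vector set \<Rightarrow> 'a set \<Rightarrow> bool" where
  "banach_lattice_on X W \<longleftrightarrow>
     subspace X \<and> complete X \<and> order_cone W \<and> W \<subseteq> X \<and>
     (\<forall>x\<in>X. \<forall>y\<in>X. \<exists>s. is_cone_sup W {x, y} s) \<and>
     (\<forall>x\<in>X. \<forall>y\<in>X. cone_le W (real_abs W x) (real_abs W y) \<longrightarrow> norm x \<le> norm y)"

definition real_banach_lattice :: "'a::banach set \<Rightarrow> bool" where
  "real_banach_lattice W \<longleftrightarrow> banach_lattice_on UNIV W"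

text \<open>
  The space is the complexification of the real Banach lattice \<open>cone_diff W\<close>, and its norm is
  the canonical norm of that complexification, the norm of the modulus.
\<close>

definition complex_banach_lattice :: "'a::complex_banach set \<Rightarrow> bool" where
  "complex_banach_lattice W \<longleftrightarrow>
     banach_lattice_on (cone_diff W) W \<and>
     (\<forall>z. \<exists>!(x, y). x \<in> cone_diff W \<and> y \<in> cone_diff W \<and> z = x + \<i> *\<^sub>C y) \<and>
     (\<forall>z. \<exists>m. is_complex_abs W z m \<and> norm z = norm m)"

definition real_closed_ideals :: "'a::real_normed_vector set \<Rightarrow> 'a set set" where
  "real_closed_ideals W =
     {I. subspace I \<and> closed I \<and>
         (\<forall>x\<in>I. \<forall>y. cone_le W (real_abs W y) (real_abs W x) \<longrightarrow> y \<in> I)}"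

definition complex_closed_ideals :: "'a::complex_normed_vector set \<Rightarrow> 'a set set" where
  "complex_closed_ideals W =
     {I. subspace I \<and> (\<forall>c. \<forall>x\<in>I. c *\<^sub>C x \<in> I) \<and> closed I \<and>
         (\<forall>x\<in>I. \<forall>y. cone_le W (complex_abs W y) (complex_abs W x) \<longrightarrow> y \<in> I)}"

definition real_center :: "'a::real_normed_vector set \<Rightarrow> ('a \<Rightarrow>\<^sub>L 'a) set" where
  "real_center P =
     {T. \<exists>M>0. \<forall>x\<in>P. cone_le P (real_abs P (blinfun_apply T x)) (M *\<^sub>R x)}"

text \<open>
  This is the positive cone of the ideal center, so \<open>is_real_abs (real_center_cone P) T m\<close> says
  that \<open>m\<close> is the absolute value of \<open>T\<close> in the lattice of central operators, as opposed to the
  space of all bounded operators. The complex case is analogous.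
\<close>

definition real_center_cone :: "'a::real_normed_vector set \<Rightarrow> ('a \<Rightarrow>\<^sub>L 'a) set" where
  "real_center_cone P = {T \<in> real_center P. \<forall>x\<in>P. blinfun_apply T x \<in> P}"

text \<open>Elements of the function type \<open>'a \<Rightarrow>\<^sub>L 'a\<close> are only real linear, hence the homogeneity condition.\<close>

definition complex_center :: "'a::complex_normed_vector set \<Rightarrow> ('a \<Rightarrow>\<^sub>L 'a) set" where
  "complex_center P =
     {T. (\<forall>c x. blinfun_apply T (c *\<^sub>C x) = c *\<^sub>C blinfun_apply T x) \<and>
         (\<exists>M>0. \<forall>x\<in>P. cone_le P (complex_abs P (blinfun_apply T x)) (M *\<^sub>R x))}"

definition complex_center_cone :: "'a::complex_normed_vector set \<Rightarrow> ('a \<Rightarrow>\<^sub>L 'a) set" where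
  "complex_center_cone P = {T \<in> complex_center P. \<forall>x\<in>P. blinfun_apply T x \<in> P}"

end

theory Submission
  imports Defs
begin

text \<open>
  Real and complex scalars are treated together through the modulus
  \<open>m z = sup\<^sub>t (cos t * re z + sin t * im z)\<close>. Lattice computations are reduced to real arithmetic by
  real-valued lattice homomorphisms on a principal ideal, which come from maximal ideals.

  For (A): disjointness of \<open>x\<close> and \<open>y\<close> means that they lie in closed ideals with trivial intersection,
  so it is the same relation for both cones. Comparing quotient norms modulo polars of small regions,
  where the elements of \<open>P\<close> are nearly proportional, shows that the \<open>W\<close>-modulus is additive on \<open>P\<close>,
  and likewise with the cones exchanged. The composition \<open>R\<close> of the two moduli is then an additive
  isometry of \<open>P\<close> that preserves closed ideals, which forces \<open>R x = x\<close>; so the linear extension of the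
  \<open>W\<close>-modulus is central and unimodular.

  For (B): a homomorphism turns a central operator into multiplication by a scalar. Hence a unimodular \<open>T\<close>
  preserves the modulus and is bijective, and \<open>T\<close> carries the lattice structure of \<open>P\<close> to that of
  \<open>W = T P\<close>; the moduli correspond under \<open>T\<close>, so both cones have the same ideals.
\<close>

section \<open>Lattices with a modulus\<close>

text \<open>The obstacle in (A) is that the homomorphisms obtained for \<open>P\<close> cannot be
  carried over to \<open>W\<close>: they live on principal ideals, need not be continuous, and come
  from ideals that need not be closed, about which hypothesis (2) says nothing. What the two
  lattices do share is the norm, multiplication by \<open>\<iota>\<close> and the closed ideals,
  hence also the quotient norms \<open>infdist x J\<close>. So an order estimate for one cone has to
  be turned into an inequality between quotient norms before it can serve the other cone. Passing to
  the quotient by a polar amounts to looking only at the region carried by the element whose polar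
  is taken.

  Additivity of the \<open>W\<close>-modulus yields a bounded operator only; that it is central
  comes from the identity for the composed moduli, which is why both directions of the additivity
  result are needed.

  A second obstacle concerns the meaning of |T| = 1. The supremum is taken among operators, in the
  order of the center, and is not pointwise by definition. To compare it with
  \<open>m (T x)\<close>, the map \<open>m (T x)\<close> must itself be realised by a central
  operator, and this requires its additivity on \<open>P\<close>.\<close>

definition modulus :: "'a::real_vector set \<Rightarrow> ('a \<Rightarrow> 'a) \<Rightarrow> ('a \<Rightarrow> 'a) \<Rightarrow> 'a \<Rightarrow> 'a" where
  "modulus P re im z = (THE m. is_cone_sup P (range (\<lambda>t. cos t *\<^sub>R re z + sin t *\<^sub>R im z)) m)"

lemma order_coneD:
  assumes "order_cone P"
  shows "0 \<in> P" "\<And>x y. x \<in> P \<Longrightarrow> y \<in> P \<Longrightarrow> x + y \<in> P"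
    "\<And>r x. 0 \<le> r \<Longrightarrow> x \<in> P \<Longrightarrow> r *\<^sub>R x \<in> P" "\<And>x. x \<in> P \<Longrightarrow> - x \<in> P \<Longrightarrow> x = 0"
proof -
  have c: "convex_cone P" and i: "P \<inter> uminus ` P = {0}"
    using assms by (auto simp: order_cone_def)
  show "0 \<in> P" using i by blast
  show "\<And>x y. x \<in> P \<Longrightarrow> y \<in> P \<Longrightarrow> x + y \<in> P" by (rule convex_cone_add[OF c])
  show "\<And>r x. 0 \<le> r \<Longrightarrow> x \<in> P \<Longrightarrow> r *\<^sub>R x \<in> P" by (rule convex_cone_scaleR[OF c])
  show "x = 0" if "x \<in> P" "- x \<in> P" for x
  proof -
    have "x \<in> P \<inter> uminus ` P" using that by (metis IntI add.inverse_inverse imageI)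
    then show ?thesis using i by blast
  qed
qed

lemma is_cone_sup_unique:
  assumes "order_cone P" "is_cone_sup P S a" "is_cone_sup P S b"
  shows "a = b"
proof -
  have "b - a \<in> P" "a - b \<in> P" using assms(2,3) by (auto simp: is_cone_sup_def cone_le_def)
  then have "b - a = 0" using order_coneD(4)[OF assms(1), of "b - a"] by simp
  then show ?thesis by simp
qed

text \<open>
  In the complex case \<open>\<iota>\<close> is multiplication by the imaginary unit and \<open>re\<close>, \<open>im\<close> are the parts of a vector
  with respect to \<open>cone_diff P\<close>. The real case is \<open>\<iota> = 0\<close>, \<open>re = id\<close>, \<open>im = 0\<close>: the supremum of the
  vectors \<open>cos t *\<^sub>R x\<close> is that of \<open>x\<close> and \<open>- x\<close>.
\<close>

locale modulus_lattice =
  fixes P :: "'a::real_normed_vector set" and \<iota> re im :: "'a \<Rightarrow> 'a"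
  assumes cone: "order_cone P"
    and lin: "linear \<iota>" "linear re" "linear im"
    and re_in: "re x \<in> cone_diff P" and im_in: "im x \<in> cone_diff P"
    and split: "re x + \<iota> (im x) = x"
    and re_real: "x \<in> cone_diff P \<Longrightarrow> re x = x" and im_real: "x \<in> cone_diff P \<Longrightarrow> im x = 0"
    and re_iota: "re (\<iota> x) = - im x"
    and iota_cases: "(\<forall>x. im (\<iota> x) = re x \<and> \<iota> (\<iota> x) = - x) \<or> (\<forall>x. im x = 0 \<and> \<iota> x = 0)"
    and norm_iota: "norm (\<iota> x) \<le> norm x"
    and sup_ex: "\<exists>m. is_cone_sup P (range (\<lambda>t. cos t *\<^sub>R re x + sin t *\<^sub>R im x)) m"
    and norm_modulus: "norm (modulus P re im x) = norm x"
    and norm_mono_real: "x \<in> P \<Longrightarrow> y \<in> P \<Longrightarrow> cone_le P x y \<Longrightarrow> norm x \<le> norm y"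
begin

section \<open>Order arithmetic and basic laws of the modulus\<close>

abbreviation X :: "'a set" where "X \<equiv> cone_diff P"
abbreviation m :: "'a \<Rightarrow> 'a" where "m \<equiv> modulus P re im"
abbreviation le :: "'a \<Rightarrow> 'a \<Rightarrow> bool" (infix "\<preceq>" 50) where "x \<preceq> y \<equiv> cone_le P x y"

lemmas P_0 [simp] = order_coneD(1)[OF cone]
lemmas P_add = order_coneD(2)[OF cone]
lemmas P_scale = order_coneD(3)[OF cone]
lemmas P_antisym = order_coneD(4)[OF cone]

lemmas re_simps [simp] = linear_0[OF lin(2)] linear_add[OF lin(2)] linear_diff[OF lin(2)]
  linear_neg[OF lin(2)] linear_scale[OF lin(2)]
lemmas im_simps [simp] = linear_0[OF lin(3)] linear_add[OF lin(3)] linear_diff[OF lin(3)]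
  linear_neg[OF lin(3)] linear_scale[OF lin(3)]
lemmas iota_simps [simp] = linear_0[OF lin(1)] linear_add[OF lin(1)] linear_diff[OF lin(1)]
  linear_neg[OF lin(1)] linear_scale[OF lin(1)]

lemma P_sub_X: "x \<in> P \<Longrightarrow> x \<in> X"
  unfolding cone_diff_def using P_0 by (metis (mono_tags, lifting) diff_zero mem_Collect_eq)

lemma cle_refl [simp]: "x \<preceq> x" by (simp add: cone_le_def)

lemma cle_trans [trans]: "x \<preceq> y \<Longrightarrow> y \<preceq> z \<Longrightarrow> x \<preceq> z"
  using P_add[of "y - x" "z - y"] by (simp add: cone_le_def)

lemma cle_antisym: "x \<preceq> y \<Longrightarrow> y \<preceq> x \<Longrightarrow> x = y"
  using P_antisym[of "y - x"] by (simp add: cone_le_def)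

lemma le_add: "a \<preceq> b \<Longrightarrow> c \<preceq> d \<Longrightarrow> a + c \<preceq> b + d"
  using P_add[of "b - a" "d - c"] by (simp add: cone_le_def algebra_simps)

lemma le_scale: "0 \<le> r \<Longrightarrow> a \<preceq> b \<Longrightarrow> r *\<^sub>R a \<preceq> r *\<^sub>R b"
  using P_scale[of r "b - a"] by (simp add: cone_le_def algebra_simps)

lemma le_0 [simp]: "0 \<preceq> x \<longleftrightarrow> x \<in> P" by (simp add: cone_le_def)

lemma le_scale_cancel: "0 < r \<Longrightarrow> r *\<^sub>R a \<preceq> r *\<^sub>R b \<Longrightarrow> a \<preceq> b"
  using le_scale[of "1/r" "r *\<^sub>R a" "r *\<^sub>R b"] by simp

lemma P_up: "x \<in> P \<Longrightarrow> x \<preceq> y \<Longrightarrow> y \<in> P"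
  using cle_trans[of 0 x y] by simp

lemma subspace_X: "subspace X"
proof (rule subspaceI)
  show "0 \<in> X" by (rule P_sub_X) simp
  show "x + y \<in> X" if x: "x \<in> X" and y: "y \<in> X" for x y
  proof -
    obtain a b where "x = a - b" "a \<in> P" "b \<in> P" using x by (auto simp: cone_diff_def)
    moreover obtain c d where "y = c - d" "c \<in> P" "d \<in> P" using y by (auto simp: cone_diff_def)
    ultimately have "x + y = (a + c) - (b + d)" "a + c \<in> P" "b + d \<in> P" by (auto simp: P_add)
    then show ?thesis unfolding cone_diff_def by blast
  qed
  show "r *\<^sub>R x \<in> X" if x: "x \<in> X" for r x
  proof -
    obtain a b where ab: "x = a - b" "a \<in> P" "b \<in> P" using x unfolding cone_diff_def by blast
    show ?thesis
    proof (cases "0 \<le> r")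
      case True
      have "r *\<^sub>R x = r *\<^sub>R a - r *\<^sub>R b" by (simp add: ab algebra_simps)
      then show ?thesis unfolding cone_diff_def using P_scale[OF True] ab by blast
    next
      case False
      have "r *\<^sub>R x = (-r) *\<^sub>R b - (-r) *\<^sub>R a" by (simp add: ab algebra_simps)
      moreover have "(-r) *\<^sub>R b \<in> P" "(-r) *\<^sub>R a \<in> P" using ab False by (simp_all add: P_scale del: scaleR_minus_left)
      ultimately show ?thesis unfolding cone_diff_def by blast
    qed
  qed
qed

lemmas X_closed [intro, simp] = subspace_add[OF subspace_X] subspace_diff[OF subspace_X]
  subspace_scale[OF subspace_X] subspace_neg[OF subspace_X] subspace_0[OF subspace_X]

lemma is_sup_m: "is_cone_sup P (range (\<lambda>t. cos t *\<^sub>R re x + sin t *\<^sub>R im x)) (m x)"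
  unfolding modulus_def
  by (rule theI') (use sup_ex is_cone_sup_unique[OF cone] in blast)

lemma m_upper: "cos t *\<^sub>R re x + sin t *\<^sub>R im x \<preceq> m x"
  using is_sup_m[of x] by (auto simp: is_cone_sup_def)

lemma m_least: "(\<And>t. cos t *\<^sub>R re x + sin t *\<^sub>R im x \<preceq> v) \<Longrightarrow> m x \<preceq> v"
  using is_sup_m[of x] by (auto simp: is_cone_sup_def)

lemma re_le_m: "re x \<preceq> m x" "- re x \<preceq> m x"
  using m_upper[of 0 x] m_upper[of pi x] by auto

lemma im_le_m: "im x \<preceq> m x" "- im x \<preceq> m x"
  using m_upper[of "pi/2" x] m_upper[of "-(pi/2)" x] by auto

lemma m_in_P [simp]: "m x \<in> P"
proof -
  have "(1/2) *\<^sub>R (re x + - re x) \<preceq> (1/2) *\<^sub>R (m x + m x)"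
    by (intro le_scale le_add re_le_m) simp
  then show ?thesis unfolding scaleR_half_double by simp
qed

lemma m_in_X [simp]: "m x \<in> X" by (simp add: P_sub_X)
lemma re_im_X [simp]: "re x \<in> X" "im x \<in> X" by (simp_all add: re_in im_in)
lemma re_im_re [simp]: "re (re x) = re x" "im (re x) = 0" "re (im x) = im x" "im (im x) = 0"
  "re (m x) = m x" "im (m x) = 0"
  by (simp_all add: re_real im_real)
lemma re_im_P [simp]: "x \<in> P \<Longrightarrow> re x = x" "x \<in> P \<Longrightarrow> im x = 0"
  by (simp_all add: re_real im_real P_sub_X)

lemma real_le_m: "x \<in> X \<Longrightarrow> x \<preceq> m x" "x \<in> X \<Longrightarrow> - x \<preceq> m x"
  using re_le_m[of x] by (auto simp: re_real)

text \<open>For real \<open>x\<close> the vector \<open>cos t *\<^sub>R x\<close> is the convex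
  combination of \<open>x\<close> and \<open>- x\<close> with weights \<open>(1 + cos t)/2\<close>
  and \<open>(1 - cos t)/2\<close>, so a bound at the two endpoints bounds the whole rotating
  family.\<close>

lemma m_least_real:
  assumes "x \<in> X" "x \<preceq> v" "- x \<preceq> v" shows "m x \<preceq> v"
proof (rule m_least)
  fix t
  have "((1 + cos t)/2) *\<^sub>R x + ((1 - cos t)/2) *\<^sub>R (- x)
      \<preceq> ((1 + cos t)/2) *\<^sub>R v + ((1 - cos t)/2) *\<^sub>R v"
    using assms cos_ge_minus_one[of t] cos_le_one[of t] by (intro le_add le_scale; simp; linarith)
  moreover have "((1 + cos t)/2) *\<^sub>R x + ((1 - cos t)/2) *\<^sub>R (- x) = cos t *\<^sub>R x"
    by (simp add: scaleR_left_diff_distrib[symmetric] field_simps del: scaleR_left_diff_distrib)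
  moreover have "((1 + cos t)/2) *\<^sub>R v + ((1 - cos t)/2) *\<^sub>R v = v"
    by (simp flip: scaleR_left_distrib add: field_simps)
  ultimately show "cos t *\<^sub>R re x + sin t *\<^sub>R im x \<preceq> v"
    using assms(1) by (simp add: re_real im_real)
qed

lemma m_P [simp]: "x \<in> P \<Longrightarrow> m x = x"
proof (rule cle_antisym)
  assume x: "x \<in> P"
  then have "- x \<preceq> x" using P_add[OF x x] by (simp add: cone_le_def)
  with x show "m x \<preceq> x" by (intro m_least_real P_sub_X) auto
  from x show "x \<preceq> m x" by (intro real_le_m P_sub_X)
qed

lemma m_0 [simp]: "m 0 = 0" by simp

lemma m_re_le: "m (re x) \<preceq> m x" and m_im_le: "m (im x) \<preceq> m x"
  by (auto intro!: m_least_real re_le_m im_le_m)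

lemma m_add: "m (x + y) \<preceq> m x + m y"
proof (rule m_least)
  fix t
  have "(cos t *\<^sub>R re x + sin t *\<^sub>R im x) + (cos t *\<^sub>R re y + sin t *\<^sub>R im y) \<preceq> m x + m y"
    by (intro le_add m_upper)
  then show "cos t *\<^sub>R re (x + y) + sin t *\<^sub>R im (x + y) \<preceq> m x + m y"
    by (simp add: algebra_simps)
qed

lemma m_minus [simp]: "m (- x) = m x"
proof -
  have "m (- x) \<preceq> m x" for x
    using m_upper[of "_ + pi" x] by (intro m_least) simp
  from this[of x] this[of "- x"] show ?thesis by (auto intro: cle_antisym)
qed

lemma m_diff: "m (x - y) \<preceq> m x + m y"
  using m_add[of x "- y"] by simp

lemma m_diff_commute: "m (x - y) = m (y - x)"
  using m_minus[of "x - y"] by simp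

lemma m_scale [simp]: "m (r *\<^sub>R x) = \<bar>r\<bar> *\<^sub>R m x"
proof -
  have 1: "m (r *\<^sub>R x) \<preceq> r *\<^sub>R m x" if "0 \<le> r" for r x
  proof (rule m_least)
    fix t
    show "cos t *\<^sub>R re (r *\<^sub>R x) + sin t *\<^sub>R im (r *\<^sub>R x) \<preceq> r *\<^sub>R m x"
      using le_scale[OF that m_upper[of t x]] by (simp add: algebra_simps)
  qed
  have 2: "m (r *\<^sub>R x) = r *\<^sub>R m x" if "0 < r" for r x
  proof (rule cle_antisym)
    show "m (r *\<^sub>R x) \<preceq> r *\<^sub>R m x" using 1 that by simp
    have "m ((1/r) *\<^sub>R (r *\<^sub>R x)) \<preceq> (1/r) *\<^sub>R m (r *\<^sub>R x)"
      by (rule 1) (use that in simp)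
    then show "r *\<^sub>R m x \<preceq> m (r *\<^sub>R x)"
      using le_scale[of r "m x" "(1/r) *\<^sub>R m (r *\<^sub>R x)"] that by simp
  qed
  consider "r = 0" | "0 < r" | "0 < - r" by linarith
  then show ?thesis
  proof cases
    case 3
    then show ?thesis using 2[of "- r" "- x"] by simp
  qed (use 2 in auto)
qed

text \<open>In the complex case multiplication by \<open>\<iota>\<close> only shifts the angle by a
  quarter turn; in the real case the left side is zero.\<close>

lemma m_iota: "m (\<iota> x) \<preceq> m x"
  using iota_cases
proof
  assume a: "\<forall>x. im (\<iota> x) = re x \<and> \<iota> (\<iota> x) = - x"
  show ?thesis
  proof (rule m_least)
    fix t
    show "cos t *\<^sub>R re (\<iota> x) + sin t *\<^sub>R im (\<iota> x) \<preceq> m x"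
      using m_upper[of "t - pi/2" x] a by (simp add: re_iota cos_diff sin_diff)
  qed
next
  assume "\<forall>x. im x = 0 \<and> \<iota> x = 0"
  then show ?thesis by simp
qed

lemma norm_mono: "m x \<preceq> m y \<Longrightarrow> norm x \<le> norm y"
  using norm_mono_real[of "m x" "m y"] by (simp add: norm_modulus)

lemma m_eq_0 [simp]: "m x = 0 \<longleftrightarrow> x = 0"
  using norm_modulus[of x] by auto

lemma m_reverse: "m (m x - m y) \<preceq> m (x - y)"
proof (rule m_least_real)
  have "m x \<preceq> m (x - y) + m y" using m_add[of "x - y" y] by simp
  then show "m x - m y \<preceq> m (x - y)" by (simp add: cone_le_def algebra_simps)
  have "m y \<preceq> m (y - x) + m x" using m_add[of "y - x" x] by simp
  then show "- (m x - m y) \<preceq> m (x - y)"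
    by (simp add: cone_le_def algebra_simps m_diff_commute)
qed simp

section \<open>Positive and negative parts of real elements\<close>

definition pp :: "'a \<Rightarrow> 'a" where "pp x = (1/2) *\<^sub>R (m x + x)"
definition np :: "'a \<Rightarrow> 'a" where "np x = (1/2) *\<^sub>R (m x - x)"

lemma pp_P [simp]: "x \<in> X \<Longrightarrow> pp x \<in> P" and np_P [simp]: "x \<in> X \<Longrightarrow> np x \<in> P"
  using real_le_m[of x] by (auto simp: pp_def np_def cone_le_def intro!: P_scale)

lemma pp_np: "pp x - np x = x" "pp x + np x = m x"
proof -
  have *: "(1/2) *\<^sub>R (a + a) = a" for a :: 'a by (rule scaleR_half_double)
  show "pp x - np x = x" "pp x + np x = m x"
    unfolding pp_def np_def scaleR_diff_right[symmetric] scaleR_add_right[symmetric]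
    using *[of x] *[of "m x"] by (simp_all add: algebra_simps)
qed

lemma pp_eq: "pp x = x + np x"
  using pp_np(1)[of x] by (simp add: diff_eq_eq)

lemma pp_minus: "pp (- x) = np x" and np_minus: "np (- x) = pp x"
  by (simp_all add: pp_def np_def)

text \<open>\<open>v + v - x\<close> bounds both \<open>x\<close> and \<open>- x\<close>, hence
  \<open>m x\<close>. This identifies \<open>pp x\<close> as the supremum of \<open>x\<close> and
  \<open>0\<close>.\<close>

lemma pp_least:
  assumes "x \<in> X" "x \<preceq> v" "v \<in> P" shows "pp x \<preceq> v"
proof -
  have "m x \<preceq> v + v - x"
  proof (rule m_least_real)
    show "x \<preceq> v + v - x" using le_add[OF assms(2) assms(2)] by (simp add: cone_le_def algebra_simps)
    show "- x \<preceq> v + v - x" using P_add[OF assms(3) assms(3)] by (simp add: cone_le_def)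
  qed fact
  then have "m x + x \<preceq> 2 *\<^sub>R v" by (simp add: cone_le_def algebra_simps scaleR_2)
  then show ?thesis using le_scale[of "1/2" "m x + x" "2 *\<^sub>R v"] by (simp add: pp_def)
qed

lemma np_least: "x \<in> X \<Longrightarrow> - x \<preceq> v \<Longrightarrow> v \<in> P \<Longrightarrow> np x \<preceq> v"
  using pp_least[of "- x" v] by (simp add: pp_minus)

lemma np_eq_0: "x \<in> X \<Longrightarrow> np x = 0 \<longleftrightarrow> x \<in> P"
  by (metis add.right_neutral diff_zero m_P pp_P pp_np np_def diff_self scaleR_zero_right)

lemma pp_eq_0: "x \<in> X \<Longrightarrow> pp x = 0 \<longleftrightarrow> x \<preceq> 0"
  using np_eq_0[of "- x"] by (simp add: np_minus cone_le_def)

text \<open>A common lower bound \<open>c\<close> of the two parts can be subtracted twice from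
  \<open>m x\<close> with the result still above \<open>x\<close> and \<open>- x\<close>; minimality
  of \<open>m x\<close> decides the sign of \<open>c\<close>. This is disjointness of the two parts
  in elementary form.\<close>

lemma le_pp_np:
  assumes "x \<in> X" "c \<preceq> pp x" "c \<preceq> np x" shows "c \<preceq> 0"
proof -
  have "m x \<preceq> m x - 2 *\<^sub>R c"
  proof (rule m_least_real)
    show "x \<preceq> m x - 2 *\<^sub>R c"
      using le_scale[of 2, OF _ assms(3)] by (simp add: np_def cone_le_def algebra_simps)
    show "- x \<preceq> m x - 2 *\<^sub>R c"
      using le_scale[of 2, OF _ assms(2)] by (simp add: pp_def cone_le_def algebra_simps)
  qed fact
  then have "2 *\<^sub>R (- c) \<in> P" by (simp add: cone_le_def)
  from P_scale[of "1/2", OF _ this] show ?thesis by (simp add: cone_le_def)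
qed

subsection \<open>Real-valued lattice homomorphisms\<close>

text \<open>Order ideals of the real part, without norm closure: they feed Zorn's lemma, and the
  homomorphisms built from them are purely algebraic. The ideals of the theorem are
  \<open>closed_ideals\<close>.\<close>

definition lattice_ideal :: "'a set \<Rightarrow> bool" where
  "lattice_ideal I \<longleftrightarrow> subspace I \<and> I \<subseteq> X \<and> (\<forall>x\<in>I. \<forall>y\<in>X. m y \<preceq> m x \<longrightarrow> y \<in> I)"

lemma lattice_idealD:
  assumes "lattice_ideal I"
  shows "0 \<in> I" "\<And>x y. x \<in> I \<Longrightarrow> y \<in> I \<Longrightarrow> x + y \<in> I" "\<And>r x. x \<in> I \<Longrightarrow> r *\<^sub>R x \<in> I"
    "\<And>x. x \<in> I \<Longrightarrow> x \<in> X" "\<And>x y. x \<in> I \<Longrightarrow> y \<in> X \<Longrightarrow> m y \<preceq> m x \<Longrightarrow> y \<in> I"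
    "\<And>x y. x \<in> I \<Longrightarrow> y \<in> P \<Longrightarrow> y \<preceq> x \<Longrightarrow> y \<in> I"
proof -
  show "0 \<in> I" "\<And>x y. x \<in> I \<Longrightarrow> y \<in> I \<Longrightarrow> x + y \<in> I" "\<And>r x. x \<in> I \<Longrightarrow> r *\<^sub>R x \<in> I"
    "\<And>x. x \<in> I \<Longrightarrow> x \<in> X" and solid: "\<And>x y. x \<in> I \<Longrightarrow> y \<in> X \<Longrightarrow> m y \<preceq> m x \<Longrightarrow> y \<in> I"
    using assms by (auto simp: lattice_ideal_def subspace_0 subspace_add subspace_scale)
  show "y \<in> I" if "x \<in> I" "y \<in> P" "y \<preceq> x" for x y
    using solid[of x y] that P_up[of y x] P_sub_X[of y] by simp
qed

definition ideal_join :: "'a set \<Rightarrow> 'a \<Rightarrow> 'a set" where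
  "ideal_join I w = {y \<in> X. \<exists>i\<in>I \<inter> P. \<exists>n\<ge>0. m y \<preceq> i + n *\<^sub>R m w}"

lemma lattice_ideal_join:
  assumes "lattice_ideal I" "w \<in> X"
  shows "lattice_ideal (ideal_join I w)" "I \<subseteq> ideal_join I w" "w \<in> ideal_join I w"
proof -
  note I = lattice_idealD[OF assms(1)]
  have "subspace (ideal_join I w)"
  proof (rule subspaceI)
    show "0 \<in> ideal_join I w"
      unfolding ideal_join_def using I(1) by (auto intro!: bexI[of _ 0] exI[of _ 0])
    fix x assume "x \<in> ideal_join I w"
    then obtain i n where x: "x \<in> X" "i \<in> I" "i \<in> P" "n \<ge> 0" "m x \<preceq> i + n *\<^sub>R m w"
      by (auto simp: ideal_join_def)
    show "r *\<^sub>R x \<in> ideal_join I w" for r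
    proof -
      have "m (r *\<^sub>R x) \<preceq> \<bar>r\<bar> *\<^sub>R i + (\<bar>r\<bar> * n) *\<^sub>R m w"
        using le_scale[OF abs_ge_zero[of r] x(5)] by (simp add: algebra_simps)
      moreover have "\<bar>r\<bar> *\<^sub>R i \<in> I \<inter> P" "\<bar>r\<bar> * n \<ge> 0" using x by (auto intro: P_scale I(3))
      ultimately show ?thesis unfolding ideal_join_def using x(1) by blast
    qed
    fix y assume "y \<in> ideal_join I w"
    then obtain j k where y: "y \<in> X" "j \<in> I" "j \<in> P" "k \<ge> 0" "m y \<preceq> j + k *\<^sub>R m w"
      by (auto simp: ideal_join_def)
    have "m (x + y) \<preceq> (i + j) + (n + k) *\<^sub>R m w"
      using cle_trans[OF m_add le_add[OF x(5) y(5)]] by (simp add: algebra_simps)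
    moreover have "i + j \<in> I \<inter> P" "n + k \<ge> 0" using x y by (auto intro: I(2) P_add)
    ultimately show "x + y \<in> ideal_join I w" unfolding ideal_join_def using x(1) y(1) by blast
  qed
  then show "lattice_ideal (ideal_join I w)"
    unfolding lattice_ideal_def by (auto simp: ideal_join_def intro: cle_trans)
  show "I \<subseteq> ideal_join I w"
  proof
    fix x assume "x \<in> I"
    then have "x \<in> X" "m x \<in> I \<inter> P" "m x \<preceq> m x + 0 *\<^sub>R m w"
      using I(4) I(5)[of x "m x"] by auto
    then show "x \<in> ideal_join I w" unfolding ideal_join_def by blast
  qed
  have "m w \<preceq> 0 + 1 *\<^sub>R m w" "(0::'a) \<in> I \<inter> P" using I(1) by auto
  then show "w \<in> ideal_join I w" unfolding ideal_join_def using assms(2) zero_le_one by blast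
qed

lemma lattice_ideal_zero: "lattice_ideal {0}"
proof -
  have "y = 0" if "m y \<preceq> 0" for y using cle_antisym[OF that] by simp
  then show ?thesis by (auto simp: lattice_ideal_def subspace_0)
qed

text \<open>Maximality is among the ideals avoiding \<open>u\<close>, not among all proper ideals:
  \<open>X\<close> need not have an order unit, whereas \<open>u\<close> is one in its own principal
  ideal.\<close>

definition maximal_without :: "'a \<Rightarrow> 'a set \<Rightarrow> bool" where
  "maximal_without u M \<longleftrightarrow> lattice_ideal M \<and> u \<notin> M \<and>
     (\<forall>I. lattice_ideal I \<and> u \<notin> I \<and> M \<subseteq> I \<longrightarrow> I = M)"

lemma maximal_ideal_exists:
  assumes "lattice_ideal I" "u \<notin> I"
  obtains M where "I \<subseteq> M" "maximal_without u M"
proof -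
  let ?F = "{J. lattice_ideal J \<and> u \<notin> J \<and> I \<subseteq> J}"
  have "\<exists>M\<in>?F. \<forall>J\<in>?F. M \<subseteq> J \<longrightarrow> J = M"
  proof (rule subset_Zorn_nonempty)
    show "?F \<noteq> {}" using assms by auto
    fix C assume C: "C \<noteq> {}" "subset.chain ?F C"
    have el: "\<And>J. J \<in> C \<Longrightarrow> lattice_ideal J \<and> u \<notin> J \<and> I \<subseteq> J"
      using C(2) by (auto simp: subset.chain_def)
    have "subspace (\<Union>C)"
    proof (rule subspaceI)
      show "0 \<in> \<Union>C" using C(1) el lattice_idealD(1) by blast
      show "x + y \<in> \<Union>C" if xy: "x \<in> \<Union>C" "y \<in> \<Union>C" for x y
      proof -
        obtain J K where JK: "J \<in> C" "x \<in> J" "K \<in> C" "y \<in> K" using xy by blast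
        then have "J \<subseteq> K \<or> K \<subseteq> J" using C(2) by (auto simp: subset.chain_def)
        then show ?thesis
        proof
          assume "J \<subseteq> K"
          with JK el[of K] have "x + y \<in> K" by (blast intro: lattice_idealD(2))
          then show ?thesis using JK by blast
        next
          assume "K \<subseteq> J"
          with JK el[of J] have "x + y \<in> J" by (blast intro: lattice_idealD(2))
          then show ?thesis using JK by blast
        qed
      qed
      show "r *\<^sub>R x \<in> \<Union>C" if "x \<in> \<Union>C" for r x
        using that el lattice_idealD(3) by blast
    qed
    moreover have "\<Union>C \<subseteq> X" using el lattice_idealD(4) by blast
    moreover have "\<forall>x\<in>\<Union>C. \<forall>y\<in>X. m y \<preceq> m x \<longrightarrow> y \<in> \<Union>C"
      using el lattice_idealD(5) by blast
    ultimately have "lattice_ideal (\<Union>C)" by (simp add: lattice_ideal_def)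
    then show "\<Union>C \<in> ?F" using C(1) el by blast
  qed
  then obtain M where M: "M \<in> ?F" "\<forall>J\<in>?F. M \<subseteq> J \<longrightarrow> J = M" by (rule bexE)
  have "J = M" if "lattice_ideal J" "u \<notin> J" "M \<subseteq> J" for J
  proof -
    have "J \<in> ?F" using that M(1) by auto
    then show ?thesis using M(2) that(3) by simp
  qed
  then have "maximal_without u M" using M(1) by (simp add: maximal_without_def)
  moreover have "I \<subseteq> M" using M(1) by simp
  ultimately show thesis using that by simp
qed

text \<open>Adjoining \<open>w\<close> to \<open>M\<close> must capture \<open>u\<close>. One extra
  copy of \<open>m w\<close> makes the coefficient strictly positive, so that later arguments can
  divide by it.\<close>

lemma maximal_dominated:
  assumes "maximal_without u M" "u \<in> P" "w \<in> X" "w \<notin> M"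
  obtains i n where "i \<in> M" "i \<in> P" "n > 0" "u \<preceq> i + n *\<^sub>R m w"
proof -
  have M: "lattice_ideal M" using assms(1) by (simp add: maximal_without_def)
  have "u \<in> ideal_join M w"
    using assms lattice_ideal_join[OF M assms(3)] unfolding maximal_without_def by blast
  then obtain i n where i: "i \<in> M" "i \<in> P" "n \<ge> 0" "m u \<preceq> i + n *\<^sub>R m w"
    by (auto simp: ideal_join_def)
  have "u \<preceq> (i + n *\<^sub>R m w) + m w"
    using le_add[OF i(4), of 0 "m w"] assms(2) by simp
  then have "u \<preceq> i + (n + 1) *\<^sub>R m w" by (simp add: algebra_simps)
  then show thesis using that[of i "n + 1"] i by auto
qed

text \<open>The quotient by \<open>M\<close> is totally ordered: if both parts were outside
  \<open>M\<close>, then modulo \<open>M\<close> a positive multiple of \<open>u\<close> would lie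
  below both of them, and their disjointness would force \<open>u\<close> into
  \<open>M\<close>.\<close>

lemma maximal_prime:
  assumes "maximal_without u M" "u \<in> P" "x \<in> X"
  shows "pp x \<in> M \<or> np x \<in> M"
proof (rule ccontr)
  assume "\<not> ?thesis"
  then have n: "pp x \<notin> M" "np x \<notin> M" by auto
  have M: "lattice_ideal M" "u \<notin> M" using assms(1) by (auto simp: maximal_without_def)
  note I = lattice_idealD[OF M(1)]
  obtain i n where i: "i \<in> M" "i \<in> P" "n > 0" "u \<preceq> i + n *\<^sub>R pp x"
    using maximal_dominated[OF assms(1,2) P_sub_X n(1)] assms(3) by auto
  obtain j k where j: "j \<in> M" "j \<in> P" "k > 0" "u \<preceq> j + k *\<^sub>R np x"
    using maximal_dominated[OF assms(1,2) P_sub_X n(2)] assms(3) by auto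
  let ?N = "n + k"
  have "u \<preceq> (i + n *\<^sub>R pp x) + (j + k *\<^sub>R pp x)"
    using le_add[OF i(4), of 0 "j + k *\<^sub>R pp x"] i j assms(3) by (simp add: P_add P_scale)
  then have a: "?N *\<^sub>R ((1/?N) *\<^sub>R (u - (i + j))) \<preceq> ?N *\<^sub>R pp x"
    using i(3) j(3) by (simp add: cone_le_def algebra_simps)
  have "u \<preceq> (i + n *\<^sub>R np x) + (j + k *\<^sub>R np x)"
    using le_add[OF j(4), of 0 "i + n *\<^sub>R np x"] i j assms(3) by (simp add: P_add P_scale algebra_simps)
  then have b: "?N *\<^sub>R ((1/?N) *\<^sub>R (u - (i + j))) \<preceq> ?N *\<^sub>R np x"
    using i(3) j(3) by (simp add: cone_le_def algebra_simps)
  have "(1/?N) *\<^sub>R (u - (i + j)) \<preceq> 0"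
    using le_pp_np[OF assms(3)] le_scale_cancel[OF _ a] le_scale_cancel[OF _ b] i(3) j(3) by auto
  then have "(1/?N) *\<^sub>R (u - (i + j)) \<preceq> (1/?N) *\<^sub>R 0" by simp
  then have "u - (i + j) \<preceq> 0" by (rule le_scale_cancel[rotated]) (use i(3) j(3) in simp)
  then have "u \<preceq> i + j" by (simp add: cone_le_def)
  then show False using I(6)[OF I(2)[OF i(1) j(1)] assms(2)] M(2) by simp
qed

text \<open>Modulo \<open>M\<close> the order is total and every element outside \<open>M\<close>
  has a multiple of its modulus above \<open>u\<close>, so a Dedekind cut finds the residue:
  \<open>l\<close> is the supremum of the scalars whose multiple of \<open>u\<close> lies below
  \<open>x\<close> modulo \<open>M\<close>.\<close>

lemma maximal_value:
  assumes max: "maximal_without u M" and u: "u \<in> P" and x: "x \<in> X" "m x \<preceq> C *\<^sub>R u"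
  shows "\<exists>!l. x - l *\<^sub>R u \<in> M"
proof -
  have M: "lattice_ideal M" "u \<notin> M" using max by (auto simp: maximal_without_def)
  note I = lattice_idealD[OF M(1)]
  have uX: "u \<in> X" using u by (rule P_sub_X)
  have small: False if "r > 0" "r *\<^sub>R u \<preceq> j" "j \<in> M" for r j
  proof -
    have "u \<preceq> (1/r) *\<^sub>R j" using le_scale[OF _ that(2), of "1/r"] that(1) by simp
    then show False using I(6)[OF I(3)[OF that(3)] u] M(2) by simp
  qed
  have xl: "x \<preceq> C *\<^sub>R u" "- x \<preceq> C *\<^sub>R u" 
    by (rule cle_trans[OF real_le_m(1)[OF x(1)] x(2)], rule cle_trans[OF real_le_m(2)[OF x(1)] x(2)])
  have d: "x - l *\<^sub>R u \<in> X" for l using x uX by auto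
  define S where "S = {l. np (x - l *\<^sub>R u) \<in> M}"
  have np_le: "- np (x - l *\<^sub>R u) \<preceq> x - l *\<^sub>R u" for l
  proof -
    have "(x - l *\<^sub>R u) - (- np (x - l *\<^sub>R u)) = pp (x - l *\<^sub>R u)"
      using pp_np(1)[of "x - l *\<^sub>R u"] by (simp add: diff_eq_eq)
    then show ?thesis using pp_P[OF d[of l]] by (simp add: cone_le_def)
  qed
  have bd: "l \<le> C" if "l \<in> S" for l
  proof (rule ccontr)
    assume "\<not> l \<le> C"
    then have "l - C > 0" by simp
    moreover have "(l - C) *\<^sub>R u \<preceq> np (x - l *\<^sub>R u)"
      using le_add[OF np_le[of l] xl(1)] by (simp add: cone_le_def algebra_simps)
    ultimately show False by (rule small) (use that in \<open>simp add: S_def\<close>)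
  qed
  have "x + C *\<^sub>R u \<in> P" using xl(2) by (simp add: cone_le_def algebra_simps)
  then have "np (x - (-C) *\<^sub>R u) = 0" by (subst np_eq_0) (auto simp: P_sub_X)
  then have ne: "-C \<in> S" by (simp add: S_def I(1))
  have bdd: "bdd_above S" using bd by (rule bdd_aboveI)
  define l where "l = Sup S"
  define y where "y = x - l *\<^sub>R u"
  have yX: "y \<in> X" using d by (simp add: y_def)
  have "y \<in> M"
  proof (rule ccontr)
    assume "y \<notin> M"
    then obtain i n where i: "i \<in> M" "i \<in> P" "n > 0" "u \<preceq> i + n *\<^sub>R m y"
      using maximal_dominated[OF max u yX] by blast
    from maximal_prime[OF max u yX] show False
    proof
      assume np: "np y \<in> M"
      define k where "k = i + (2 * n) *\<^sub>R np y"
      have k: "k \<in> M" "k \<in> P" using i np yX by (auto simp: k_def intro!: P_add P_scale I(2,3))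
      have "m y = y + 2 *\<^sub>R np y" by (simp add: np_def)
      \<comment> \<open>Modulo \<open>M\<close>, the remainder \<open>y\<close> is at least
        \<open>u/n\<close>, so the cut could be raised by \<open>1/n\<close>.\<close>
      then have "u \<preceq> k + n *\<^sub>R y" using i(4) by (simp add: k_def algebra_simps)
      then have "(1/n) *\<^sub>R u \<preceq> (1/n) *\<^sub>R (k + n *\<^sub>R y)" by (rule le_scale[rotated]) (use i in simp)
      then have 1: "- (y - (1/n) *\<^sub>R u) \<preceq> (1/n) *\<^sub>R k"
        using i(3) by (simp add: cone_le_def algebra_simps)
      have "np (y - (1/n) *\<^sub>R u) \<preceq> (1/n) *\<^sub>R k"
        by (rule np_least[OF _ 1]) (use yX uX k i(3) in \<open>auto intro: P_scale\<close>)
      then have "np (y - (1/n) *\<^sub>R u) \<in> M"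
        using I(6)[OF I(3)[OF k(1)]] yX uX by auto
      then have "l + 1/n \<in> S" by (simp add: S_def y_def algebra_simps)
      then show False using cSup_upper[OF _ bdd] i(3) by (fastforce simp: l_def)
    next
      assume pp: "pp y \<in> M"
      define k where "k = i + (2 * n) *\<^sub>R pp y"
      have k: "k \<in> M" "k \<in> P" using i pp yX by (auto simp: k_def intro!: P_add P_scale I(2,3))
      have my: "m y = 2 *\<^sub>R pp y - y" by (simp add: pp_def)
      have 1: "u \<preceq> k - n *\<^sub>R y" using i(4)[unfolded my] by (simp add: k_def algebra_simps)
      \<comment> \<open>The gap \<open>1/(2*n)\<close> gives away only half of \<open>u\<close> in
        the next estimate; the other half stays bounded by an element of \<open>M\<close>.\<close>
      obtain l' where l': "l' \<in> S" "l - 1/(2*n) < l'"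
        using less_cSupD[of S "l - 1/(2*n)"] ne i(3) by (auto simp: l_def)
      define q where "q = np (x - l' *\<^sub>R u)"
      have q: "q \<in> M" using l' by (simp add: S_def q_def)
      have "(n * (1/(2*n) - (l - l'))) *\<^sub>R u \<in> P" using u l' i(3) by (intro P_scale) auto
      then have "(1/2 - n * l + n * l') *\<^sub>R u \<in> P" using i(3) by (simp add: algebra_simps)
      moreover have "n *\<^sub>R (- q) \<preceq> n *\<^sub>R (x - l' *\<^sub>R u)"
        using np_le[of l'] i(3) by (intro le_scale) (auto simp: q_def)
      moreover note 1
      ultimately have "((k - n *\<^sub>R y) - u) + (n *\<^sub>R (x - l' *\<^sub>R u) - n *\<^sub>R (- q)) + (1/2 - n * l + n * l') *\<^sub>R u \<in> P"
        unfolding cone_le_def by (intro P_add)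
      moreover have "((k - n *\<^sub>R y) - u) + (n *\<^sub>R (x - l' *\<^sub>R u) - n *\<^sub>R (- q)) + (1/2 - n * l + n * l') *\<^sub>R u
          = (k + n *\<^sub>R q) + (1/2 - 1) *\<^sub>R u"
        unfolding y_def scaleR_left_diff_distrib scaleR_left_distrib scaleR_diff_right scaleR_scaleR
        by simp
      moreover have "(k + n *\<^sub>R q) + (1/2 - 1) *\<^sub>R u = (k + n *\<^sub>R q) - (1/2) *\<^sub>R u" by simp
      ultimately have "(1/2) *\<^sub>R u \<preceq> k + n *\<^sub>R q" unfolding cone_le_def by (simp only:)
      then show False using small[of "1/2"] I(2)[OF k(1) I(3)[OF q]] by auto
    qed
  qed
  moreover have "l1 = l2" if "x - l1 *\<^sub>R u \<in> M" "x - l2 *\<^sub>R u \<in> M" for l1 l2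
  proof (rule ccontr)
    assume "l1 \<noteq> l2"
    have "(1/(l2 - l1)) *\<^sub>R ((x - l1 *\<^sub>R u) + (-1) *\<^sub>R (x - l2 *\<^sub>R u)) \<in> M" by (intro I(2,3) that)
    moreover have "(x - l1 *\<^sub>R u) + (-1) *\<^sub>R (x - l2 *\<^sub>R u) = (l2 - l1) *\<^sub>R u"
      by (simp add: algebra_simps)
    ultimately show False using M(2) \<open>l1 \<noteq> l2\<close> by simp
  qed
  ultimately show ?thesis unfolding y_def by blast
qed

text \<open>Unlike a \<open>lattice_ideal\<close>, this contains non-real vectors, because
  homomorphisms are also evaluated at complex elements.\<close>

definition principal :: "'a \<Rightarrow> 'a set" where
  "principal u = {x. \<exists>C. m x \<preceq> C *\<^sub>R u}"

text \<open>Values of \<open>\<phi>\<close> outside the principal ideal of \<open>u\<close> are irrelevant.\<close>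

definition hom :: "'a \<Rightarrow> ('a \<Rightarrow> real) \<Rightarrow> bool" where
  "hom u \<phi> \<longleftrightarrow> u \<in> P \<and>
     (\<forall>x\<in>principal u. \<forall>y\<in>principal u. \<phi> (x + y) = \<phi> x + \<phi> y) \<and>
     (\<forall>x\<in>principal u. \<forall>r. \<phi> (r *\<^sub>R x) = r * \<phi> x) \<and>
     (\<forall>x\<in>principal u. \<phi> (re x) = \<phi> x) \<and>
     (\<forall>x\<in>principal u. \<phi> (m x) = cmod (Complex (\<phi> x) (\<phi> (im x)))) \<and> \<phi> u = 1"

lemma principal_dom:
  assumes "x \<in> principal u" "m y \<preceq> r *\<^sub>R m x" "0 \<le> r"
  shows "y \<in> principal u"
proof -
  obtain C where "m x \<preceq> C *\<^sub>R u" using assms(1) by (auto simp: principal_def)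
  then have "m y \<preceq> (r * C) *\<^sub>R u"
    using cle_trans[OF assms(2) le_scale[OF assms(3)]] by fastforce
  then show ?thesis by (auto simp: principal_def)
qed

lemma principal_le:
  assumes "x \<in> principal u" "m y \<preceq> m x" shows "y \<in> principal u"
  using principal_dom[OF assms(1), of y 1] assms(2) by simp

lemma principal_P:
  assumes "x \<in> principal u" "x \<in> P" "y \<in> P" "y \<preceq> x" shows "y \<in> principal u"
  using principal_le[OF assms(1), of y] assms by simp

lemma principal_add: "x \<in> principal u \<Longrightarrow> y \<in> principal u \<Longrightarrow> x + y \<in> principal u"
proof -
  assume "x \<in> principal u" "y \<in> principal u"
  then obtain C D where "m x \<preceq> C *\<^sub>R u" "m y \<preceq> D *\<^sub>R u" by (auto simp: principal_def)
  then have "m (x + y) \<preceq> (C + D) *\<^sub>R u"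
    using cle_trans[OF m_add le_add] by (simp add: scaleR_left_distrib)
  then show ?thesis by (auto simp: principal_def)
qed

lemma principal_scale: "x \<in> principal u \<Longrightarrow> r *\<^sub>R x \<in> principal u"
  by (rule principal_dom[where r = "\<bar>r\<bar>"]) auto

lemma principal_0: "u \<in> P \<Longrightarrow> 0 \<in> principal u"
  by (auto simp: principal_def intro: exI[of _ 0])

lemma principal_self: "u \<in> P \<Longrightarrow> u \<in> principal u"
  by (auto simp: principal_def intro: exI[of _ 1])

lemma principal_minus: "x \<in> principal u \<Longrightarrow> - x \<in> principal u"
  using principal_scale[of x u "-1"] by simp

lemma principal_diff: "x \<in> principal u \<Longrightarrow> y \<in> principal u \<Longrightarrow> x - y \<in> principal u"
  using principal_add[OF _ principal_minus] by fastforce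

lemma principal_re: "x \<in> principal u \<Longrightarrow> re x \<in> principal u"
  and principal_im: "x \<in> principal u \<Longrightarrow> im x \<in> principal u"
  and principal_iota: "x \<in> principal u \<Longrightarrow> \<iota> x \<in> principal u"
  and principal_m: "x \<in> principal u \<Longrightarrow> m x \<in> principal u"
  by (auto intro: principal_le m_re_le m_im_le m_iota)

lemma principal_pp: "x \<in> principal u \<Longrightarrow> pp x \<in> principal u"
  and principal_np: "x \<in> principal u \<Longrightarrow> np x \<in> principal u"
  unfolding pp_def np_def
  by (auto intro: principal_scale principal_add principal_diff principal_m)

lemmas principal_intros = principal_add principal_scale principal_minus principal_diff
  principal_re principal_im principal_iota principal_m principal_pp principal_np

text \<open>Choosing \<open>s\<close> such that a homomorphism annihilates the second rotated part evaluates it on \<open>m x\<close>,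
  although it need not preserve the infinite supremum that defines \<open>m x\<close>.\<close>

lemma m_rotate: "m x \<preceq> m (cos s *\<^sub>R re x + sin s *\<^sub>R im x) + m (cos s *\<^sub>R im x - sin s *\<^sub>R re x)"
proof (rule m_least)
  fix t
  let ?a = "cos s *\<^sub>R re x + sin s *\<^sub>R im x" and ?b = "cos s *\<^sub>R im x - sin s *\<^sub>R re x"
  have r: "?a \<in> X" "?b \<in> X" by auto
  have *: "c *\<^sub>R y \<preceq> m y" if "y \<in> X" "\<bar>c\<bar> \<le> 1" for c y
  proof -
    have "c *\<^sub>R y \<preceq> \<bar>c\<bar> *\<^sub>R m y" using real_le_m(1)[of "c *\<^sub>R y"] that by simp
    moreover have "(1 - \<bar>c\<bar>) *\<^sub>R m y \<in> P" using that by (intro P_scale) auto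
    ultimately show ?thesis using cle_trans by (fastforce simp: cone_le_def algebra_simps)
  qed
  have "cos (t - s) *\<^sub>R ?a + sin (t - s) *\<^sub>R ?b \<preceq> m ?a + m ?b"
    using r by (intro le_add *) auto
  moreover have "cos (t - s) *\<^sub>R ?a + sin (t - s) *\<^sub>R ?b
      = (cos (t - s) * cos s - sin (t - s) * sin s) *\<^sub>R re x
      + (cos (t - s) * sin s + sin (t - s) * cos s) *\<^sub>R im x"
    by (simp add: algebra_simps)
  moreover have "cos (t - s) * cos s - sin (t - s) * sin s = cos t"
    using cos_add[of "t - s" s] by simp
  moreover have "cos (t - s) * sin s + sin (t - s) * cos s = sin t"
    using sin_add[of "t - s" s] by simp
  ultimately show "cos t *\<^sub>R re x + sin t *\<^sub>R im x \<preceq> m ?a + m ?b" by simp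
qed

text \<open>The homomorphism reads off the residue of \<open>re x\<close> modulo \<open>M\<close> as
  a multiple of \<open>u\<close>. For real vectors, compatibility with the modulus comes from the
  reverse triangle inequality; the general case is reduced to that one by a rotation.\<close>

lemma maximal_hom:
  assumes max: "maximal_without u M" and u: "u \<in> P"
  obtains \<phi> where "hom u \<phi>" "\<And>x. x \<in> M \<Longrightarrow> x \<in> principal u \<Longrightarrow> \<phi> x = 0"
proof -
  have M: "lattice_ideal M" "u \<notin> M" using max by (auto simp: maximal_without_def)
  note I = lattice_idealD[OF M(1)]
  define \<phi> where "\<phi> x = (THE l. re x - l *\<^sub>R u \<in> M)" for x
  have ex: "\<exists>!l. re x - l *\<^sub>R u \<in> M" if x: "x \<in> principal u" for x
  proof -
    obtain C where "m (re x) \<preceq> C *\<^sub>R u" using principal_re[OF x] unfolding principal_def by blast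
    then show ?thesis by (rule maximal_value[OF max u re_im_X(1)])
  qed
  have mem: "re x - \<phi> x *\<^sub>R u \<in> M" if "x \<in> principal u" for x
    unfolding \<phi>_def by (rule theI'[OF ex[OF that]])
  have eqI: "\<phi> x = l" if "x \<in> principal u" "re x - l *\<^sub>R u \<in> M" for x l
    using ex[OF that(1)] mem[OF that(1)] that(2) by blast
  have neg: "- x \<in> M" if "x \<in> M" for x using I(3)[OF that, of "-1"] by simp
  have add: "\<phi> (x + y) = \<phi> x + \<phi> y" if "x \<in> principal u" "y \<in> principal u" for x y
    using I(2)[OF mem[OF that(1)] mem[OF that(2)]] that
    by (intro eqI principal_add) (auto simp: algebra_simps)
  have scale: "\<phi> (r *\<^sub>R x) = r * \<phi> x" if "x \<in> principal u" for x r
    using I(3)[OF mem[OF that(1)], of r] that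
    by (intro eqI principal_scale) (auto simp: algebra_simps)
  have re: "\<phi> (re x) = \<phi> x" for x by (simp add: \<phi>_def)
  have one: "\<phi> u = 1" using u by (intro eqI principal_self) (auto simp: I(1))
  have absr: "\<phi> (m x) = \<bar>\<phi> x\<bar>" if "x \<in> principal u" "x \<in> X" for x
  proof (rule eqI)
    have "m (m x - m (\<phi> x *\<^sub>R u)) \<preceq> m (x - \<phi> x *\<^sub>R u)" by (rule m_reverse)
    then have "m x - \<bar>\<phi> x\<bar> *\<^sub>R u \<in> M"
      using I(5)[OF mem[OF that(1)], of "m x - \<bar>\<phi> x\<bar> *\<^sub>R u"] that u P_sub_X[OF u] by (simp add: re_real)
    then show "re (m x) - \<bar>\<phi> x\<bar> *\<^sub>R u \<in> M" by simp
  qed (use that in \<open>auto intro: principal_m\<close>)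
  have mono: "\<phi> x \<le> \<phi> y" if "x \<in> principal u" "y \<in> principal u" "x \<preceq> y" "x \<in> X" "y \<in> X" for x y
  proof -
    have "y - x \<in> P" using that by (simp add: cone_le_def)
    then have "\<phi> (y - x) = \<bar>\<phi> (y - x)\<bar>" using absr[of "y - x"] that principal_diff by simp
    moreover have "\<phi> (y + (-1) *\<^sub>R x) = \<phi> y + - 1 * \<phi> x"
      using add[OF that(2) principal_scale[OF that(1), of "-1"]] scale[OF that(1), of "-1"] by simp
    ultimately show ?thesis by simp
  qed
  have abs: "\<phi> (m x) = cmod (Complex (\<phi> x) (\<phi> (im x)))" if x: "x \<in> principal u" for x
  proof -
    obtain r s where rs: "Complex (\<phi> x) (\<phi> (im x)) = rcis r s" "r = cmod (Complex (\<phi> x) (\<phi> (im x)))"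
      using rcis_cmod_Arg by metis
    have c: "\<phi> x = r * cos s" "\<phi> (im x) = r * sin s"
      using rs(1) by (simp_all add: rcis_def cis.ctr complex_eq_iff)
    let ?a = "cos s *\<^sub>R re x + sin s *\<^sub>R im x" and ?b = "cos s *\<^sub>R im x - sin s *\<^sub>R re x"
    have b': "?b = cos s *\<^sub>R im x + (- sin s) *\<^sub>R re x" by simp
    have pr: "?a \<in> principal u" "?b \<in> principal u" using x by (auto intro!: principal_intros)
    have "\<phi> ?a = cos s * \<phi> x + sin s * \<phi> (im x)"
      using x by (subst add) (auto intro!: principal_intros simp: scale re principal_re principal_im)
    also have "\<dots> = r * ((cos s)\<^sup>2 + (sin s)\<^sup>2)" unfolding c by (simp only: power2_eq_square algebra_simps)
    finally have a: "\<phi> ?a = r" by simp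
    have "\<phi> ?b = cos s * \<phi> (im x) + (- sin s) * \<phi> x"
      unfolding b' using x by (subst add) (auto intro!: principal_intros simp: scale re principal_re principal_im simp del: scaleR_minus_left)
    then have b: "\<phi> ?b = 0" unfolding c by simp
    have "\<phi> (m x) \<le> \<phi> (m ?a + m ?b)"
      using m_rotate[of x s] pr x by (intro mono) (auto intro!: principal_intros)
    also have "\<dots> = \<bar>r\<bar> + 0" using pr a b by (simp add: add absr principal_m)
    finally have "\<phi> (m x) \<le> r" using rs(2) by simp
    moreover have "\<phi> ?a \<le> \<phi> (m x)" using m_upper[of s x] pr x by (intro mono) (auto intro!: principal_intros)
    ultimately show ?thesis using a rs(2) by simp
  qed
  have "hom u \<phi>" unfolding hom_def using add scale re abs one u by blast
  moreover have "\<phi> x = 0" if "x \<in> M" "x \<in> principal u" for x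
    using that I(4) by (intro eqI) (auto simp: re_real)
  ultimately show thesis using that by blast
qed

lemma homD:
  assumes "hom u \<phi>"
  shows hom_P: "u \<in> P" and hom_add: "\<And>x y. x \<in> principal u \<Longrightarrow> y \<in> principal u \<Longrightarrow> \<phi> (x + y) = \<phi> x + \<phi> y"
    and hom_scale: "\<And>x r. x \<in> principal u \<Longrightarrow> \<phi> (r *\<^sub>R x) = r * \<phi> x"
    and hom_re: "\<And>x. x \<in> principal u \<Longrightarrow> \<phi> (re x) = \<phi> x"
    and hom_m: "\<And>x. x \<in> principal u \<Longrightarrow> \<phi> (m x) = cmod (Complex (\<phi> x) (\<phi> (im x)))"
    and hom_unit: "\<phi> u = 1"
  using assms by (simp_all add: hom_def)

context
  fixes u :: 'a and \<phi> :: "'a \<Rightarrow> real"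
  assumes h: "hom u \<phi>"
begin

lemma hom_minus: "x \<in> principal u \<Longrightarrow> \<phi> (- x) = - \<phi> x"
  using hom_scale[OF h, of x "-1"] by simp

lemma hom_diff: "x \<in> principal u \<Longrightarrow> y \<in> principal u \<Longrightarrow> \<phi> (x - y) = \<phi> x - \<phi> y"
  using hom_add[OF h, of x "- y"] by (simp add: hom_minus principal_minus)

lemma hom_0: "\<phi> 0 = 0"
  using hom_scale[OF h principal_self[OF hom_P[OF h]], of 0] by simp

lemma hom_m_real: "x \<in> principal u \<Longrightarrow> x \<in> X \<Longrightarrow> \<phi> (m x) = \<bar>\<phi> x\<bar>"
  by (simp add: hom_m[OF h] im_real hom_0 complex_norm)

lemma hom_pos: "x \<in> principal u \<Longrightarrow> x \<in> P \<Longrightarrow> 0 \<le> \<phi> x"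
  using hom_m_real[of x] by (simp add: P_sub_X)

lemma hom_mono: "x \<in> principal u \<Longrightarrow> y \<in> principal u \<Longrightarrow> x \<preceq> y \<Longrightarrow> \<phi> x \<le> \<phi> y"
  using hom_pos[of "y - x"] by (simp add: cone_le_def hom_diff principal_diff)

lemma hom_pp: "x \<in> principal u \<Longrightarrow> x \<in> X \<Longrightarrow> \<phi> (pp x) = max 0 (\<phi> x)"
  by (simp add: pp_def hom_scale[OF h] hom_add[OF h] principal_add principal_m hom_m_real)

lemma hom_np: "x \<in> principal u \<Longrightarrow> x \<in> X \<Longrightarrow> \<phi> (np x) = max 0 (- \<phi> x)"
  by (simp add: np_def hom_scale[OF h] hom_diff principal_diff principal_m hom_m_real)

end

lemmas hom_simps = hom_add hom_scale hom_minus hom_diff hom_re hom_m_real hom_pp hom_np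

text \<open>The lattice norm supplies this property: the positive part of \<open>x\<close> lies
  below every positive multiple of \<open>v\<close>, so its norm is zero.\<close>

lemma archimedean:
  assumes "x \<in> X" "v \<in> P" "\<And>e. 0 < e \<Longrightarrow> x \<preceq> e *\<^sub>R v"
  shows "x \<preceq> 0"
proof -
  have "norm (pp x) \<le> e" if e: "0 < e" for e
  proof -
    define d where "d = e / (norm v + 1)"
    have d: "d > 0" using e by (simp add: d_def add_nonneg_pos)
    have "pp x \<preceq> d *\<^sub>R v" using assms d by (intro pp_least) (auto intro: P_scale)
    then have "norm (pp x) \<le> norm (d *\<^sub>R v)" using assms d by (intro norm_mono) simp
    also have "\<dots> = e * (norm v / (norm v + 1))" using e by (simp add: d_def abs_of_nonneg)
    also have "\<dots> \<le> e * 1" using e by (intro mult_left_mono) (auto simp: divide_le_eq add_nonneg_pos)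
    finally show ?thesis by simp
  qed
  then have "pp x = 0" using field_le_epsilon[of "norm (pp x)" 0] by simp
  then show ?thesis using pp_eq_0[OF assms(1)] by simp
qed

text \<open>If \<open>np x\<close> is not zero, then \<open>np x\<close> still exceeds some
  \<open>e *\<^sub>R u\<close> somewhere; \<open>y\<close> is the difference. Its negative part
  generates an ideal avoiding \<open>u\<close>, and a homomorphism vanishing on \<open>np y\<close>
  has \<open>\<phi> (np x) \<ge> e\<close>, so it is negative at \<open>x\<close>.\<close>

lemma separate:
  assumes u: "u \<in> P" and x: "x \<in> X" "x \<in> principal u" and pos: "\<And>\<phi>. hom u \<phi> \<Longrightarrow> 0 \<le> \<phi> x"
  shows "x \<in> P"
proof (rule ccontr)
  assume "x \<notin> P"
  then have nz: "np x \<noteq> 0" using x np_eq_0 by blast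
  have "\<not> np x \<preceq> 0" using cle_antisym[of "np x" 0] nz x by auto
  then obtain e where e: "e > 0" "\<not> np x \<preceq> e *\<^sub>R u"
    using archimedean[of "np x" u] u x P_sub_X np_P by blast
  define y where "y = np x - e *\<^sub>R u"
  have yX: "y \<in> X" using x u by (simp add: y_def P_sub_X)
  have ypr: "y \<in> principal u"
    unfolding y_def using x u by (auto intro!: principal_intros principal_self)
  have s: "pp y \<noteq> 0"
  proof
    assume "pp y = 0"
    then show False using e(2) pp_eq_0[OF yX] by (simp add: y_def cone_le_def)
  qed
  have npX: "np y \<in> X" using yX by (simp add: P_sub_X)
  have "u \<notin> ideal_join {0} (np y)"
  proof
    assume "u \<in> ideal_join {0} (np y)"
    then obtain n where n: "n \<ge> 0" "u \<preceq> n *\<^sub>R np y" using u yX by (auto simp: ideal_join_def)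
    obtain C where C: "m (np x) \<preceq> C *\<^sub>R u" using principal_np[OF x(2)] by (auto simp: principal_def)
    \<comment> \<open>Since \<open>N\<close> is at least 1, \<open>(1/N) *\<^sub>R pp y\<close> lies
      below \<open>pp y\<close> as well as below \<open>np y\<close>, and disjointness of the parts
      applies.\<close>
    define N where "N = 1 + \<bar>C\<bar> * n"
    have N: "N \<ge> 1" using n by (simp add: N_def)
    have "pp y \<preceq> np x"
      using yX x u e by (intro pp_least) (auto simp: y_def cone_le_def intro: P_scale)
    also have "np x \<preceq> C *\<^sub>R u" using C x by simp
    also have "C *\<^sub>R u \<preceq> \<bar>C\<bar> *\<^sub>R u" using u P_scale[of "\<bar>C\<bar> - C" u] by (simp add: cone_le_def algebra_simps)
    also have "\<dots> \<preceq> \<bar>C\<bar> *\<^sub>R (n *\<^sub>R np y)" by (rule le_scale) (use n in auto)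
    also have "\<dots> \<preceq> N *\<^sub>R np y" using yX by (simp add: N_def cone_le_def algebra_simps)
    finally have "pp y \<preceq> N *\<^sub>R np y" .
    from le_scale[OF _ this, of "1/N"] have a: "(1/N) *\<^sub>R pp y \<preceq> np y" using N by simp
    have "(1 - 1/N) *\<^sub>R pp y \<in> P" using N yX by (intro P_scale) auto
    then have b: "(1/N) *\<^sub>R pp y \<preceq> pp y" by (simp add: cone_le_def algebra_simps)
    have "(1/N) *\<^sub>R pp y \<preceq> 0" by (rule le_pp_np[OF yX b a])
    moreover have "0 \<preceq> (1/N) *\<^sub>R pp y" using N yX by (simp add: P_scale)
    ultimately have "(1/N) *\<^sub>R pp y = 0" by (rule cle_antisym)
    then show False using s N by simp
  qed
  then obtain M where M: "ideal_join {0} (np y) \<subseteq> M" "maximal_without u M"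
    using maximal_ideal_exists lattice_ideal_join(1)[OF lattice_ideal_zero npX] by blast
  obtain \<phi> where \<phi>: "hom u \<phi>" "\<And>x. x \<in> M \<Longrightarrow> x \<in> principal u \<Longrightarrow> \<phi> x = 0"
    using maximal_hom[OF M(2) u] by blast
  have "np y \<in> M" using lattice_ideal_join(3)[OF lattice_ideal_zero npX] M(1) by blast
  then have "\<phi> (np y) = 0" using \<phi>(2) ypr principal_np by blast
  then have "\<phi> y \<ge> 0" using hom_np[OF \<phi>(1) ypr yX] by simp
  moreover have "\<phi> y = max 0 (- \<phi> x) - e"
    unfolding y_def using x u
    by (simp add: hom_simps[OF \<phi>(1)] hom_unit[OF \<phi>(1)] principal_np principal_self principal_scale)
  ultimately show False using e(1) pos[OF \<phi>(1)] by auto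
qed

lemma le_by_homs:
  assumes "u \<in> P" "x \<in> principal u" "y \<in> principal u" "x \<in> X" "y \<in> X"
    and "\<And>\<phi>. hom u \<phi> \<Longrightarrow> \<phi> x \<le> \<phi> y"
  shows "x \<preceq> y"
  unfolding cone_le_def
proof (rule separate[OF assms(1)])
  show "0 \<le> \<phi> (y - x)" if "hom u \<phi>" for \<phi>
    using assms(6)[OF that] hom_diff[OF that assms(3,2)] by simp
qed (use assms in \<open>auto intro: principal_diff\<close>)

text \<open>For non-real \<open>x\<close> the value at \<open>im x\<close> must vanish too: the two
  values together determine the one at \<open>m x\<close>.\<close>

lemma eq_0_by_homs:
  assumes "u \<in> P" "x \<in> principal u" "\<And>\<phi>. hom u \<phi> \<Longrightarrow> \<phi> x = 0" "\<And>\<phi>. hom u \<phi> \<Longrightarrow> \<phi> (im x) = 0"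
  shows "x = 0"
proof -
  have "\<phi> (m x) \<le> \<phi> 0" if h: "hom u \<phi>" for \<phi>
    unfolding hom_m[OF h assms(2)] assms(3)[OF h] assms(4)[OF h] hom_0[OF h] by (simp add: complex_norm)
  then have "m x \<preceq> 0"
    by (intro le_by_homs[of u]) (use assms(1,2) in \<open>auto intro: principal_m principal_0\<close>)
  then show ?thesis using cle_antisym[of "m x" 0] by simp
qed

lemma principal_I: "m x \<preceq> u \<Longrightarrow> x \<in> principal u"
  by (auto simp: principal_def intro: exI[of _ 1])

lemma le_add_P: "y \<in> P \<Longrightarrow> x \<preceq> x + y" "y \<in> P \<Longrightarrow> x \<preceq> y + x"
  by (simp_all add: cone_le_def)

lemma principal_sum: "x \<in> principal (m x + m y)" "y \<in> principal (m x + m y)"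
  by (rule principal_I, simp add: le_add_P)+

lemma principal_sum3: "x \<in> principal (m x + m y + m z)" "y \<in> principal (m x + m y + m z)"
  "z \<in> principal (m x + m y + m z)"
  by (rule principal_I, simp add: cone_le_def P_add algebra_simps)+

subsection \<open>Disjointness and closed ideals\<close>

definition meet :: "'a \<Rightarrow> 'a \<Rightarrow> 'a" where "meet x y = x - pp (x - y)"

lemma meet_le1: "x \<in> X \<Longrightarrow> y \<in> X \<Longrightarrow> meet x y \<preceq> x"
  by (simp add: meet_def cone_le_def)

lemma meet_le2: "x \<in> X \<Longrightarrow> y \<in> X \<Longrightarrow> meet x y \<preceq> y"
  using pp_np(1)[of "x - y"] np_P[of "x - y"] by (simp add: meet_def cone_le_def algebra_simps)

lemma meet_P: "x \<in> P \<Longrightarrow> y \<in> P \<Longrightarrow> meet x y \<in> P"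
  using pp_least[of "x - y" x] by (simp add: meet_def cone_le_def P_sub_X)

lemma hom_meet:
  assumes h: "hom u \<phi>" and "x \<in> principal u" "y \<in> principal u" "x \<in> X" "y \<in> X"
  shows "\<phi> (meet x y) = min (\<phi> x) (\<phi> y)"
  using assms(2-) by (simp add: meet_def hom_simps[OF h] principal_pp principal_diff)

lemma principal_meet: "x \<in> principal u \<Longrightarrow> y \<in> principal u \<Longrightarrow> meet x y \<in> principal u"
  by (simp add: meet_def principal_pp principal_diff)

definition disj :: "'a \<Rightarrow> 'a \<Rightarrow> bool" where "disj x y \<longleftrightarrow> meet (m x) (m y) = 0"

text \<open>A homomorphism sends the infimum to the minimum of two nonnegative reals, so
  disjointness can be tested value by value. The rules for sums and dominated vectors then become
  statements about real numbers.\<close>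

lemma disj_iff_homs:
  assumes "u \<in> P" "x \<in> principal u" "y \<in> principal u"
  shows "disj x y \<longleftrightarrow> (\<forall>\<phi>. hom u \<phi> \<longrightarrow> \<phi> (m x) = 0 \<or> \<phi> (m y) = 0)"
proof
  assume d: "disj x y"
  show "\<forall>\<phi>. hom u \<phi> \<longrightarrow> \<phi> (m x) = 0 \<or> \<phi> (m y) = 0"
  proof (intro allI impI)
    fix \<phi> assume h: "hom u \<phi>"
    have "\<phi> (meet (m x) (m y)) = 0" using d hom_0[OF h] by (simp add: disj_def)
    then show "\<phi> (m x) = 0 \<or> \<phi> (m y) = 0"
      using hom_meet[OF h, of "m x" "m y"] assms by (auto simp: principal_m min_def split: if_splits)
  qed
next
  assume h: "\<forall>\<phi>. hom u \<phi> \<longrightarrow> \<phi> (m x) = 0 \<or> \<phi> (m y) = 0"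
  show "disj x y"
    unfolding disj_def
  proof (rule eq_0_by_homs[of u])
    show "\<phi> (meet (m x) (m y)) = 0" if "hom u \<phi>" for \<phi>
    proof -
      have "0 \<le> \<phi> (m x)" "0 \<le> \<phi> (m y)" using assms by (simp_all add: hom_pos[OF that] principal_m)
      then show ?thesis using hom_meet[OF that, of "m x" "m y"] that h assms by (auto simp: principal_m)
    qed
    show "\<phi> (im (meet (m x) (m y))) = 0" if "hom u \<phi>" for \<phi>
      using hom_0[OF that] by (simp add: meet_P)
  qed (use assms in \<open>auto simp: principal_m principal_meet\<close>)
qed

lemma disj_sym: "disj x y \<Longrightarrow> disj y x"
proof -
  have "m x + m y \<in> P" by (simp add: P_add)
  note * = disj_iff_homs[OF this]
  assume "disj x y"
  then show ?thesis
    unfolding *[OF principal_sum] *[OF principal_sum(2,1)] by blast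
qed

lemma disj_dom: assumes "disj x y" "m z \<preceq> r *\<^sub>R m x" shows "disj z y"
proof -
  let ?u = "(m x + m y) + m z"
  have u: "?u \<in> P" and pr: "x \<in> principal ?u" "y \<in> principal ?u" "z \<in> principal ?u"
    by (simp_all add: P_add principal_sum3)
  have "\<phi> (m z) = 0" if h: "hom ?u \<phi>" "\<phi> (m x) = 0" for \<phi>
    using hom_mono[OF h(1) _ _ assms(2)] hom_pos[OF h(1), of "m z"] pr h
    by (simp add: principal_m principal_scale hom_scale[OF h(1)])
  then show ?thesis using assms(1) disj_iff_homs[OF u pr(1,2)] disj_iff_homs[OF u pr(3,2)] by blast
qed

lemma disj_le: "disj x y \<Longrightarrow> m z \<preceq> m x \<Longrightarrow> disj z y"
  using disj_dom[of x y z 1] by simp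

lemma disj_scale: "disj x y \<Longrightarrow> disj (r *\<^sub>R x) y"
  by (rule disj_dom[where r = "\<bar>r\<bar>"]) auto

lemma disj_add: assumes "disj x y" "disj z y" shows "disj (x + z) y"
proof -
  let ?u = "(m x + m y) + m z"
  have u: "?u \<in> P" and pr: "x \<in> principal ?u" "y \<in> principal ?u" "z \<in> principal ?u"
    by (simp_all add: P_add principal_sum3)
  have "\<phi> (m (x + z)) = 0" if h: "hom ?u \<phi>" "\<phi> (m x) = 0" "\<phi> (m z) = 0" for \<phi>
    using hom_mono[OF h(1) _ _ m_add[of x z]] hom_pos[OF h(1), of "m (x + z)"] pr h
    by (simp add: principal_m principal_add hom_add[OF h(1)])
  then show ?thesis using assms disj_iff_homs[OF u pr(1,2)] disj_iff_homs[OF u pr(3,2)]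
      disj_iff_homs[OF u principal_add[OF pr(1,3)] pr(2)] by blast
qed

lemma disj_self: "disj x x \<Longrightarrow> x = 0"
  by (simp add: disj_def meet_def pp_def)

lemma disj_0: "disj 0 x"
  by (simp add: disj_def meet_def pp_def)

lemma disj_pp_np: assumes "x \<in> X" shows "disj (pp x) (np x)"
proof -
  have "x \<in> principal (m x)" by (auto intro: principal_I)
  moreover have "\<phi> (pp x) = 0 \<or> \<phi> (np x) = 0" if "hom (m x) \<phi>" for \<phi>
    using hom_pp[OF that] hom_np[OF that] assms \<open>x \<in> principal (m x)\<close> by auto
  ultimately show ?thesis using assms
    by (subst disj_iff_homs[of "m x"]) (auto simp: principal_pp principal_np)
qed

text \<open>If \<open>z\<close> is disjoint from \<open>y\<close>, every homomorphism vanishes at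
  \<open>m z\<close> or at \<open>m y\<close>, which places \<open>meet (m x) (m y)\<close> below
  \<open>m (x - z)\<close>. Its norm is therefore at most the distance from \<open>x\<close> to any
  such \<open>z\<close>.\<close>

lemma closed_disj: "closed {x. disj x y}"
proof -
  have "x \<in> {x. disj x y}" if "x \<in> closure {x. disj x y}" for x
  proof -
    have "norm (meet (m x) (m y)) \<le> e" if e: "e > 0" for e
    proof -
      obtain z where z: "disj z y" "dist z x < e"
        using \<open>x \<in> closure {x. disj x y}\<close> e by (auto simp: closure_approachable)
      let ?u = "(m x + m y) + m z"
      have u: "?u \<in> P" and pr: "x \<in> principal ?u" "y \<in> principal ?u" "z \<in> principal ?u"
        by (simp_all add: P_add principal_sum3)
      have "meet (m x) (m y) \<preceq> m (x - z)"
      proof (rule le_by_homs[OF u])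
        fix \<phi> assume h: "hom ?u \<phi>"
        have "\<phi> (m ((x - z) + z)) \<le> \<phi> (m (x - z) + m z)"
          by (rule hom_mono[OF h _ _ m_add]) (use pr in \<open>auto intro!: principal_intros\<close>)
        then have "\<phi> (m x) \<le> \<phi> (m (x - z)) + \<phi> (m z)"
          using pr by (simp add: hom_add[OF h] principal_m principal_diff)
        moreover have "0 \<le> \<phi> (m (x - z))" using pr by (intro hom_pos[OF h]) (auto intro!: principal_intros)
        moreover have "\<phi> (m z) = 0 \<or> \<phi> (m y) = 0" using z(1) h disj_iff_homs[OF u pr(3,2)] by blast
        ultimately show "\<phi> (meet (m x) (m y)) \<le> \<phi> (m (x - z))"
          using pr by (auto simp: hom_meet[OF h] principal_m)
      qed (use pr in \<open>auto intro!: principal_intros principal_meet simp: P_sub_X meet_P\<close>)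
      then have "norm (meet (m x) (m y)) \<le> norm (x - z)" by (intro norm_mono) (simp add: meet_P)
      then show ?thesis using z(2) by (simp add: dist_norm norm_minus_commute)
    qed
    then have "meet (m x) (m y) = 0" using field_le_epsilon[of "norm (meet (m x) (m y))" 0] by simp
    then show ?thesis by (simp add: disj_def)
  qed
  then show ?thesis using closure_subset_eq by blast
qed

text \<open>Closure under \<open>\<iota>\<close> turns a real subspace into a complex one; with
  \<open>\<iota> = 0\<close> the same formula describes the closed ideals of a real lattice.\<close>

definition closed_ideals :: "'a set set" where
  "closed_ideals = {I. subspace I \<and> (\<forall>x\<in>I. \<iota> x \<in> I) \<and> closed I \<and> (\<forall>x\<in>I. \<forall>y. m y \<preceq> m x \<longrightarrow> y \<in> I)}"

lemma closed_idealsD: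
  assumes "I \<in> closed_ideals"
  shows "subspace I" "closed I" "\<And>x. x \<in> I \<Longrightarrow> \<iota> x \<in> I" "\<And>x y. x \<in> I \<Longrightarrow> m y \<preceq> m x \<Longrightarrow> y \<in> I"
  using assms unfolding closed_ideals_def by blast+

lemma polar_closed_ideal: "{x. \<forall>y\<in>S. disj x y} \<in> closed_ideals"
proof -
  have "closed (\<Inter>y\<in>S. {x. disj x y})" by (intro closed_INT ballI closed_disj)
  moreover have "(\<Inter>y\<in>S. {x. disj x y}) = {x. \<forall>y\<in>S. disj x y}" by auto
  moreover have "subspace {x. \<forall>y\<in>S. disj x y}"
    by (rule subspaceI) (auto intro: disj_0 disj_add disj_scale)
  ultimately show ?thesis
    by (auto simp: closed_ideals_def intro: disj_le m_iota)
qed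

text \<open>The witnesses are the polar of \<open>y\<close> and the second polar. Together with
  \<open>disj_if_ideals\<close> this expresses disjointness through closed ideals alone.\<close>

lemma closed_ideal_Int:
  assumes "disj x y"
  shows "\<exists>I J. I \<in> closed_ideals \<and> J \<in> closed_ideals \<and> x \<in> I \<and> y \<in> J \<and> I \<inter> J = {0}"
proof -
  let ?I = "{z. \<forall>w\<in>{y}. disj z w}"
  let ?J = "{z. \<forall>w\<in>?I. disj z w}"
  have "?I \<inter> ?J = {0}" using disj_0 disj_self by blast
  moreover have "x \<in> ?I" "y \<in> ?J" using assms disj_sym by blast+
  ultimately show ?thesis using polar_closed_ideal[of "{y}"] polar_closed_ideal[of ?I]
    by (intro exI[of _ ?I] exI[of _ ?J] conjI)
qed

lemma disj_if_ideals:
  assumes "I \<in> closed_ideals" "J \<in> closed_ideals" "x \<in> I" "y \<in> J" "I \<inter> J = {0}"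
  shows "disj x y"
proof -
  have "meet (m x) (m y) \<in> I" "meet (m x) (m y) \<in> J"
    using closed_idealsD(4)[OF assms(1,3), of "meet (m x) (m y)"] closed_idealsD(4)[OF assms(2,4), of "meet (m x) (m y)"]
    by (auto simp: meet_P meet_le1 meet_le2)
  then show ?thesis using assms(5) by (auto simp: disj_def)
qed

end

section \<open>Quotient norms and cone isometries\<close>

lemma infdist_less_ex:
  assumes "A \<noteq> {}" "infdist x A < r"
  shows "\<exists>a\<in>A. dist x a < r"
  using assms cINF_less_iff[of A "dist x" r] by (auto simp: infdist_notempty bdd_below_image_dist)

text \<open>\<open>infdist x J\<close> is the norm of the class of \<open>x\<close> in the quotient
  by \<open>J\<close>; this and the following facts are its seminorm laws.\<close>

lemma infdist_add_subspace:
  fixes J :: "'a::real_normed_vector set"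
  assumes "subspace J"
  shows "infdist (x + y) J \<le> infdist x J + infdist y J"
proof (rule field_le_epsilon)
  fix e :: real assume "e > 0"
  have ne: "J \<noteq> {}" using subspace_0[OF assms] by blast
  obtain a where a: "a \<in> J" "dist x a < infdist x J + e/2"
    using infdist_less_ex[OF ne, of x "infdist x J + e/2"] \<open>e > 0\<close> by auto
  obtain b where b: "b \<in> J" "dist y b < infdist y J + e/2"
    using infdist_less_ex[OF ne, of y "infdist y J + e/2"] \<open>e > 0\<close> by auto
  have "infdist (x + y) J \<le> dist (x + y) (a + b)"
    using subspace_add[OF assms a(1) b(1)] by (rule infdist_le)
  also have "\<dots> \<le> dist x a + dist y b" by (rule dist_triangle_add)
  finally show "infdist (x + y) J \<le> infdist x J + infdist y J + e" using a b by simp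
qed

lemma infdist_scaleR_le_subspace:
  fixes J :: "'a::real_normed_vector set"
  assumes "subspace J"
  shows "infdist (r *\<^sub>R x) J \<le> \<bar>r\<bar> * infdist x J"
proof (cases "r = 0")
  case True
  then show ?thesis using subspace_0[OF assms] by simp
next
  case False
  have ne: "J \<noteq> {}" using subspace_0[OF assms] by blast
  have "infdist (r *\<^sub>R x) J / \<bar>r\<bar> \<le> infdist x J"
    unfolding infdist_notempty[OF ne, of x]
  proof (rule cINF_greatest[OF ne])
    fix a assume "a \<in> J"
    then have "infdist (r *\<^sub>R x) J \<le> dist (r *\<^sub>R x) (r *\<^sub>R a)"
      by (intro infdist_le subspace_scale[OF assms])
    also have "\<dots> = \<bar>r\<bar> * dist x a" by (simp add: dist_norm flip: scaleR_diff_right)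
    finally show "infdist (r *\<^sub>R x) J / \<bar>r\<bar> \<le> dist x a" using False by (simp add: field_simps)
  qed
  then show ?thesis using False by (simp add: field_simps)
qed

lemma infdist_minus_subspace:
  fixes J :: "'a::real_normed_vector set"
  assumes "subspace J"
  shows "infdist (- x) J \<le> infdist x J"
  using infdist_scaleR_le_subspace[OF assms, of "-1" x] by simp

lemma infdist_diff_subspace:
  fixes J :: "'a::real_normed_vector set"
  assumes "subspace J"
  shows "infdist (x - y) J \<le> infdist x J + infdist y J"
  using infdist_add_subspace[OF assms, of x "- y"] infdist_minus_subspace[OF assms, of y] by simp

section \<open>Quotient norms modulo a closed ideal\<close>

context modulus_lattice
begin

text \<open>Each representative \<open>b - j\<close> of the class of \<open>b\<close> is matched by
  a representative \<open>pp t\<close> of the class of \<open>a\<close> with no larger modulus: what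
  is cut off from \<open>a\<close> lies between \<open>0\<close> and \<open>m j + c\<close>, hence
  in \<open>J\<close>.\<close>

lemma infdist_ideal_mono:
  assumes J: "J \<in> closed_ideals" and a: "a \<in> P" and c: "c \<in> P" "c \<in> J" and le: "a \<preceq> m b + c"
  shows "infdist a J \<le> infdist b J"
proof -
  have ne: "J \<noteq> {}" using subspace_0[OF closed_idealsD(1)[OF J]] by blast
  show ?thesis unfolding infdist_notempty[OF ne, of b]
  proof (rule cINF_greatest[OF ne])
    fix j assume j: "j \<in> J"
    define t where "t = a - (m j + c)"
    have tX: "t \<in> X" using a c by (simp add: t_def P_sub_X)
    have "m b \<preceq> m (b - j) + m j" using m_add[of "b - j" j] by simp
    then have "a \<preceq> m (b - j) + m j + c" using cle_trans[OF le] le_add[of "m b" _ c c] by simp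
    then have "t \<preceq> m (b - j)" by (simp add: t_def cone_le_def algebra_simps)
    then have t: "pp t \<preceq> m (b - j)" using tX by (intro pp_least) auto
    have "pp t \<preceq> a" using tX a c by (intro pp_least) (auto simp: t_def cone_le_def P_add)
    then have "a - pp t \<in> P" by (simp add: cone_le_def)
    moreover have "a - pp t \<preceq> m j + c"
      using pp_np(1)[of t] np_P[OF tX] by (simp add: t_def cone_le_def algebra_simps)
    moreover have "m j + c \<in> P" using c by (simp add: P_add)
    moreover have "m j + c \<in> J"
      using closed_idealsD(4)[OF J j, of "m j"] subspace_add[OF closed_idealsD(1)[OF J]] c by simp
    ultimately have "a - pp t \<in> J" using closed_idealsD(4)[OF J, of "m j + c" "a - pp t"] by simp
    then have "infdist a J \<le> dist a (a - pp t)" by (rule infdist_le)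
    also have "\<dots> = norm (pp t)" by (simp add: dist_norm)
    also have "\<dots> \<le> norm (b - j)" by (rule norm_mono) (use t tX in simp)
    finally show "infdist a J \<le> dist b j" by (simp add: dist_norm)
  qed
qed

text \<open>The factor 4 counts the positive and negative parts of \<open>re b\<close> and of
  \<open>im b\<close>, each of them dominated by \<open>m b\<close>. Only the existence of a fixed
  constant matters later.\<close>

lemma infdist_ideal_modulus:
  assumes J: "J \<in> closed_ideals"
  shows "infdist b J \<le> 4 * infdist (m b) J"
proof -
  have ne: "J \<noteq> {}" using subspace_0[OF closed_idealsD(1)[OF J]] by blast
  note d = infdist_diff_subspace[OF closed_idealsD(1)[OF J]]
  have iota: "infdist (\<iota> x) J \<le> infdist x J" for x
    unfolding infdist_notempty[OF ne, of x]
  proof (rule cINF_greatest[OF ne])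
    fix j assume "j \<in> J"
    then have "infdist (\<iota> x) J \<le> dist (\<iota> x) (\<iota> j)" by (intro infdist_le closed_idealsD(3)[OF J])
    also have "\<dots> \<le> dist x j" using norm_iota[of "x - j"] by (simp add: dist_norm)
    finally show "infdist (\<iota> x) J \<le> dist x j" .
  qed
  have real: "infdist x J \<le> 2 * infdist (m b) J" if "x \<in> X" "m x \<preceq> m b" for x
  proof -
    have "pp x \<preceq> m x" "np x \<preceq> m x" using that by (auto intro!: pp_least np_least real_le_m)
    then have "pp x \<preceq> m (m b) + 0" "np x \<preceq> m (m b) + 0" using cle_trans that(2) by fastforce+
    then have "infdist (pp x) J \<le> infdist (m b) J" "infdist (np x) J \<le> infdist (m b) J"
      using that subspace_0[OF closed_idealsD(1)[OF J]] by (auto intro!: infdist_ideal_mono[OF J])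
    then show ?thesis using d[of "pp x" "np x"] by (simp add: pp_np)
  qed
  have "infdist b J \<le> infdist (re b) J + infdist (\<iota> (im b)) J"
    using infdist_add_subspace[OF closed_idealsD(1)[OF J], of "re b" "\<iota> (im b)"] by (simp add: split)
  then show ?thesis using iota[of "im b"] real[of "re b"] real[of "im b"] m_re_le m_im_le by fastforce
qed

text \<open>The part of \<open>v\<close> exceeding \<open>a\<close> is dominated by
  \<open>c\<close>, so it lies in \<open>I\<close>; being also below \<open>v\<close>, which is
  disjoint from \<open>I\<close>, it is disjoint from itself.\<close>

lemma ideal_cut:
  assumes v: "v \<in> P" "\<And>j. j \<in> I \<Longrightarrow> disj v j" and a: "a \<in> P" and I: "I \<in> closed_ideals"
    and c: "c \<in> I" "c \<in> P" and le: "v \<preceq> a + c"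
  shows "v \<preceq> a"
proof -
  define t where "t = pp (v - a)"
  have X: "v - a \<in> X" using v a by (simp add: P_sub_X)
  have tP: "t \<in> P" using X by (simp add: t_def)
  have "t \<preceq> v" unfolding t_def using X v a by (intro pp_least) (auto simp: cone_le_def)
  have "t \<preceq> c" unfolding t_def using X c le by (intro pp_least) (auto simp: cone_le_def algebra_simps)
  then have "t \<in> I" using closed_idealsD(4)[OF I c(1), of t] tP c by simp
  then have "disj v t" by (rule v(2))
  then have "disj t t" by (rule disj_le) (use \<open>t \<preceq> v\<close> tP v in simp)
  then have "t = 0" by (rule disj_self)
  then show ?thesis using pp_eq_0[OF X] by (simp add: t_def cone_le_def)
qed

text \<open>On the region where \<open>R x \<le> q x\<close> with \<open>q < 1\<close> the powers of \<open>R\<close> tend to zero, which is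
  incompatible with \<open>R\<close> preserving norms; and if \<open>d = R x - x \<ge> 0\<close>, then \<open>R\<^sup>k x \<ge> x + k d\<close>.\<close>

context
  fixes R :: "'a \<Rightarrow> 'a"
  assumes R: "\<And>x. x \<in> P \<Longrightarrow> R x \<in> P" and add: "\<And>x y. x \<in> P \<Longrightarrow> y \<in> P \<Longrightarrow> R (x + y) = R x + R y"
    and scale: "\<And>r x. 0 \<le> r \<Longrightarrow> x \<in> P \<Longrightarrow> R (r *\<^sub>R x) = r *\<^sub>R R x"
    and norm: "\<And>x. x \<in> P \<Longrightarrow> norm (R x) = norm x"
    and ideal: "\<And>I x. I \<in> closed_ideals \<Longrightarrow> x \<in> I \<Longrightarrow> x \<in> P \<Longrightarrow> R x \<in> I"
begin

lemma cone_isometry_ge: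
  assumes x: "x \<in> P"
  shows "x \<preceq> R x"
proof -
  have mono: "R a \<preceq> R b" if "a \<preceq> b" "a \<in> P" "b \<in> P" for a b
    using add[of a "b - a"] R[of "b - a"] that by (simp add: cone_le_def)
  have Rk: "(R ^^ k) a \<in> P" "norm ((R ^^ k) a) = norm a" if "a \<in> P" for k a
    using that by (induction k) (auto simp: R norm)
  have lower: "q *\<^sub>R x \<preceq> R x" if q: "0 < q" "q < 1" for q
  proof -
    define y where "y = q *\<^sub>R x - R x"
    define s where "s = pp y"
    \<comment> \<open>\<open>s\<close> carries the region where \<open>R x\<close> falls below
      \<open>q *\<^sub>R x\<close>; modulo its polar \<open>I\<close>, the map \<open>R\<close>
      contracts \<open>x\<close> by the factor \<open>q\<close>.\<close>
    define I where "I = {v. \<forall>w\<in>{s}. disj v w}"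
    define c where "c = np y"
    have yX: "y \<in> X" using x R[OF x] by (simp add: y_def P_sub_X)
    have sP: "s \<in> P" and cP: "c \<in> P" using yX by (simp_all add: s_def c_def)
    have I: "I \<in> closed_ideals" unfolding I_def by (rule polar_closed_ideal)
    note sub = closed_idealsD(1)[OF I]
    have cI: "c \<in> I" using disj_sym[OF disj_pp_np[OF yX]] by (simp add: I_def s_def c_def)
    have "s = y + c" using pp_np(1)[of y] by (simp add: s_def c_def diff_eq_eq)
    moreover have "q *\<^sub>R x + c - R x = y + c" by (simp add: y_def)
    ultimately have "q *\<^sub>R x + c - R x = s" by (simp only:)
    then have le: "R x \<preceq> q *\<^sub>R x + c" using sP by (simp add: cone_le_def)
    \<comment> \<open>The second polar \<open>K\<close> contains \<open>s\<close> and is preserved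
      by \<open>R\<close>, so all iterates of \<open>s\<close> remain disjoint from
      \<open>I\<close>.\<close>
    define K where "K = {v. \<forall>j\<in>I. disj v j}"
    have K: "K \<in> closed_ideals" unfolding K_def by (rule polar_closed_ideal)
    have RkK: "(R ^^ k) s \<in> K" for k
      by (induction k) (use disj_sym ideal[OF K] Rk(1)[OF sP] in \<open>auto simp: K_def I_def\<close>)
    have iter: "\<exists>d\<in>I \<inter> P. (R ^^ k) s \<preceq> q ^ k *\<^sub>R x + d" for k
    proof (induction k)
      case 0
      have "q *\<^sub>R x \<preceq> x" using P_scale[of "1 - q" x] x q by (simp add: cone_le_def algebra_simps)
      moreover have "y \<preceq> q *\<^sub>R x" using R[OF x] by (simp add: y_def cone_le_def)
      ultimately have "s \<preceq> x" unfolding s_def using yX x by (intro pp_least) (auto intro: cle_trans)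
      then show ?case using subspace_0[OF sub] by (intro bexI[of _ 0]) auto
    next
      case (Suc k)
      then obtain d where d: "d \<in> I" "d \<in> P" "(R ^^ k) s \<preceq> q ^ k *\<^sub>R x + d" by auto
      have qx: "q ^ k *\<^sub>R x \<in> P" using q x by (intro P_scale) auto
      have "(R ^^ Suc k) s \<preceq> R (q ^ k *\<^sub>R x + d)"
        using mono[OF d(3) Rk(1)[OF sP] P_add[OF qx d(2)]] by simp
      also have "R (q ^ k *\<^sub>R x + d) = q ^ k *\<^sub>R R x + R d"
        using q qx d x by (simp add: add scale)
      also have "\<dots> \<preceq> q ^ k *\<^sub>R (q *\<^sub>R x + c) + R d"
        using q le by (intro le_add le_scale) auto
      finally have "(R ^^ Suc k) s \<preceq> q ^ Suc k *\<^sub>R x + (q ^ k *\<^sub>R c + R d)"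
        by (simp add: algebra_simps)
      moreover have "q ^ k *\<^sub>R c + R d \<in> I"
        by (intro subspace_add[OF sub] subspace_scale[OF sub] cI ideal[OF I d(1,2)])
      moreover have "q ^ k *\<^sub>R c + R d \<in> P"
        using q by (intro P_add P_scale cP R d(2)) simp
      ultimately show ?case by blast
    qed
    have bound: "norm s \<le> q ^ k * norm x" for k
    proof -
      obtain d where d: "d \<in> I" "d \<in> P" "(R ^^ k) s \<preceq> q ^ k *\<^sub>R x + d"
        using iter by blast
      have qx: "q ^ k *\<^sub>R x \<in> P" using q x by (intro P_scale) auto
      have "(R ^^ k) s \<preceq> q ^ k *\<^sub>R x"
        by (rule ideal_cut[OF Rk(1)[OF sP] _ qx I d]) (use RkK[of k] in \<open>simp add: K_def\<close>)
      then have "norm ((R ^^ k) s) \<le> norm (q ^ k *\<^sub>R x)"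
        by (rule norm_mono_real[OF Rk(1)[OF sP] qx])
      then show ?thesis using Rk(2)[OF sP] q by simp
    qed
    have "s = 0"
    proof (rule ccontr)
      assume "s \<noteq> 0"
      then have "norm s / (norm x + 1) > 0" by (simp add: add_nonneg_pos)
      then obtain k where "q ^ k < norm s / (norm x + 1)" using real_arch_pow_inv q by blast
      then have "q ^ k * (norm x + 1) < norm s" by (simp add: less_divide_eq add_nonneg_pos)
      then have "q ^ k * norm x + q ^ k < norm s" by (simp add: algebra_simps)
      then show False using bound[of k] zero_less_power[OF q(1), of k] by linarith
    qed
    then show ?thesis using pp_eq_0[OF yX] by (simp add: s_def y_def cone_le_def)
  qed
  \<comment> \<open>This lets \<open>q = 1 - e\<close> tend to 1; the values
    \<open>e \<ge> 1\<close> are included because \<open>archimedean\<close> asks for every positive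
    \<open>e\<close>.\<close>
  have "x - R x \<preceq> e *\<^sub>R x" if "0 < e" for e
  proof (cases "e < 1")
    case True
    then show ?thesis using lower[of "1 - e"] that by (simp add: cone_le_def algebra_simps)
  next
    case False
    have "(e - 1) *\<^sub>R x + R x \<in> P" using False by (intro P_add P_scale x R) auto
    then show ?thesis by (simp add: cone_le_def algebra_simps)
  qed
  then have "x - R x \<preceq> 0" by (intro archimedean[OF _ x]) (use x R[OF x] in \<open>auto simp: P_sub_X\<close>)
  then show ?thesis by (simp add: cone_le_def)
qed

lemma cone_isometry_eq_id:
  assumes x: "x \<in> P"
  shows "R x = x"
proof -
  define d where "d = R x - x"
  have d: "d \<in> P" "R x = x + d" using cone_isometry_ge[OF x] by (simp_all add: d_def cone_le_def)
  have Rk: "(R ^^ k) x \<in> P" "norm ((R ^^ k) x) = norm x" for k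
    using x by (induction k) (auto simp: R norm)
  have kd: "x + real k *\<^sub>R d \<in> P" for k using x d by (intro P_add P_scale) auto
  have iter: "x + real k *\<^sub>R d \<preceq> (R ^^ k) x" for k
  proof (induction k)
    case (Suc k)
    define w where "w = (R ^^ k) x - (x + real k *\<^sub>R d)"
    have w: "w \<in> P" "(R ^^ k) x = (x + real k *\<^sub>R d) + w" using Suc by (simp_all add: w_def cone_le_def)
    have "R (x + real k *\<^sub>R d) \<preceq> R ((R ^^ k) x)"
      using R[OF w(1)] by (simp only: w(2) add[OF kd w(1)]) (simp add: cone_le_def)
    moreover have "R (x + real k *\<^sub>R d) = x + d + real k *\<^sub>R R d"
      using x d by (simp add: add scale P_scale)
    moreover have "x + d + real k *\<^sub>R d \<preceq> x + d + real k *\<^sub>R R d"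
      using cone_isometry_ge[OF d(1)] by (intro le_add le_scale) auto
    ultimately show ?case using cle_trans by (fastforce simp: algebra_simps)
  qed simp
  have "real k * norm d \<le> norm x" for k
  proof -
    have "real k *\<^sub>R d \<preceq> x + real k *\<^sub>R d" using x by (simp add: cone_le_def)
    then have "real k *\<^sub>R d \<preceq> (R ^^ k) x" using iter by (rule cle_trans)
    then have "norm (real k *\<^sub>R d) \<le> norm ((R ^^ k) x)"
      by (intro norm_mono_real P_scale) (use d Rk in simp_all)
    then show ?thesis by (simp add: Rk)
  qed
  then have "norm d = 0" using reals_Archimedean3[of "norm d"] by (metis linorder_not_le norm_eq_zero zero_less_norm_iff)
  then show ?thesis using d by simp
qed

end

subsection \<open>The center\<close>

definition center :: "('a \<Rightarrow>\<^sub>L 'a) set" where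
  "center = {T :: 'a \<Rightarrow>\<^sub>L 'a. (\<forall>x. T (\<iota> x) = \<iota> (T x)) \<and> (\<exists>M>0. \<forall>x\<in>P. m (T x) \<preceq> M *\<^sub>R x)}"

definition center_cone :: "('a \<Rightarrow>\<^sub>L 'a) set" where
  "center_cone = {T \<in> center. \<forall>x\<in>P. T x \<in> P}"

text \<open>By additivity the value on \<open>a - b\<close> does not depend on how a real vector is
  written as a difference of positive ones. The extension passes from \<open>P\<close> to
  \<open>X\<close> by \<open>pp\<close> and \<open>np\<close>, then to the whole space by
  \<open>re\<close> and \<open>im\<close>. The values of \<open>f\<close> may be non-real for
  \<open>P\<close>, as those of the \<open>W\<close>-modulus may be.\<close>

lemma cone_extension:
  fixes f :: "'a \<Rightarrow> 'a"
  assumes add: "\<And>x y. x \<in> P \<Longrightarrow> y \<in> P \<Longrightarrow> f (x + y) = f x + f y"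
    and scale: "\<And>r x. 0 \<le> r \<Longrightarrow> x \<in> P \<Longrightarrow> f (r *\<^sub>R x) = r *\<^sub>R f x"
    and bound: "0 \<le> C" "\<And>x. x \<in> P \<Longrightarrow> norm (f x) \<le> C * norm x"
  obtains T :: "'a \<Rightarrow>\<^sub>L 'a" where "\<And>x. x \<in> P \<Longrightarrow> T x = f x" "\<And>x. T (\<iota> x) = \<iota> (T x)"
proof -
  define g where "g x = f (pp x) - f (np x)" for x
  have g_diff: "g (a - b) = f a - f b" if "a \<in> P" "b \<in> P" for a b
  proof -
    have X: "a - b \<in> X" using that by (simp add: P_sub_X)
    have "a + np (a - b) = b + pp (a - b)"
      using pp_np(1)[of "a - b"] by (simp add: algebra_simps)
    then have "f (a + np (a - b)) = f (b + pp (a - b))" by simp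
    then show ?thesis using that X by (simp add: g_def add algebra_simps)
  qed
  have g_add: "g (x + y) = g x + g y" if "x \<in> X" "y \<in> X" for x y
  proof -
    have "x + y = (pp x + pp y) - (np x + np y)" using pp_np(1)[of x] pp_np(1)[of y] by (simp add: algebra_simps)
    then have "g (x + y) = f (pp x + pp y) - f (np x + np y)"
      using g_diff that P_add by (metis np_P pp_P)
    then show ?thesis using that by (simp add: add g_def)
  qed
  have g_scale: "g (r *\<^sub>R x) = r *\<^sub>R g x" if "x \<in> X" for r x
  proof (cases "0 \<le> r")
    case True
    have "r *\<^sub>R x = r *\<^sub>R pp x - r *\<^sub>R np x" using pp_np(1)[of x] by (simp flip: scaleR_diff_right)
    then have "g (r *\<^sub>R x) = f (r *\<^sub>R pp x) - f (r *\<^sub>R np x)"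
      using g_diff[of "r *\<^sub>R pp x" "r *\<^sub>R np x"] that True by (simp add: P_scale)
    then show ?thesis using that True by (simp add: scale g_def algebra_simps)
  next
    case False
    have "r *\<^sub>R x = (-r) *\<^sub>R np x - (-r) *\<^sub>R pp x" using pp_np(1)[of x] by (simp flip: scaleR_diff_right)
    then have "g (r *\<^sub>R x) = f ((-r) *\<^sub>R np x) - f ((-r) *\<^sub>R pp x)"
      using g_diff[OF P_scale P_scale, of "-r" "np x" "-r" "pp x"] that False by simp
    also have "\<dots> = (-r) *\<^sub>R f (np x) - (-r) *\<^sub>R f (pp x)"
      using that False scale[of "-r" "np x"] scale[of "-r" "pp x"] by (simp only: np_P pp_P)
    finally show ?thesis by (simp add: g_def algebra_simps)
  qed
  have g_bound: "norm (g x) \<le> 2 * C * norm y" if "x \<in> X" "m x \<preceq> m y" for x y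
  proof -
    have "pp x \<preceq> m x" "np x \<preceq> m x" using that by (auto intro!: pp_least np_least real_le_m)
    then have "norm (pp x) \<le> norm y" "norm (np x) \<le> norm y"
      using that by (auto intro!: norm_mono intro: cle_trans)
    then have "norm (f (pp x)) \<le> C * norm y" "norm (f (np x)) \<le> C * norm y"
      using bound(2)[of "pp x"] bound(2)[of "np x"] that mult_left_mono[OF _ bound(1)]
      by (meson order_trans np_P pp_P)+
    then show ?thesis using norm_triangle_ineq4[of "f (pp x)" "f (np x)"] by (simp add: g_def)
  qed
  define h where "h x = g (re x) + \<iota> (g (im x))" for x
  have "bounded_linear h"
  proof (rule bounded_linear_intro[where K = "4 * C"])
    show "h (x + y) = h x + h y" for x y by (simp add: h_def g_add)
    show "h (r *\<^sub>R x) = r *\<^sub>R h x" for r x by (simp add: h_def g_scale algebra_simps)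
    show "norm (h x) \<le> norm x * (4 * C)" for x
      using g_bound[of "re x" x] g_bound[of "im x" x] m_re_le[of x] m_im_le[of x]
        norm_iota[of "g (im x)"] norm_triangle_ineq[of "g (re x)" "\<iota> (g (im x))"]
      by (simp add: h_def algebra_simps)
  qed
  note app = bounded_linear_Blinfun_apply[OF this]
  have f0: "f 0 = 0" using scale[of 0 0] by simp
  have g0: "g 0 = 0" using g_diff[of 0 0] by simp
  show thesis
  proof (rule that[of "Blinfun h"])
    show "Blinfun h x = f x" if "x \<in> P" for x
      using g_diff[OF that P_0] that by (simp add: app h_def g0 f0)
    have g_neg: "g (- x) = - g x" if "x \<in> X" for x using g_scale[OF that, of "-1"] by simp
    show "Blinfun h (\<iota> x) = \<iota> (Blinfun h x)" for x
      using iota_cases by (auto simp: app h_def re_iota g_neg g0)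
  qed
qed

lemma blinfun_eq_on_cone:
  fixes S T :: "'a \<Rightarrow>\<^sub>L 'a"
  assumes "\<And>x. x \<in> P \<Longrightarrow> T x = S x" "\<And>x. T (\<iota> x) = \<iota> (T x)" "\<And>x. S (\<iota> x) = \<iota> (S x)"
  shows "T = S"
proof (rule blinfun_eqI)
  fix x
  have real: "T y = S y" if "y \<in> X" for y
  proof -
    have "T (pp y) - T (np y) = S (pp y) - S (np y)" using assms(1) that by simp
    then show ?thesis by (simp add: pp_np flip: blinfun.diff_right)
  qed
  have "T (re x + \<iota> (im x)) = S (re x + \<iota> (im x))"
    unfolding blinfun.add_right assms(2,3) by (simp add: real)
  then show "T x = S x" by (simp add: split)
qed

lemma centerI:
  fixes T :: "'a \<Rightarrow>\<^sub>L 'a"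
  assumes "\<And>x. T (\<iota> x) = \<iota> (T x)" "\<And>x. x \<in> P \<Longrightarrow> m (T x) \<preceq> M *\<^sub>R x"
  shows "T \<in> center"
proof -
  have "m (T x) \<preceq> (\<bar>M\<bar> + 1) *\<^sub>R x" if "x \<in> P" for x
    using cle_trans[OF assms(2)[OF that]] P_scale[of "\<bar>M\<bar> + 1 - M" x] that
    by (simp add: cone_le_def algebra_simps)
  then show ?thesis unfolding center_def using assms(1)
    by (auto intro!: exI[of _ "\<bar>M\<bar> + 1"])
qed

lemma center_iota: "T \<in> center \<Longrightarrow> T (\<iota> x) = \<iota> (T x)" by (simp add: center_def)

lemma center_bound:
  assumes "T \<in> center"
  obtains M where "M > 0" "\<And>x. x \<in> P \<Longrightarrow> m (blinfun_apply T x) \<preceq> M *\<^sub>R x"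
  using assms by (auto simp: center_def)

lemma subspace_center: "subspace center"
proof (rule subspaceI)
  show "0 \<in> center" by (rule centerI[where M = 0]) auto
  show "S + T \<in> center" if S: "S \<in> center" and T: "T \<in> center" for S T
  proof -
    obtain M where M: "\<And>x. x \<in> P \<Longrightarrow> m (S x) \<preceq> M *\<^sub>R x" using center_bound[OF S] by blast
    obtain N where N: "\<And>x. x \<in> P \<Longrightarrow> m (T x) \<preceq> N *\<^sub>R x" using center_bound[OF T] by blast
    show ?thesis
    proof (rule centerI[where M = "M + N"])
      show "m ((S + T) x) \<preceq> (M + N) *\<^sub>R x" if "x \<in> P" for x
        using cle_trans[OF m_add le_add[OF M[OF that] N[OF that]]]
        by (simp add: blinfun.add_left scaleR_left_distrib)
    qed (simp add: blinfun.add_left center_iota[OF S] center_iota[OF T])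
  qed
  show "r *\<^sub>R T \<in> center" if T: "T \<in> center" for r T
  proof -
    obtain M where M: "\<And>x. x \<in> P \<Longrightarrow> m (T x) \<preceq> M *\<^sub>R x" using center_bound[OF T] by blast
    show ?thesis
    proof (rule centerI[where M = "\<bar>r\<bar> * M"])
      show "m ((r *\<^sub>R T) x) \<preceq> (\<bar>r\<bar> * M) *\<^sub>R x" if "x \<in> P" for x
        using le_scale[OF abs_ge_zero M[OF that], of r] by (simp add: blinfun.scaleR_left)
    qed (simp add: blinfun.scaleR_left center_iota[OF T])
  qed
qed

lemma id_center_cone: "id_blinfun \<in> center_cone"
  by (auto simp: center_cone_def intro!: centerI[where M = 1])

end

section \<open>Two cones with the same closed ideals\<close>

text \<open>Both lattices share \<open>\<iota>\<close>, which belongs to the scalar structure of the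
  space, but a vector may have different real and imaginary parts for the two cones.\<close>

locale lattice_pair = A: modulus_lattice P \<iota> re im + B: modulus_lattice W \<iota> re' im'
  for P W :: "'a::real_normed_vector set" and \<iota> re im re' im' :: "'a \<Rightarrow> 'a" +
  assumes same: "A.closed_ideals = B.closed_ideals"
begin

lemma disj_eq: "A.disj x y \<longleftrightarrow> B.disj x y"
  using A.closed_ideal_Int A.disj_if_ideals B.closed_ideal_Int B.disj_if_ideals same by metis

text \<open>Let \<open>J\<close> be the polar of a region where \<open>x\<close> is within \<open>\<eta> u\<close> of \<open>l u\<close> for the cone \<open>P\<close>,
  while the defect \<open>D\<close> is at least \<open>\<delta>\<close> times the modulus of \<open>u\<close> for the cone \<open>W\<close>. Modulo \<open>J\<close>, the norm of \<open>x - l u\<close>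
  is then at most \<open>4\<eta>\<close> times that of \<open>u\<close>, and \<open>D\<close> is at most twice the modulus of \<open>x - l u\<close>;
  hence \<open>u\<close> is in \<open>J\<close>.\<close>

lemma region_trivial:
  assumes x: "x \<in> P" and y: "y \<in> P" and l: "0 \<le> l" "l \<le> 1" and \<delta>: "0 < \<delta>"
  defines "u \<equiv> x + y"
  defines "D \<equiv> B.m x + B.m y - B.m u"
  defines "s' \<equiv> B.pp (D - \<delta> *\<^sub>R B.m u)"
  defines "s \<equiv> A.pp ((\<delta>/33) *\<^sub>R u - A.m (x - l *\<^sub>R u))"
  shows "A.disj s' s"
proof -
  \<comment> \<open>Two passages between a vector and its modulus cost a factor 4 each and the
    triangle inequality a factor 2, which makes 32; dividing by 33 leaves strict room.\<close>
  define \<eta> where "\<eta> = \<delta> / 33"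
  have \<eta>: "0 < \<eta>" "32 * \<eta> < \<delta>" using \<delta> by (simp_all add: \<eta>_def)
  have uP: "u \<in> P" using x y by (simp add: u_def A.P_add)
  define e where "e = x - l *\<^sub>R u"
  define c where "c = A.np (\<eta> *\<^sub>R u - A.m e)"
  define c' where "c' = B.np (D - \<delta> *\<^sub>R B.m u)"
  define z where "z = A.meet (A.m s') s"
  define J where "J = {v. \<forall>w\<in>{z}. A.disj v w}"
  have AX: "\<eta> *\<^sub>R u - A.m e \<in> cone_diff P" using uP A.P_sub_X by auto
  have s_eq: "s = A.pp (\<eta> *\<^sub>R u - A.m e)" by (simp add: s_def \<eta>_def e_def)
  have BX: "D - \<delta> *\<^sub>R B.m u \<in> cone_diff W" by (auto simp: D_def)
  have sP: "s \<in> P" using AX by (simp add: s_eq)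
  have zP: "z \<in> P" using sP by (simp add: z_def A.meet_P)
  have z_s: "cone_le P z s" and z_s': "cone_le P z (A.m s')"
    using sP A.P_sub_X by (auto simp: z_def intro!: A.meet_le1 A.meet_le2)
  have J: "J \<in> A.closed_ideals" unfolding J_def by (rule A.polar_closed_ideal)
  \<comment> \<open>\<open>J\<close> is a closed ideal for both cones and the quotient norm modulo
    \<open>J\<close> involves no order, so estimates for \<open>P\<close> and for \<open>W\<close>
    can be chained from here on.\<close>
  then have JB: "J \<in> B.closed_ideals" using same by simp
  have cP: "c \<in> P" using AX by (simp add: c_def)
  have c'W: "c' \<in> W" using BX by (simp add: c'_def)
  have "A.disj s c" using A.disj_pp_np[OF AX] by (simp add: s_eq c_def)
  then have "A.disj z c" by (rule A.disj_le) (use z_s zP sP in simp)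
  then have cJ: "c \<in> J" using A.disj_sym by (simp add: J_def)
  have "B.disj s' c'" using B.disj_pp_np[OF BX] by (simp add: s'_def c'_def)
  then have "A.disj s' c'" by (simp add: disj_eq)
  then have "A.disj z c'" by (rule A.disj_le) (use z_s' zP in simp)
  then have c'J: "c' \<in> J" using A.disj_sym by (simp add: J_def)
  have sub: "subspace J" using A.closed_idealsD(1)[OF J] .
  note sc = infdist_scaleR_le_subspace[OF sub]
  have "A.m e = \<eta> *\<^sub>R u + c - s"
    using A.pp_np(1)[of "\<eta> *\<^sub>R u - A.m e"] by (simp add: s_eq c_def algebra_simps)
  then have "cone_le P (A.m e) (A.m (\<eta> *\<^sub>R u) + c)"
    using \<eta> uP sP by (simp add: cone_le_def)
  then have "infdist (A.m e) J \<le> infdist (\<eta> *\<^sub>R u) J"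
    by (intro A.infdist_ideal_mono[OF J _ cP cJ]) auto
  also have "\<dots> \<le> \<eta> * infdist u J" using sc[of \<eta> u] \<eta> by simp
  finally have e_u: "infdist e J \<le> 4 * (\<eta> * infdist u J)"
    using A.infdist_ideal_modulus[OF J, of e] by simp
  \<comment> \<open>In \<open>D\<close> the multiples of \<open>B.m u\<close> cancel, because the
    coefficients \<open>l\<close> and \<open>1 - l\<close> add up to 1; only two copies of
    \<open>B.m e\<close> remain.\<close>
  have "x = l *\<^sub>R u + e" "y = (1 - l) *\<^sub>R u - e" by (simp_all add: e_def u_def algebra_simps)
  then have "cone_le W (B.m x) (l *\<^sub>R B.m u + B.m e)" "cone_le W (B.m y) ((1 - l) *\<^sub>R B.m u + B.m e)"
    using B.m_add[of "l *\<^sub>R u" e] B.m_diff[of "(1 - l) *\<^sub>R u" e] l by simp_all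
  from B.le_add[OF this] have "cone_le W D (B.m (2 *\<^sub>R e))"
    using scaleR_2[of "B.m e"] by (simp add: D_def cone_le_def algebra_simps)
  moreover have "D + c' - \<delta> *\<^sub>R B.m u = B.pp (D - \<delta> *\<^sub>R B.m u)"
    unfolding B.pp_eq c'_def by simp
  then have "cone_le W (\<delta> *\<^sub>R B.m u) (D + c')"
    using B.pp_P[OF BX] by (simp add: cone_le_def)
  ultimately have "cone_le W (\<delta> *\<^sub>R B.m u) (B.m (2 *\<^sub>R e) + c')"
    using B.le_add[of D _ c' c'] B.cle_trans B.cle_refl by blast
  then have "infdist (\<delta> *\<^sub>R B.m u) J \<le> infdist (2 *\<^sub>R e) J"
    using \<delta> by (intro B.infdist_ideal_mono[OF JB _ c'W c'J]) (auto simp: B.P_scale)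
  also have "\<dots> \<le> 2 * infdist e J" using sc[of 2 e] by simp
  also have "\<dots> \<le> 8 * \<eta> * infdist u J" using e_u by simp
  also have "\<dots> \<le> 8 * \<eta> * (4 * infdist (B.m u) J)"
    using B.infdist_ideal_modulus[OF JB, of u] \<eta> by (intro mult_left_mono) auto
  finally have 1: "infdist (\<delta> *\<^sub>R B.m u) J \<le> 32 * \<eta> * infdist (B.m u) J" by simp
  have "\<delta> * infdist (B.m u) J \<le> infdist (\<delta> *\<^sub>R B.m u) J"
    using sc[of "1/\<delta>" "\<delta> *\<^sub>R B.m u"] \<delta> by (simp add: field_simps)
  with 1 have "(\<delta> - 32 * \<eta>) * infdist (B.m u) J \<le> 0" by (simp add: algebra_simps)
  then have "infdist (B.m u) J = 0"
    using \<eta>(2) infdist_nonneg[of "B.m u" J] by (simp add: mult_le_0_iff)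
  then have "infdist u J = 0"
    using B.infdist_ideal_modulus[OF JB, of u] infdist_nonneg[of u J] by simp
  then have "u \<in> J"
    using in_closed_iff_infdist_zero[OF A.closed_idealsD(2)[OF J]] subspace_0[OF sub] by blast
  then have "A.disj u z" by (simp add: J_def)
  \<comment> \<open>\<open>z\<close> lies below a multiple of \<open>u\<close> and \<open>u\<close>
    is disjoint from \<open>z\<close>, so \<open>z\<close> is disjoint from itself.\<close>
  moreover have "cone_le P s (\<eta> *\<^sub>R u)"
    unfolding s_eq using AX \<eta> uP by (intro A.pp_least) (auto simp: cone_le_def A.P_scale)
  then have "cone_le P (A.m z) (\<eta> *\<^sub>R A.m u)" using z_s zP uP A.cle_trans by simp
  ultimately have "A.disj z z" by (rule A.disj_dom)
  then have "z = 0" by (rule A.disj_self)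
  then show ?thesis using sP by (simp add: A.disj_def z_def)
qed

text \<open>A homomorphism on \<open>u = x + y\<close> sees the region with \<open>l = \<phi> x / \<phi> u\<close> as full.\<close>

lemma modulus_additive:
  assumes x: "x \<in> P" and y: "y \<in> P"
  shows "B.m (x + y) = B.m x + B.m y"
proof -
  define u where "u = x + y"
  define D where "D = B.m x + B.m y - B.m u"
  have uP: "u \<in> P" using x y by (simp add: u_def A.P_add)
  have DW: "D \<in> W" using B.m_add[of x y] by (simp add: D_def u_def cone_le_def)
  have x_u: "cone_le P x u" and y_u: "cone_le P y u" using x y by (simp_all add: u_def cone_le_def)
  have "cone_le W D (\<delta> *\<^sub>R B.m u)" if \<delta>: "0 < \<delta>" for \<delta>
  proof -
    define s' where "s' = B.pp (D - \<delta> *\<^sub>R B.m u)"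
    have BX: "D - \<delta> *\<^sub>R B.m u \<in> cone_diff W" by (auto simp: D_def)
    let ?v = "A.m s' + A.m u"
    have v: "?v \<in> P" "s' \<in> A.principal ?v" "u \<in> A.principal ?v"
      by (simp_all add: A.P_add A.principal_sum)
    have xpr: "x \<in> A.principal ?v" using A.principal_P[OF v(3) uP x x_u] .
    have "A.disj s' u"
      unfolding A.disj_iff_homs[OF v]
    proof (intro allI impI)
      fix \<phi> assume h: "A.hom ?v \<phi>"
      have x0: "0 \<le> \<phi> x" "\<phi> x \<le> \<phi> u" using A.hom_pos[OF h xpr x] A.hom_mono[OF h xpr v(3) x_u] .
      show "\<phi> (A.m s') = 0 \<or> \<phi> (A.m u) = 0"
      proof (cases "\<phi> u = 0")
        case False
        define l where "l = \<phi> x / \<phi> u"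
        define s where "s = A.pp ((\<delta>/33) *\<^sub>R u - A.m (x - l *\<^sub>R u))"
        have l: "0 \<le> l" "l \<le> 1" using x0 False by (simp_all add: l_def divide_le_eq_1)
        have d: "A.disj s' s"
          using region_trivial[OF x y l \<delta>] by (simp add: s'_def s_def D_def u_def)
        have pr: "x - l *\<^sub>R u \<in> A.principal ?v" using xpr v(3) by (intro A.principal_intros)
        then have pr': "(\<delta>/33) *\<^sub>R u - A.m (x - l *\<^sub>R u) \<in> A.principal ?v"
          by (rule A.principal_diff[OF A.principal_scale[OF v(3)] A.principal_m])
        have X: "(\<delta>/33) *\<^sub>R u - A.m (x - l *\<^sub>R u) \<in> cone_diff P" "x - l *\<^sub>R u \<in> cone_diff P"
          using uP x A.P_sub_X by auto
        have "\<phi> (x - l *\<^sub>R u) = 0"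
          using xpr v(3) False by (simp add: A.hom_simps[OF h] A.principal_scale l_def)
        then have val: "\<phi> ((\<delta>/33) *\<^sub>R u - A.m (x - l *\<^sub>R u)) = \<delta>/33 * \<phi> u"
          using pr v(3) X by (simp add: A.hom_simps[OF h] A.principal_scale A.principal_m)
        have \<phi>s: "\<phi> s = \<delta>/33 * \<phi> u"
          unfolding s_def A.hom_pp[OF h pr' X(1)] val using x0 \<delta> by simp
        have "\<phi> s \<noteq> 0" unfolding \<phi>s using False \<delta> by simp
        moreover have "A.m s = s" using X by (simp add: s_def)
        ultimately have "\<phi> (A.m s) \<noteq> 0" by simp
        moreover have "s \<in> A.principal ?v" unfolding s_def using pr' by (rule A.principal_pp)
        ultimately show ?thesis using d A.disj_iff_homs[OF v(1,2)] h by blast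
      qed (use uP in simp)
    qed
    \<comment> \<open>The polar of \<open>s'\<close> contains \<open>u\<close>, hence
      \<open>x\<close> and \<open>y\<close>, hence the \<open>W\<close>-moduli of all three and the
      defect \<open>D\<close>. As \<open>D\<close> dominates \<open>s'\<close>, the vector
      \<open>s'\<close> is disjoint from itself.\<close>
    define J where "J = {v. \<forall>w\<in>{s'}. A.disj v w}"
    have J: "J \<in> A.closed_ideals" unfolding J_def by (rule A.polar_closed_ideal)
    then have JB: "J \<in> B.closed_ideals" using same by simp
    note sub = A.closed_idealsD(1)[OF J]
    have uJ: "u \<in> J" using \<open>A.disj s' u\<close> A.disj_sym by (simp add: J_def)
    then have "x \<in> J" "y \<in> J"
      using A.closed_idealsD(4)[OF J uJ] x y uP x_u y_u by simp_all
    then have "B.m x \<in> J" "B.m y \<in> J" "B.m u \<in> J"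
      using B.closed_idealsD(4)[OF JB] uJ by simp_all
    then have DJ: "D \<in> J" unfolding D_def by (intro subspace_add[OF sub] subspace_diff[OF sub])
    have "cone_le W s' D" unfolding s'_def
      using BX DW \<delta> by (intro B.pp_least) (auto simp: cone_le_def B.P_scale)
    then have "s' \<in> J" using B.closed_idealsD(4)[OF JB DJ, of s'] DW BX by (simp add: s'_def)
    then have "s' = 0" by (intro A.disj_self) (simp add: J_def)
    then show ?thesis using B.pp_eq_0[OF BX] by (simp add: s'_def cone_le_def)
  qed
  then have "cone_le W D 0" by (intro B.archimedean[of D "B.m u"]) (auto simp: DW B.P_sub_X)
  then have "D = 0" using DW B.cle_antisym[of D 0] by simp
  then show ?thesis by (simp add: D_def u_def)
qed

lemma swapped: "lattice_pair W P \<iota> re' im' re im"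
  by unfold_locales (simp add: same)

text \<open>\<open>B.m\<close> maps \<open>P\<close> into \<open>W\<close>, so additivity of the
  composition uses \<open>modulus_additive\<close> once for each order of the cones. Each modulus
  maps a shared closed ideal into itself.\<close>

lemma modulus_modulus:
  assumes x: "x \<in> P"
  shows "A.m (B.m x) = x"
proof (rule A.cone_isometry_eq_id[where R = "\<lambda>x. A.m (B.m x)", OF _ _ _ _ _ x])
  show "A.m (B.m (a + b)) = A.m (B.m a) + A.m (B.m b)" if "a \<in> P" "b \<in> P" for a b
    using modulus_additive[OF that] lattice_pair.modulus_additive[OF swapped, of "B.m a" "B.m b"] by simp
  show "A.m (B.m a) \<in> I" if "I \<in> A.closed_ideals" "a \<in> I" "a \<in> P" for I a
  proof -
    have "B.m a \<in> I" using B.closed_idealsD(4)[of I a "B.m a"] that same by simp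
    then show ?thesis using A.closed_idealsD(4)[of I "B.m a" "A.m (B.m a)"] that by simp
  qed
qed (simp_all add: A.norm_modulus B.norm_modulus)

lemma central_operator_exists:
  obtains T where "T \<in> A.center" "\<And>x. x \<in> P \<Longrightarrow> blinfun_apply T x = B.m x"
    "\<And>x. x \<in> P \<Longrightarrow> A.m (blinfun_apply T x) = x"
proof -
  obtain T :: "'a \<Rightarrow>\<^sub>L 'a" where T: "\<And>x. x \<in> P \<Longrightarrow> T x = B.m x" "\<And>x. T (\<iota> x) = \<iota> (T x)"
    using A.cone_extension[of B.m 1] modulus_additive by (auto simp: B.norm_modulus)
  have "T \<in> A.center"
    using T(2) by (rule A.centerI[where M = 1]) (simp add: T(1) modulus_modulus)
  with T show thesis by (intro that) (auto simp: modulus_modulus)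
qed

end

context modulus_lattice
begin

section \<open>Unimodular central operators\<close>

lemma center_cone_sub: "center_cone \<subseteq> center"
  by (auto simp: center_cone_def)

lemma center_cone_diff_le:
  assumes "T \<in> center" "S \<in> center"
  shows "cone_le center_cone S T \<longleftrightarrow> (\<forall>x\<in>P. S x \<preceq> blinfun_apply T x)"
  using subspace_diff[OF subspace_center assms]
  by (simp add: cone_le_def center_cone_def blinfun.diff_left)

text \<open>The constant survives the passage from \<open>P\<close> to \<open>X\<close> because
  \<open>pp x + np x\<close> is exactly \<open>m x\<close>.\<close>

lemma center_bound_X:
  assumes "T \<in> center"
  obtains M where "M > 0" "\<And>x. x \<in> X \<Longrightarrow> m (blinfun_apply T x) \<preceq> M *\<^sub>R m x"
proof -
  obtain M where M: "M > 0" "\<And>x. x \<in> P \<Longrightarrow> m (T x) \<preceq> M *\<^sub>R x" using center_bound[OF assms] by blast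
  have "m (T x) \<preceq> M *\<^sub>R m x" if "x \<in> X" for x
  proof -
    have "m (T (pp x - np x)) \<preceq> m (T (pp x)) + m (T (np x))"
      unfolding blinfun.diff_right by (rule m_diff)
    also have "\<dots> \<preceq> M *\<^sub>R pp x + M *\<^sub>R np x" using that by (intro le_add M) auto
    also have "\<dots> = M *\<^sub>R (pp x + np x)" by (simp add: scaleR_add_right)
    finally show ?thesis by (simp only: pp_np)
  qed
  with M(1) show thesis by (rule that)
qed

lemma center_split: "T \<in> center \<Longrightarrow> blinfun_apply T x = T (re x) + \<iota> (T (im x))"
  by (metis blinfun.add_right center_iota split)

lemma center_principal:
  assumes "T \<in> center" "x \<in> principal u" shows "blinfun_apply T x \<in> principal u"
proof -
  obtain M where M: "M > 0" "\<And>x. x \<in> X \<Longrightarrow> m (T x) \<preceq> M *\<^sub>R m x" using center_bound_X[OF assms(1)] by blast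
  have real: "T y \<in> principal u" if "y \<in> principal u" "y \<in> X" for y
    using principal_dom[OF that(1) M(2)[OF that(2)]] M(1) by simp
  show ?thesis unfolding center_split[OF assms(1), of x]
    using assms(2) by (intro principal_add principal_iota real principal_re principal_im) auto
qed

text \<open>A homomorphism sees only \<open>re x\<close>. Pairing it with the value at
  \<open>im x\<close> gives a scalar-valued map, complex linear on the principal ideal in the
  complex case, whose absolute value there is \<open>\<phi> (m x)\<close>.\<close>

definition chom :: "('a \<Rightarrow> real) \<Rightarrow> 'a \<Rightarrow> complex" where
  "chom \<phi> x = Complex (\<phi> x) (\<phi> (im x))"

context
  fixes u :: 'a and \<phi> :: "'a \<Rightarrow> real"
  assumes h: "hom u \<phi>"
begin

lemma chom_add: "x \<in> principal u \<Longrightarrow> y \<in> principal u \<Longrightarrow> chom \<phi> (x + y) = chom \<phi> x + chom \<phi> y"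
  by (simp add: chom_def hom_add[OF h] principal_im complex_eq_iff)

lemma chom_scale: "x \<in> principal u \<Longrightarrow> chom \<phi> (r *\<^sub>R x) = of_real r * chom \<phi> x"
  by (simp add: chom_def hom_scale[OF h] principal_im complex_eq_iff)

lemma chom_diff: "x \<in> principal u \<Longrightarrow> y \<in> principal u \<Longrightarrow> chom \<phi> (x - y) = chom \<phi> x - chom \<phi> y"
  by (simp add: chom_def hom_diff[OF h] principal_im complex_eq_iff)

lemma chom_real: "x \<in> X \<Longrightarrow> chom \<phi> x = of_real (\<phi> x)"
  by (simp add: chom_def im_real hom_0[OF h] complex_eq_iff)

lemma hom_m_eq: "x \<in> principal u \<Longrightarrow> \<phi> (m x) = cmod (chom \<phi> x)"
  by (simp add: chom_def hom_m[OF h])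

lemma hom_iota: "x \<in> principal u \<Longrightarrow> \<phi> (\<iota> x) = - \<phi> (im x)"
  using hom_re[OF h principal_iota, of x] by (simp add: re_iota hom_minus[OF h] principal_im)

text \<open>A bound \<open>m (T y) \<preceq> M *\<^sub>R m y\<close> makes \<open>T\<close> preserve the kernel of a homomorphism, which has codimension one.\<close>

lemma chom_center:
  assumes T: "T \<in> center" and x: "x \<in> principal u"
  shows "chom \<phi> (blinfun_apply T x) = chom \<phi> (T u) * chom \<phi> x"
proof -
  have uP: "u \<in> P" and upr: "u \<in> principal u" using hom_P[OF h] by (auto intro: principal_self)
  obtain M where M: "M > 0" "\<And>x. x \<in> X \<Longrightarrow> m (T x) \<preceq> M *\<^sub>R m x" using center_bound_X[OF T] by blast
  have kernel: "chom \<phi> (T y) = 0" if "y \<in> principal u" "y \<in> X" "\<phi> y = 0" for y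
  proof -
    have "\<phi> (m (T y)) \<le> \<phi> (M *\<^sub>R m y)"
      using M(2)[OF that(2)] center_principal[OF T that(1)] that(1)
      by (intro hom_mono[OF h]) (auto intro!: principal_intros)
    also have "\<dots> = 0" using that by (simp add: hom_scale[OF h] hom_m_real[OF h] principal_m)
    finally show ?thesis using hom_m_eq[OF center_principal[OF T that(1)]] by simp
  qed
  have real: "chom \<phi> (T y) = chom \<phi> (T u) * of_real (\<phi> y)" if y: "y \<in> principal u" "y \<in> X" for y
  proof -
    have "y - \<phi> y *\<^sub>R u \<in> principal u" using y upr by (intro principal_intros)
    moreover have "y - \<phi> y *\<^sub>R u \<in> X" using y uP by (simp add: P_sub_X)
    moreover have "\<phi> (y - \<phi> y *\<^sub>R u) = 0"
      using y upr by (simp add: hom_diff[OF h] hom_scale[OF h] principal_scale hom_unit[OF h])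
    ultimately have "chom \<phi> (T (y - \<phi> y *\<^sub>R u)) = 0" by (rule kernel)
    then show ?thesis using y upr
      by (simp add: blinfun.diff_right blinfun.scaleR_right chom_diff chom_scale center_principal[OF T]
          principal_scale mult.commute)
  qed
  from iota_cases show ?thesis
  proof
    assume i: "\<forall>x. im (\<iota> x) = re x \<and> \<iota> (\<iota> x) = - x"
    have ci: "chom \<phi> (\<iota> y) = \<i> * chom \<phi> y" if "y \<in> principal u" for y
      using that i by (simp add: chom_def hom_iota hom_re[OF h] complex_eq_iff)
    have pr: "re x \<in> principal u" "im x \<in> principal u" using x by (auto intro!: principal_intros)
    have "chom \<phi> (T x) = chom \<phi> (T (re x)) + \<i> * chom \<phi> (T (im x))"
      unfolding center_split[OF T, of x]
      using pr by (simp add: chom_add ci center_principal[OF T] principal_iota)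
    also have "\<dots> = chom \<phi> (T u) * (of_real (\<phi> x) + \<i> * of_real (\<phi> (im x)))"
      using pr x by (simp add: real hom_re[OF h] algebra_simps)
    also have "of_real (\<phi> x) + \<i> * of_real (\<phi> (im x)) = chom \<phi> x"
      by (simp add: chom_def complex_eq_iff)
    finally show ?thesis .
  next
    assume i: "\<forall>x. im x = 0 \<and> \<iota> x = 0"
    then have "x \<in> X" using split[of x] re_im_X(1)[of x] by simp
    then show ?thesis using real[OF x] by (simp add: chom_real)
  qed
qed

end

lemma eq_by_chom:
  assumes "u \<in> P" "x \<in> principal u" "y \<in> principal u" "\<And>\<phi>. hom u \<phi> \<Longrightarrow> chom \<phi> x = chom \<phi> y"
  shows "x = y"
proof -
  have "x - y = 0"
  proof (rule eq_0_by_homs[OF assms(1) principal_diff[OF assms(2,3)]])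
    fix \<phi> assume h: "hom u \<phi>"
    show "\<phi> (x - y) = 0" "\<phi> (im (x - y)) = 0"
      using assms(4)[OF h] chom_diff[OF h assms(2,3)] by (simp_all add: chom_def complex_eq_iff)
  qed
  then show ?thesis by simp
qed

text \<open>Common form of |T| = 1: for complex scalars \<open>A\<close> and \<open>B\<close> are
  the parts of \<open>T\<close> in the complexified center, for real scalars they are
  \<open>T\<close> and \<open>0\<close>. Since \<open>\<iota>\<close> acts on vectors and not on
  operators, the decomposition is stated pointwise.\<close>

definition unimodular_parts :: "('a \<Rightarrow>\<^sub>L 'a) \<Rightarrow> ('a \<Rightarrow>\<^sub>L 'a) \<Rightarrow> ('a \<Rightarrow>\<^sub>L 'a) \<Rightarrow> bool" where
  "unimodular_parts T A B \<longleftrightarrow> A \<in> cone_diff center_cone \<and> B \<in> cone_diff center_cone \<and>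
     (\<forall>x. T x = A x + \<iota> (B x)) \<and> (\<forall>x\<in>P. re (T x) = A x \<and> im (T x) = B x) \<and>
     is_cone_sup center_cone (range (\<lambda>t. cos t *\<^sub>R A + sin t *\<^sub>R B)) id_blinfun"

lemma center_operator_exists:
  fixes f :: "'a \<Rightarrow> 'a"
  assumes "\<And>x y. x \<in> P \<Longrightarrow> y \<in> P \<Longrightarrow> f (x + y) = f x + f y"
    and "\<And>r x. 0 \<le> r \<Longrightarrow> x \<in> P \<Longrightarrow> f (r *\<^sub>R x) = r *\<^sub>R f x"
    and bound: "0 \<le> M" "\<And>x. x \<in> P \<Longrightarrow> m (f x) \<preceq> M *\<^sub>R x"
  obtains T where "T \<in> center" "\<And>x. x \<in> P \<Longrightarrow> blinfun_apply T x = f x"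
proof -
  have "norm (f x) \<le> M * norm x" if "x \<in> P" for x
    using norm_mono[of "f x" "M *\<^sub>R x"] bound that by simp
  then obtain T :: "'a \<Rightarrow>\<^sub>L 'a" where T: "\<And>x. x \<in> P \<Longrightarrow> T x = f x" "\<And>x. T (\<iota> x) = \<iota> (T x)"
    using cone_extension[OF assms(1,2) bound(1)] by blast
  then have "T \<in> center" using bound(2) by (intro centerI) auto
  then show thesis using T(1) by (rule that)
qed

text \<open>Adding \<open>M\<close> times the identity, with \<open>M\<close> the central bound of
  \<open>A\<close>, makes the operator positive.\<close>

lemma real_center_decomp:
  assumes "A \<in> center" "\<And>x. x \<in> P \<Longrightarrow> blinfun_apply A x \<in> X"
  shows "A \<in> cone_diff center_cone"
proof -
  obtain M where M: "M > 0" "\<And>x. x \<in> P \<Longrightarrow> m (A x) \<preceq> M *\<^sub>R x" using center_bound[OF assms(1)] by blast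
  have "M *\<^sub>R id_blinfun \<in> center_cone" "A + M *\<^sub>R id_blinfun \<in> center_cone"
  proof -
    have c: "M *\<^sub>R id_blinfun \<in> center"
      using id_center_cone center_cone_sub by (intro subspace_scale[OF subspace_center]) auto
    then show "M *\<^sub>R id_blinfun \<in> center_cone" using M(1) by (simp add: center_cone_def blinfun.scaleR_left P_scale)
    have "A x + M *\<^sub>R x \<in> P" if "x \<in> P" for x
      using cle_trans[OF real_le_m(2)[OF assms(2)[OF that]] M(2)[OF that]] by (simp add: cone_le_def algebra_simps)
    then show "A + M *\<^sub>R id_blinfun \<in> center_cone"
      using subspace_add[OF subspace_center assms(1) c]
      by (simp add: center_cone_def blinfun.add_left blinfun.scaleR_left)
  qed
  moreover have "A = (A + M *\<^sub>R id_blinfun) - M *\<^sub>R id_blinfun" by simp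
  ultimately show ?thesis unfolding cone_diff_def by blast
qed

text \<open>\<open>A\<close> and \<open>B\<close> extend the maps \<open>re (T x)\<close> and
  \<open>im (T x)\<close> from \<open>P\<close>. An upper bound of all rotations bounds them at each
  \<open>x\<close> in \<open>P\<close>, hence bounds \<open>m (T x)\<close>, which is
  \<open>x\<close>; so the identity is the least one.\<close>

lemma unimodular_parts_exist:
  assumes T: "T \<in> center" and m1: "\<And>x. x \<in> P \<Longrightarrow> m (blinfun_apply T x) = x"
  obtains A B where "unimodular_parts T A B"
proof -
  have b: "m (re (T x)) \<preceq> 1 *\<^sub>R x" "m (im (T x)) \<preceq> 1 *\<^sub>R x" if "x \<in> P" for x
    using m_re_le[of "T x"] m_im_le[of "T x"] m1[OF that] by simp_all
  obtain A where A: "A \<in> center" "\<And>x. x \<in> P \<Longrightarrow> blinfun_apply A x = re (T x)"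
    by (rule center_operator_exists[of "\<lambda>x. re (T x)" 1]) (use b in \<open>auto simp: blinfun.add_right blinfun.scaleR_right\<close>)
  obtain B where B: "B \<in> center" "\<And>x. x \<in> P \<Longrightarrow> blinfun_apply B x = im (T x)"
    by (rule center_operator_exists[of "\<lambda>x. im (T x)" 1]) (use b in \<open>auto simp: blinfun.add_right blinfun.scaleR_right\<close>)
  have bl: "bounded_linear \<iota>"
    using lin(1) norm_iota by (intro bounded_linear_intro[where K = 1]) auto
  have iB: "Blinfun \<iota> (B x) = \<iota> (B x)" for x by (simp add: bounded_linear_Blinfun_apply[OF bl])
  have "T = A + (Blinfun \<iota> o\<^sub>L B)"
    by (rule blinfun_eq_on_cone)
      (simp_all add: blinfun.add_left A(2) B(2) split bounded_linear_Blinfun_apply[OF bl]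
        center_iota[OF T] center_iota[OF A(1)] center_iota[OF B(1)])
  then have eq: "T x = A x + \<iota> (B x)" for x
    by (simp add: blinfun.add_left bounded_linear_Blinfun_apply[OF bl])
  have idc: "id_blinfun \<in> center" using id_center_cone center_cone_sub by blast
  let ?F = "\<lambda>t. cos t *\<^sub>R A + sin t *\<^sub>R B"
  have Fc: "?F t \<in> center" for t
    by (intro subspace_add[OF subspace_center] subspace_scale[OF subspace_center] A B)
  have Fx: "?F t x = cos t *\<^sub>R re (T x) + sin t *\<^sub>R im (T x)" if "x \<in> P" for t x
    using that by (simp add: blinfun.add_left blinfun.scaleR_left A B)
  have "is_cone_sup center_cone (range ?F) id_blinfun"
    unfolding is_cone_sup_def
  proof (intro conjI ballI allI impI)
    fix S assume "S \<in> range ?F"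
    then obtain t where S: "S = ?F t" by auto
    show "cone_le center_cone S id_blinfun"
      unfolding S center_cone_diff_le[OF idc Fc] using m_upper[of _ "T _"] Fx m1 by simp metis
  next
    fix U assume U: "\<forall>S\<in>range ?F. cone_le center_cone S U"
    then have "cone_le center_cone (?F 0) U" by blast
    \<comment> \<open>Upper bounds range over all bounded operators. \<open>U\<close> is central
      because it differs from the central operator \<open>A\<close>, the rotation by 0, by a member
      of the cone.\<close>
    then have "U - ?F 0 \<in> center" using center_cone_sub unfolding cone_le_def by blast
    from subspace_add[OF subspace_center this Fc[of 0]] have Uc: "U \<in> center" by simp
    have "x \<preceq> U x" if "x \<in> P" for x
    proof -
      have "m (T x) \<preceq> U x"
      proof (rule m_least)
        fix t
        have "\<forall>x\<in>P. ?F t x \<preceq> U x" using U center_cone_diff_le[OF Uc Fc] by blast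
        then show "cos t *\<^sub>R re (T x) + sin t *\<^sub>R im (T x) \<preceq> U x" using Fx[OF that] that by metis
      qed
      then show ?thesis using m1[OF that] by simp
    qed
    then show "cone_le center_cone id_blinfun U" unfolding center_cone_diff_le[OF Uc idc] by simp
  qed
  moreover have "A \<in> cone_diff center_cone" "B \<in> cone_diff center_cone"
    by (rule real_center_decomp; simp add: A B)+
  moreover have "\<forall>x. T x = A x + \<iota> (B x)" using eq by blast
  moreover have "\<forall>x\<in>P. re (T x) = A x \<and> im (T x) = B x" by (simp add: A(2) B(2))
  ultimately have "unimodular_parts T A B" unfolding unimodular_parts_def by (intro conjI)
  then show thesis by (rule that)
qed

lemma center_cone_diffD:
  assumes "A \<in> cone_diff center_cone"
  shows "A \<in> center" "\<And>x. x \<in> P \<Longrightarrow> blinfun_apply A x \<in> X"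
proof -
  obtain U V where UV: "A = U - V" "U \<in> center_cone" "V \<in> center_cone"
    using assms by (auto simp: cone_diff_def)
  then show "A \<in> center" using center_cone_sub subspace_diff[OF subspace_center] by blast
  show "A x \<in> X" if "x \<in> P" for x
    using UV that unfolding cone_diff_def center_cone_def by (auto simp: blinfun.diff_left)
qed

text \<open>Under a homomorphism \<open>T\<close> acts as one scalar, so the value at
  \<open>m (T z)\<close> is the absolute value of that scalar times the value at \<open>z\<close>,
  which is additive in positive \<open>z\<close>.\<close>

lemma center_modulus_additive:
  assumes T: "T \<in> center" and x: "x \<in> P" and y: "y \<in> P"
  shows "m (blinfun_apply T (x + y)) = m (T x) + m (T y)"
proof -
  let ?u = "x + y"
  have u: "?u \<in> P" using x y by (rule P_add)
  have pr: "x \<in> principal ?u" "y \<in> principal ?u" "?u \<in> principal ?u"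
    using x y u by (auto intro!: principal_I le_add_P)
  have mT: "\<phi> (m (T z)) = cmod (chom \<phi> (T ?u)) * \<phi> z" if "hom ?u \<phi>" "z \<in> principal ?u" "z \<in> P" for \<phi> z
    using hom_m_eq[OF that(1) center_principal[OF T that(2)]] chom_center[OF that(1) T that(2)]
      hom_pos[OF that] chom_real[OF that(1) P_sub_X[OF that(3)]] by (simp add: norm_mult)
  have prT: "m (T z) \<in> principal ?u" if "z \<in> principal ?u" for z
    using center_principal[OF T that] by (rule principal_m)
  have "m (T ?u) - (m (T x) + m (T y)) = 0"
  proof (rule eq_0_by_homs[OF u])
    show "m (T ?u) - (m (T x) + m (T y)) \<in> principal ?u"
      by (intro principal_diff principal_add prT pr)
    fix \<phi> assume h: "hom ?u \<phi>"
    show "\<phi> (m (T ?u) - (m (T x) + m (T y))) = 0"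
      using mT[OF h] pr x y u hom_add[OF h pr(1,2)]
      by (simp add: hom_diff[OF h] hom_add[OF h] principal_add prT distrib_left)
    show "\<phi> (im (m (T ?u) - (m (T x) + m (T y)))) = 0" by (simp add: hom_0[OF h])
  qed
  then show ?thesis by simp
qed

text \<open>One inequality evaluates the upper bound property at a point. For the other,
  \<open>m (T z)\<close> is additive on \<open>P\<close> and extends to a central operator
  \<open>U\<close>; being an upper bound of the rotations, \<open>U\<close> dominates the
  identity.\<close>

lemma unimodular_modulus:
  assumes T: "T \<in> center" and parts: "unimodular_parts T A B" and x: "x \<in> P"
  shows "m (blinfun_apply T x) = x"
proof -
  let ?F = "\<lambda>t. cos t *\<^sub>R A + sin t *\<^sub>R B"
  have AB: "A \<in> center" "B \<in> center" using parts center_cone_diffD(1) by (auto simp: unimodular_parts_def)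
  have Fc: "?F t \<in> center" for t
    by (intro subspace_add[OF subspace_center] subspace_scale[OF subspace_center] AB)
  have Fx: "?F t z = cos t *\<^sub>R re (T z) + sin t *\<^sub>R im (T z)" if "z \<in> P" for t z
  proof -
    have "re (T z) = A z" "im (T z) = B z" using that parts unfolding unimodular_parts_def by blast+
    then show ?thesis by (simp add: blinfun.add_left blinfun.scaleR_left)
  qed
  have sup: "is_cone_sup center_cone (range ?F) id_blinfun" using parts by (simp add: unimodular_parts_def)
  have idc: "id_blinfun \<in> center" using id_center_cone center_cone_sub by blast
  have le: "m (T z) \<preceq> z" if "z \<in> P" for z
  proof (rule m_least)
    fix t
    have "cone_le center_cone (?F t) id_blinfun" using sup by (auto simp: is_cone_sup_def)
    then have "?F t z \<preceq> z" using that by (simp add: center_cone_diff_le[OF idc Fc])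
    then show "cos t *\<^sub>R re (T z) + sin t *\<^sub>R im (T z) \<preceq> z" by (simp only: Fx[OF that])
  qed
  obtain U where U: "U \<in> center" "\<And>z. z \<in> P \<Longrightarrow> blinfun_apply U z = m (T z)"
  proof (rule center_operator_exists[of "\<lambda>z. m (T z)" 1])
    show "m (T (a + b)) = m (T a) + m (T b)" if "a \<in> P" "b \<in> P" for a b
      by (rule center_modulus_additive[OF T that])
    show "m (m (T z)) \<preceq> 1 *\<^sub>R z" if "z \<in> P" for z using le[OF that] by simp
  qed (auto simp: blinfun.scaleR_right)
  have "\<forall>S\<in>range ?F. cone_le center_cone S U"
  proof
    fix S assume "S \<in> range ?F"
    then obtain t where S: "S = ?F t" by auto
    show "cone_le center_cone S U"
      unfolding S center_cone_diff_le[OF U(1) Fc]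
    proof
      fix z assume z: "z \<in> P"
      show "?F t z \<preceq> U z" unfolding Fx[OF z] U(2)[OF z] by (rule m_upper)
    qed
  qed
  then have "cone_le center_cone id_blinfun U" using sup by (simp add: is_cone_sup_def)
  then have "x \<preceq> m (T x)" using x U by (simp add: center_cone_diff_le[OF U(1) idc])
  with le[OF x] show ?thesis by (rule cle_antisym)
qed

section \<open>Unimodular operators are bijective isometries\<close>

context
  fixes T :: "'a \<Rightarrow>\<^sub>L 'a"
  assumes T: "T \<in> center" and unimodular: "\<And>x. x \<in> P \<Longrightarrow> m (T x) = x"
begin

lemma unimodular_hom:
  assumes h: "hom u \<phi>" shows "cmod (chom \<phi> (T u)) = 1"
  using hom_m_eq[OF h center_principal[OF T principal_self]] hom_P[OF h] hom_unit[OF h]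
  by (simp add: unimodular)

lemma unimodular_preserves_modulus: "m (T x) = m x"
proof -
  let ?u = "m x"
  have pr: "x \<in> principal ?u" by (auto intro: principal_I)
  have "m (T x) - m x = 0"
  proof (rule eq_0_by_homs[of ?u])
    show "m (T x) - m x \<in> principal ?u" using pr by (intro principal_diff principal_m center_principal[OF T])
    fix \<phi> assume h: "hom ?u \<phi>"
    show "\<phi> (m (T x) - m x) = 0"
      using pr hom_m_eq[OF h center_principal[OF T pr]] hom_m_eq[OF h pr] chom_center[OF h T pr] unimodular_hom[OF h]
      by (simp add: hom_diff[OF h] principal_m center_principal[OF T] norm_mult)
    show "\<phi> (im (m (T x) - m x)) = 0" by (simp add: hom_0[OF h])
  qed simp
  then show ?thesis by simp
qed

text \<open>The preimage comes from the adjoint \<open>A - \<iota> B\<close>: under a homomorphism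
  \<open>T\<close> acts as a scalar of modulus one and the adjoint as its conjugate. For real
  scalars the adjoint is \<open>T\<close> itself.\<close>

lemma unimodular_surj: "\<exists>y. T y = x"
proof -
  obtain A B where parts: "unimodular_parts T A B" using unimodular_parts_exist[OF T unimodular] .
  then have AB: "A \<in> center" "B \<in> center" and AX: "\<And>x. x \<in> P \<Longrightarrow> A x \<in> X" and BX: "\<And>x. x \<in> P \<Longrightarrow> B x \<in> X"
    and eq: "\<And>x. T x = A x + \<iota> (B x)"
    using center_cone_diffD by (auto simp: unimodular_parts_def)
  let ?u = "m x"
  have pr: "x \<in> principal ?u" and u: "?u \<in> P" "?u \<in> principal ?u"
    by (auto intro: principal_I principal_self)
  note cp = center_principal[OF T] center_principal[OF AB(1)] center_principal[OF AB(2)]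
  have "T (A x - \<iota> (B x)) = x"
  proof (rule eq_by_chom[OF u(1) _ pr])
    show "T (A x - \<iota> (B x)) \<in> principal ?u"
      by (intro cp principal_diff principal_iota pr)
    fix \<phi> assume h: "hom ?u \<phi>"
    obtain a where a: "chom \<phi> (A ?u) = of_real a" using chom_real[OF h AX[OF u(1)]] by blast
    obtain b where b: "chom \<phi> (B ?u) = of_real b" using chom_real[OF h BX[OF u(1)]] by blast
    have "chom \<phi> (T (A x - \<iota> (B x))) = chom \<phi> (T ?u) * chom \<phi> (A x - \<iota> (B x))"
      by (intro chom_center[OF h T] cp principal_diff principal_iota pr)
    also have "\<dots> = chom \<phi> (T ?u) * cnj (chom \<phi> (T ?u)) * chom \<phi> x"
      using iota_cases
    proof
      assume i: "\<forall>x. im (\<iota> x) = re x \<and> \<iota> (\<iota> x) = - x"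
      have ci: "chom \<phi> (\<iota> y) = \<i> * chom \<phi> y" if "y \<in> principal ?u" for y
        using that i by (simp add: chom_def hom_iota[OF h] hom_re[OF h] complex_eq_iff)
      have e1: "chom \<phi> (A x - \<iota> (B x)) = (of_real a - \<i> * of_real b) * chom \<phi> x"
        using pr by (simp add: chom_diff[OF h] ci cp principal_iota
            chom_center[OF h AB(1)] chom_center[OF h AB(2)] a b algebra_simps)
      have e2: "chom \<phi> (T ?u) = of_real a + \<i> * of_real b"
        unfolding eq using u(2) by (simp add: chom_add[OF h] ci cp principal_iota a b)
      show ?thesis unfolding e1 e2 by (simp add: complex_eq_iff algebra_simps)
    next
      assume i: "\<forall>x. im x = 0 \<and> \<iota> x = 0"
      then show ?thesis
        unfolding eq using pr by (simp add: chom_center[OF h AB(1)] a)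
    qed
    also have "\<dots> = chom \<phi> x"
      using unimodular_hom[OF h] by (simp add: complex_norm_square[symmetric])
    finally show "chom \<phi> (T (A x - \<iota> (B x))) = chom \<phi> x" .
  qed
  then show ?thesis by blast
qed

lemma unimodular_bij: "bij (blinfun_apply T)" and unimodular_norm: "norm (T x) = norm x"
proof -
  show n: "norm (T x) = norm x" for x
    using norm_modulus[of "T x"] norm_modulus[of x] unimodular_preserves_modulus[of x] by simp
  have "x = y" if "T x = T y" for x y
    using n[of "x - y"] that by (simp add: blinfun.diff_right)
  then have "inj (blinfun_apply T)" by (rule injI)
  moreover have "surj (blinfun_apply T)" using unimodular_surj by (metis surjI)
  ultimately show "bij (blinfun_apply T)" by (simp add: bij_def)
qed

end

end

section \<open>Transport along a bijective isometry\<close>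

lemma real_abs_eqI: "order_cone P \<Longrightarrow> is_real_abs P x a \<Longrightarrow> real_abs P x = a"
  unfolding real_abs_def is_real_abs_def by (blast intro: the_equality is_cone_sup_unique)

context
  fixes T :: "'a::real_normed_vector \<Rightarrow> 'a"
  assumes T: "bounded_linear T" and bij: "bij T"
begin

interpretation T: bounded_linear T by (rule T)

lemma image_mem_iff: "T x \<in> T ` S \<longleftrightarrow> x \<in> S"
  using bij by (auto simp: bij_def inj_def)

lemma cone_le_image: "cone_le (T ` P) (T x) (T y) \<longleftrightarrow> cone_le P x y"
  by (simp add: cone_le_def image_mem_iff flip: T.diff)

text \<open>Suprema quantify over upper bounds in the whole space; surjectivity of \<open>T\<close>
  allows each of them to be written as \<open>T u\<close>.\<close>

lemma is_cone_sup_image: "is_cone_sup (T ` P) (T ` S) (T s) \<longleftrightarrow> is_cone_sup P S s"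
proof -
  have "(\<forall>u. Q u) \<longleftrightarrow> (\<forall>u. Q (T u))" for Q using bij by (metis bij_pointE)
  from this[of "\<lambda>u. (\<forall>x\<in>S. cone_le (T ` P) (T x) u) \<longrightarrow> cone_le (T ` P) (T s) u"]
  show ?thesis by (simp add: is_cone_sup_def cone_le_image)
qed

lemma order_cone_image: "order_cone P \<Longrightarrow> order_cone (T ` P)"
proof -
  assume P: "order_cone P"
  have "uminus ` T ` P = T ` uminus ` P" by (simp add: image_image T.neg)
  then have "T ` P \<inter> uminus ` T ` P = T ` (P \<inter> uminus ` P)"
    using bij by (simp add: bij_def image_Int)
  then show ?thesis
    using P T by (simp add: order_cone_def convex_cone_linear_image bounded_linear.linear)
qed

lemma cone_diff_image: "cone_diff (T ` P) = T ` cone_diff P"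
proof -
  have "cone_diff (T ` P) = {T x - T y |x y. x \<in> P \<and> y \<in> P}" unfolding cone_diff_def by blast
  also have "\<dots> = T ` cone_diff P" unfolding cone_diff_def by (auto simp: image_iff simp flip: T.diff)
  finally show ?thesis .
qed

lemma is_real_abs_image: "is_real_abs (T ` P) (T x) (T a) \<longleftrightarrow> is_real_abs P x a"
  using is_cone_sup_image[of P "{x, - x}" a] by (simp add: is_real_abs_def T.neg)

lemma banach_lattice_on_image:
  assumes norm: "\<And>x. norm (T x) = norm x" and X: "banach_lattice_on X P"
  shows "banach_lattice_on (T ` X) (T ` P)"
proof -
  have sub: "subspace X" and P: "order_cone P" and sup: "\<And>x y. x \<in> X \<Longrightarrow> y \<in> X \<Longrightarrow> \<exists>s. is_cone_sup P {x, y} s"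
    and mono: "\<And>x y. x \<in> X \<Longrightarrow> y \<in> X \<Longrightarrow> cone_le P (real_abs P x) (real_abs P y) \<Longrightarrow> norm x \<le> norm y"
    using X by (auto simp: banach_lattice_on_def)
  have abs: "real_abs (T ` P) (T x) = T (real_abs P x)" if x: "x \<in> X" for x
  proof -
    obtain a where a: "is_real_abs P x a" using sup[OF x subspace_neg[OF sub x]] by (auto simp: is_real_abs_def)
    then show ?thesis
      using real_abs_eqI[OF P a] real_abs_eqI[OF order_cone_image[OF P], of "T x" "T a"] by (simp add: is_real_abs_image)
  qed
  have "complete (T ` X)"
    using X norm by (intro complete_isometric_image[of 1] T) (auto simp: banach_lattice_on_def)
  moreover have "\<exists>s. is_cone_sup (T ` P) {T x, T y} s" if xy: "x \<in> X" "y \<in> X" for x y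
  proof -
    obtain s where "is_cone_sup P {x, y} s" using sup[OF xy] by blast
    then have "is_cone_sup (T ` P) (T ` {x, y}) (T s)" by (simp only: is_cone_sup_image)
    then show ?thesis by auto
  qed
  ultimately show ?thesis
    using X order_cone_image[OF P] linear_subspace_image[OF T.linear sub]
    by (auto simp: banach_lattice_on_def abs cone_le_image norm)
qed

end

section \<open>Real Banach lattices\<close>

text \<open>An opaque name: with \<open>\<lambda>_. 0\<close> the additivity rules of the locale would become the looping \<open>0 = 0 + 0\<close>.\<close>

definition zero_map :: "'a \<Rightarrow> 'a::zero" where "zero_map x = 0"

text \<open>Stated for any convex cone because it serves both the cone of a real lattice and, in the
  space of operators, the cone of its center.\<close>

lemma is_cone_sup_range_cos:
  assumes C: "convex_cone C"
  shows "is_cone_sup C (range (\<lambda>t. cos t *\<^sub>R x + sin t *\<^sub>R 0)) m \<longleftrightarrow> is_cone_sup C {x, - x} m"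
proof -
  have "(\<forall>y\<in>range (\<lambda>t. cos t *\<^sub>R x + sin t *\<^sub>R 0). cone_le C y u) \<longleftrightarrow> (\<forall>y\<in>{x, - x}. cone_le C y u)" for u
  proof
    assume l: "\<forall>y\<in>range (\<lambda>t. cos t *\<^sub>R x + sin t *\<^sub>R 0). cone_le C y u"
    have "x \<in> range (\<lambda>t. cos t *\<^sub>R x + sin t *\<^sub>R 0)" by (rule image_eqI[where x = 0]) auto
    moreover have "- x \<in> range (\<lambda>t. cos t *\<^sub>R x + sin t *\<^sub>R 0)" by (rule image_eqI[where x = pi]) auto
    ultimately show "\<forall>y\<in>{x, - x}. cone_le C y u" using l by blast
  next
    assume r: "\<forall>y\<in>{x, - x}. cone_le C y u"
    show "\<forall>y\<in>range (\<lambda>t. cos t *\<^sub>R x + sin t *\<^sub>R 0). cone_le C y u"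
    proof
      fix y assume "y \<in> range (\<lambda>t. cos t *\<^sub>R x + sin t *\<^sub>R 0)"
      then obtain t where y: "y = cos t *\<^sub>R x" by auto
      have "0 \<le> (1 + cos t)/2" "0 \<le> (1 - cos t)/2"
        using cos_ge_minus_one[of t] cos_le_one[of t] by (simp_all add: zero_le_divide_iff, linarith)
      then have "((1 + cos t)/2) *\<^sub>R (u - x) + ((1 - cos t)/2) *\<^sub>R (u - - x) \<in> C"
        using r by (intro convex_cone_add[OF C] convex_cone_scaleR[OF C]) (simp_all only: cone_le_def ball_simps)
      moreover have "((1 + cos t)/2) *\<^sub>R (u - x) + ((1 - cos t)/2) *\<^sub>R (u - - x)
          = ((1 + cos t)/2 + (1 - cos t)/2) *\<^sub>R u - ((1 + cos t)/2 - (1 - cos t)/2) *\<^sub>R x"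
        by (simp only: scaleR_diff_right scaleR_left_distrib scaleR_left_diff_distrib scaleR_minus_right) simp
      moreover have "(1 + cos t)/2 + (1 - cos t)/2 = 1" "(1 + cos t)/2 - (1 - cos t)/2 = cos t"
        by (simp_all add: field_simps)
      ultimately show "cone_le C y u" by (simp add: cone_le_def y)
    qed
  qed
  then show ?thesis by (simp only: is_cone_sup_def)
qed

lemma is_real_abs_self: "order_cone P \<Longrightarrow> x \<in> P \<Longrightarrow> is_real_abs P x x"
  using order_coneD(1)[of P] order_coneD(2)[of P x x] by (simp add: is_real_abs_def is_cone_sup_def cone_le_def)

lemma banach_lattice_on_norm_mono:
  assumes "banach_lattice_on X P" "x \<in> P" "y \<in> P" "cone_le P x y"
  shows "norm x \<le> norm y"
proof -
  have "order_cone P" "P \<subseteq> X" using assms(1) by (auto simp: banach_lattice_on_def)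
  then have "cone_le P (real_abs P x) (real_abs P y)" "x \<in> X" "y \<in> X"
    using assms(2-4) by (auto simp: real_abs_eqI[OF _ is_real_abs_self])
  then show ?thesis using assms(1) by (auto simp: banach_lattice_on_def)
qed

lemma (in modulus_lattice) convex_cone_center_cone: "convex_cone center_cone"
  unfolding convex_cone_iff center_cone_def
  using subspace_0[OF subspace_center] subspace_add[OF subspace_center] subspace_scale[OF subspace_center]
  by (simp add: blinfun.add_left blinfun.scaleR_left P_add P_scale)

lemma real_abs_eq_modulus:
  assumes "order_cone P" shows "real_abs P = modulus P id zero_map"
  using assms by (intro ext) (simp add: real_abs_def modulus_def is_real_abs_def is_cone_sup_range_cos order_cone_def zero_map_def
      del: scaleR_zero_right)

lemma real_modulus_lattice:
  assumes "real_banach_lattice P"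
  shows "modulus_lattice P zero_map id zero_map"
proof -
  have X: "banach_lattice_on UNIV P" using assms by (simp add: real_banach_lattice_def)
  then have P: "order_cone P" by (simp add: banach_lattice_on_def)
  have ex: "\<exists>a. is_real_abs P x a" for x using X by (auto simp: banach_lattice_on_def is_real_abs_def)
  have abs: "is_real_abs P x (real_abs P x)" for x using ex[of x] real_abs_eqI[OF P] by metis
  have halves: "(1/2) *\<^sub>R (real_abs P x + x) \<in> P" "(1/2) *\<^sub>R (real_abs P x - x) \<in> P" for x
    using abs[of x] order_coneD(3)[OF P, of "1/2"] by (auto simp: is_real_abs_def is_cone_sup_def cone_le_def)
  have "x \<in> cone_diff P" for x
  proof -
    have "x = (1/2) *\<^sub>R (real_abs P x + x) - (1/2) *\<^sub>R (real_abs P x - x)"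
      using scaleR_half_double[of x] by (simp add: algebra_simps)
    then show ?thesis unfolding cone_diff_def using halves by blast
  qed
  \<comment> \<open>\<open>x\<close> and its absolute value have the same absolute value, so
    monotonicity of the norm applies in both directions.\<close>
  moreover have "norm (real_abs P x) = norm x" for x
  proof -
    have "(1/2) *\<^sub>R (real_abs P x + x) + (1/2) *\<^sub>R (real_abs P x - x) \<in> P"
      using halves order_coneD(2)[OF P] by blast
    moreover have "(1/2) *\<^sub>R (real_abs P x + x) + (1/2) *\<^sub>R (real_abs P x - x) = real_abs P x"
      using scaleR_half_double[of "real_abs P x"] by (simp add: algebra_simps)
    ultimately have "real_abs P (real_abs P x) = real_abs P x"
      using real_abs_eqI[OF P is_real_abs_self[OF P]] by simp
    then show ?thesis
      using X order_coneD(1)[OF P] by (intro order_antisym) (auto simp: banach_lattice_on_def cone_le_def)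
  qed
  moreover have "\<exists>m. is_cone_sup P (range (\<lambda>t. cos t *\<^sub>R x + sin t *\<^sub>R 0)) m" for x
    using ex[of x] P is_cone_sup_range_cos[of P x] by (auto simp: is_real_abs_def order_cone_def simp del: scaleR_zero_right)
  ultimately show ?thesis
    using P banach_lattice_on_norm_mono[OF X]
    by unfold_locales (auto simp: real_abs_eq_modulus linear_iff zero_map_def simp del: scaleR_zero_right)
qed

lemma real_defs_eq:
  assumes "real_banach_lattice P"
  shows "real_closed_ideals P = modulus_lattice.closed_ideals P zero_map id zero_map"
    "real_center P = modulus_lattice.center P zero_map id zero_map"
    "real_center_cone P = modulus_lattice.center_cone P zero_map id zero_map"
proof -
  interpret modulus_lattice P zero_map id zero_map using assms by (rule real_modulus_lattice)
  note abs = real_abs_eq_modulus[OF cone]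
  show "real_closed_ideals P = closed_ideals"
    by (simp add: real_closed_ideals_def closed_ideals_def abs subspace_0 zero_map_def cong: conj_cong)
  show c: "real_center P = center" by (simp add: real_center_def center_def abs zero_map_def)
  show "real_center_cone P = center_cone" by (simp add: real_center_cone_def center_cone_def c)
qed

lemma real_unimodular:
  assumes P: "real_banach_lattice P" and T: "T \<in> real_center P"
  shows "is_real_abs (real_center_cone P) T id_blinfun \<longleftrightarrow> (\<forall>x\<in>P. real_abs P (blinfun_apply T x) = x)"
proof -
  interpret modulus_lattice P zero_map id zero_map using P by (rule real_modulus_lattice)
  note abs = real_abs_eq_modulus[OF cone]
  note zero_map_def [simp]
  have TC: "T \<in> center" using T by (simp add: real_defs_eq[OF P])
  have parts: "unimodular_parts T T 0 \<longleftrightarrow> is_real_abs center_cone T id_blinfun"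
  proof -
    have "T \<in> cone_diff center_cone" "0 \<in> cone_diff center_cone"
      using TC subspace_0[OF subspace_center] re_in by (auto intro!: real_center_decomp)
    then show ?thesis
      unfolding unimodular_parts_def is_real_abs_def is_cone_sup_range_cos[OF convex_cone_center_cone] by simp
  qed
  show ?thesis
    unfolding real_defs_eq[OF P] abs parts[symmetric]
  proof
    assume "unimodular_parts T T 0"
    then show "\<forall>x\<in>P. m (T x) = x" using unimodular_modulus[OF TC] by blast
  next
    assume m1: "\<forall>x\<in>P. m (T x) = x"
    then obtain A B where AB: "unimodular_parts T A B" using unimodular_parts_exist[OF TC] by blast
    have "A = T" using AB by (intro blinfun_eqI) (simp add: unimodular_parts_def)
    moreover have "B = 0"
      by (rule blinfun_eq_on_cone) (use AB in \<open>auto simp: unimodular_parts_def\<close>)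
    ultimately show "unimodular_parts T T 0" using AB by simp
  qed
qed

text \<open>The hypothesis has \<open>x\<close>, not \<open>T x\<close>, on the left. It makes
  domination of one vector by another the same relation for both cones, so the ideals agree as sets
  and not merely up to the action of \<open>T\<close>.\<close>

lemma real_closed_ideals_image:
  fixes T :: "'a::real_normed_vector \<Rightarrow> 'a"
  assumes "bounded_linear T" "bij T" and abs: "\<And>x. real_abs (T ` P) x = T (real_abs P x)"
  shows "real_closed_ideals (T ` P) = real_closed_ideals P"
  by (simp add: real_closed_ideals_def abs cone_le_image[OF assms(1,2)])

section \<open>Both implications for real scalars\<close>

lemma real_same_ideals_imp_central:
  fixes P :: "'a::banach set"
  assumes P: "real_banach_lattice P" and W: "real_banach_lattice W"
    and same: "real_closed_ideals P = real_closed_ideals W"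
  shows "\<exists>T. T \<in> real_center P \<and> is_real_abs (real_center_cone P) T id_blinfun \<and>
    (\<forall>x\<in>P. blinfun_apply T x = real_abs W x)"
proof -
  interpret A: modulus_lattice P zero_map id zero_map using P by (rule real_modulus_lattice)
  interpret B: modulus_lattice W zero_map id zero_map using W by (rule real_modulus_lattice)
  interpret lattice_pair P W zero_map id zero_map id zero_map
    using same by unfold_locales (simp add: real_defs_eq[OF P] real_defs_eq[OF W])
  obtain T where T: "T \<in> A.center" "\<And>x. x \<in> P \<Longrightarrow> blinfun_apply T x = B.m x"
    "\<And>x. x \<in> P \<Longrightarrow> A.m (blinfun_apply T x) = x" by (rule central_operator_exists) blast
  then have TC: "T \<in> real_center P" by (simp add: real_defs_eq[OF P])
  moreover have "is_real_abs (real_center_cone P) T id_blinfun"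
    unfolding real_unimodular[OF P TC] real_abs_eq_modulus[OF A.cone] using T(3) by blast
  ultimately show ?thesis using T(2) by (intro exI[of _ T]) (simp add: real_abs_eq_modulus[OF B.cone])
qed

lemma real_unimodular_image:
  fixes P :: "'a::banach set"
  assumes P: "real_banach_lattice P" and T: "T \<in> real_center P"
    and abs1: "is_real_abs (real_center_cone P) T id_blinfun"
  shows "order_cone (blinfun_apply T ` P) \<and> real_banach_lattice (blinfun_apply T ` P) \<and>
    real_closed_ideals P = real_closed_ideals (blinfun_apply T ` P)"
proof -
  interpret modulus_lattice P zero_map id zero_map using P by (rule real_modulus_lattice)
  note abs = real_abs_eq_modulus[OF cone]
  note zero_map_def [simp]
  have TC: "T \<in> center" using T by (simp add: real_defs_eq[OF P])
  have m1: "m (T x) = x" if "x \<in> P" for x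
    using abs1 that unfolding real_unimodular[OF P T] abs by blast
  have bl: "bounded_linear (blinfun_apply T)" by (rule blinfun.bounded_linear_right)
  have bij: "bij (blinfun_apply T)" and norm: "norm (T x) = norm x" and mT: "m (T x) = m x" for x
    using unimodular_bij[OF TC m1] unimodular_norm[OF TC m1] unimodular_preserves_modulus[OF TC m1] by auto
  have oc: "order_cone (T ` P)" by (rule order_cone_image[OF bl bij cone])
  have "real_banach_lattice (T ` P)"
    using banach_lattice_on_image[OF bl bij norm, of UNIV P] P bij
    by (simp add: real_banach_lattice_def bij_def)
  \<comment> \<open>Transport gives \<open>T\<close> applied to the absolute value of
    \<open>y\<close>, where \<open>x = T y\<close>; since \<open>T\<close> preserves moduli,
    \<open>y\<close> may be replaced by \<open>x\<close>.\<close>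
  moreover have "real_abs (T ` P) x = T (real_abs P x)" for x
  proof -
    obtain y where y: "x = T y" using bij by (meson bij_pointE)
    have "is_real_abs P y (m y)"
      using is_sup_m[of y] is_cone_sup_range_cos[of P y "m y"] cone
      by (simp add: is_real_abs_def order_cone_def del: scaleR_zero_right)
    then show ?thesis
      by (simp add: y abs mT real_abs_eqI[OF oc] is_real_abs_image[OF bl bij])
  qed
  ultimately show ?thesis using oc real_closed_ideals_image[OF bl bij] by metis
qed

section \<open>Complex Banach lattices\<close>

definition complex_re :: "'a::complex_vector set \<Rightarrow> 'a \<Rightarrow> 'a" where
  "complex_re P z = (SOME x. x \<in> cone_diff P \<and> (\<exists>y\<in>cone_diff P. z = x + \<i> *\<^sub>C y))"

definition complex_im :: "'a::complex_vector set \<Rightarrow> 'a \<Rightarrow> 'a" where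
  "complex_im P z = (SOME y. y \<in> cone_diff P \<and> z = complex_re P z + \<i> *\<^sub>C y)"

lemma linear_scaleC: "linear (\<lambda>x. c *\<^sub>C (x::'a::complex_normed_vector))"
  by (rule bounded_linear.linear[OF bounded_linear_scaleC])

lemma scaleC_minus_one: "(-1) *\<^sub>C x = - (x::'a::complex_vector)"
  using scaleR_scaleC[of "-1" x] by simp

text \<open>Reduces conditions on all complex scalars to real scalars and multiplication by
  \<open>\<i>\<close>, the form used in the common locale.\<close>

lemma scaleC_eq: "c *\<^sub>C x = Re c *\<^sub>R x + Im c *\<^sub>R (\<i> *\<^sub>C (x::'a::complex_vector))"
proof -
  have "c = of_real (Re c) + of_real (Im c) * \<i>" by (simp add: complex_eq_iff)
  then have "c *\<^sub>C x = (of_real (Re c) + of_real (Im c) * \<i>) *\<^sub>C x" by (rule arg_cong)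
  then show ?thesis by (simp add: scaleC_add_left scaleR_scaleC scaleC_scaleC)
qed

section \<open>Complexifications as instances of the common locale\<close>

context
  fixes P :: "'a::complex_banach set"
  assumes P: "complex_banach_lattice P"
begin

lemma complex_base: "banach_lattice_on (cone_diff P) P"
  using P by (simp add: complex_banach_lattice_def)

lemma complex_decomp_unique:
  assumes "x \<in> cone_diff P" "y \<in> cone_diff P" "x' \<in> cone_diff P" "y' \<in> cone_diff P"
    and "x + \<i> *\<^sub>C y = x' + \<i> *\<^sub>C y'"
  shows "x = x'" "y = y'"
proof -
  have "\<exists>!p. case p of (a, b) \<Rightarrow> a \<in> cone_diff P \<and> b \<in> cone_diff P \<and> x + \<i> *\<^sub>C y = a + \<i> *\<^sub>C b"
    using P by (simp add: complex_banach_lattice_def)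
  then obtain p where "\<And>q. (case q of (a, b) \<Rightarrow> a \<in> cone_diff P \<and> b \<in> cone_diff P \<and> x + \<i> *\<^sub>C y = a + \<i> *\<^sub>C b) \<Longrightarrow> q = p"
    by (elim ex1E) blast
  from this[of "(x, y)"] this[of "(x', y')"] have "(x, y) = (x', y')" using assms by simp
  then show "x = x'" "y = y'" by simp_all
qed

lemma complex_re_im:
  shows "complex_re P z \<in> cone_diff P" "complex_im P z \<in> cone_diff P"
    "complex_re P z + \<i> *\<^sub>C complex_im P z = z"
proof -
  have "\<exists>!p. case p of (a, b) \<Rightarrow> a \<in> cone_diff P \<and> b \<in> cone_diff P \<and> z = a + \<i> *\<^sub>C b"
    using P by (simp add: complex_banach_lattice_def)
  then have "\<exists>x. x \<in> cone_diff P \<and> (\<exists>y\<in>cone_diff P. z = x + \<i> *\<^sub>C y)" by auto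
  from someI_ex[OF this] have re: "complex_re P z \<in> cone_diff P" "\<exists>y\<in>cone_diff P. z = complex_re P z + \<i> *\<^sub>C y"
    by (simp_all add: complex_re_def)
  from this(2) have "\<exists>y. y \<in> cone_diff P \<and> z = complex_re P z + \<i> *\<^sub>C y" by blast
  from someI_ex[OF this] have "complex_im P z \<in> cone_diff P \<and> z = complex_re P z + \<i> *\<^sub>C complex_im P z"
    by (simp add: complex_im_def)
  with re(1) show "complex_re P z \<in> cone_diff P" "complex_im P z \<in> cone_diff P"
    "complex_re P z + \<i> *\<^sub>C complex_im P z = z" by auto
qed

lemma complex_re_im_eqI:
  assumes "x \<in> cone_diff P" "y \<in> cone_diff P" "z = x + \<i> *\<^sub>C y"
  shows "complex_re P z = x" "complex_im P z = y"
  using complex_decomp_unique[OF complex_re_im(1,2)[of z] assms(1,2)] complex_re_im(3)[of z] assms(3) by auto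

lemma is_complex_abs_iff:
  "is_complex_abs P z a \<longleftrightarrow> is_cone_sup P (range (\<lambda>t. cos t *\<^sub>R complex_re P z + sin t *\<^sub>R complex_im P z)) a"
proof
  assume "is_complex_abs P z a"
  then obtain x y where "x \<in> cone_diff P" "y \<in> cone_diff P" "z = x + \<i> *\<^sub>C y"
    "is_cone_sup P (range (\<lambda>t. cos t *\<^sub>R x + sin t *\<^sub>R y)) a" by (auto simp: is_complex_abs_def)
  then show "is_cone_sup P (range (\<lambda>t. cos t *\<^sub>R complex_re P z + sin t *\<^sub>R complex_im P z)) a"
    by (simp only: complex_re_im_eqI)
next
  assume "is_cone_sup P (range (\<lambda>t. cos t *\<^sub>R complex_re P z + sin t *\<^sub>R complex_im P z)) a"
  then show "is_complex_abs P z a"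
    unfolding is_complex_abs_def using complex_re_im[of z] by metis
qed

lemma complex_abs_eq_modulus: "complex_abs P = modulus P (complex_re P) (complex_im P)"
  by (intro ext) (simp add: complex_abs_def modulus_def is_complex_abs_iff)

lemma complex_modulus_lattice:
  "modulus_lattice P (\<lambda>x. \<i> *\<^sub>C x) (complex_re P) (complex_im P)"
proof -
  have sub: "subspace (cone_diff P)" and oc: "order_cone P"
    using complex_base by (auto simp: banach_lattice_on_def)
  note c = complex_re_im
  have add: "complex_re P (z + w) = complex_re P z + complex_re P w"
    "complex_im P (z + w) = complex_im P z + complex_im P w" for z w
  proof -
    have "z + w = (complex_re P z + complex_re P w) + \<i> *\<^sub>C (complex_im P z + complex_im P w)"
      using c(3)[of z] c(3)[of w] by (simp add: scaleC_add_right algebra_simps)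
    from complex_re_im_eqI[OF _ _ this] show "complex_re P (z + w) = complex_re P z + complex_re P w"
      "complex_im P (z + w) = complex_im P z + complex_im P w"
      using c subspace_add[OF sub] by auto
  qed
  have scale: "complex_re P (r *\<^sub>R z) = r *\<^sub>R complex_re P z"
    "complex_im P (r *\<^sub>R z) = r *\<^sub>R complex_im P z" for r z
  proof -
    have "r *\<^sub>R z = r *\<^sub>R complex_re P z + \<i> *\<^sub>C (r *\<^sub>R complex_im P z)"
      using c(3)[of z] by (simp add: linear_scale[OF linear_scaleC] flip: scaleR_add_right)
    from complex_re_im_eqI[OF _ _ this] show "complex_re P (r *\<^sub>R z) = r *\<^sub>R complex_re P z"
      "complex_im P (r *\<^sub>R z) = r *\<^sub>R complex_im P z"
      using c subspace_scale[OF sub] by auto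
  qed
  have ii: "\<i> *\<^sub>C (\<i> *\<^sub>C z) = - z" for z :: 'a by (simp add: scaleC_scaleC scaleC_minus_one)
  have iota: "complex_re P (\<i> *\<^sub>C z) = - complex_im P z" "complex_im P (\<i> *\<^sub>C z) = complex_re P z" for z
  proof -
    have "\<i> *\<^sub>C z = \<i> *\<^sub>C (complex_re P z + \<i> *\<^sub>C complex_im P z)" by (simp only: c(3))
    then have "\<i> *\<^sub>C z = (- complex_im P z) + \<i> *\<^sub>C complex_re P z" by (simp add: scaleC_add_right ii)
    from complex_re_im_eqI[OF _ _ this] show "complex_re P (\<i> *\<^sub>C z) = - complex_im P z" "complex_im P (\<i> *\<^sub>C z) = complex_re P z"
      using c subspace_neg[OF sub] by auto
  qed
  have real: "complex_re P x = x" "complex_im P x = 0" if "x \<in> cone_diff P" for x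
    using complex_re_im_eqI[OF that subspace_0[OF sub], of x] linear_0[OF linear_scaleC] by auto
  have ex: "\<exists>a. is_complex_abs P z a \<and> norm z = norm a" for z using P by (auto simp: complex_banach_lattice_def)
  have norm: "norm (modulus P (complex_re P) (complex_im P) z) = norm z" for z
  proof -
    obtain a where a: "is_complex_abs P z a" "norm z = norm a" using ex by blast
    then have "modulus P (complex_re P) (complex_im P) z = a"
      unfolding modulus_def is_complex_abs_iff by (intro the_equality is_cone_sup_unique[OF oc])
    then show ?thesis using a by simp
  qed
  show ?thesis
  proof (rule modulus_lattice.intro)
    show "\<exists>a. is_cone_sup P (range (\<lambda>t. cos t *\<^sub>R complex_re P z + sin t *\<^sub>R complex_im P z)) a" for z
      using ex[of z] by (auto simp: is_complex_abs_iff)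
    show "linear (complex_re P)" "linear (complex_im P)" by (auto simp: linear_iff add scale)
  qed (auto simp: oc linear_scaleC c real iota ii norm norm_scaleC intro: banach_lattice_on_norm_mono[OF complex_base])
qed

lemma complex_defs_eq:
  shows "complex_closed_ideals P = modulus_lattice.closed_ideals P (\<lambda>x. \<i> *\<^sub>C x) (complex_re P) (complex_im P)"
    "complex_center P = modulus_lattice.center P (\<lambda>x. \<i> *\<^sub>C x) (complex_re P) (complex_im P)"
    "complex_center_cone P = modulus_lattice.center_cone P (\<lambda>x. \<i> *\<^sub>C x) (complex_re P) (complex_im P)"
proof -
  interpret modulus_lattice P "\<lambda>x. \<i> *\<^sub>C x" "complex_re P" "complex_im P" by (rule complex_modulus_lattice)
  note abs = complex_abs_eq_modulus
  have "(\<forall>c. \<forall>x\<in>I. c *\<^sub>C x \<in> I) \<longleftrightarrow> (\<forall>x\<in>I. \<i> *\<^sub>C x \<in> I)" if "subspace I" for I :: "'a set"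
    using subspace_add[OF that] subspace_scale[OF that] scaleC_eq by metis
  then show "complex_closed_ideals P = closed_ideals"
    unfolding complex_closed_ideals_def closed_ideals_def abs by blast
  have "(\<forall>c x. T (c *\<^sub>C x) = c *\<^sub>C T x) \<longleftrightarrow> (\<forall>x. T (\<i> *\<^sub>C x) = \<i> *\<^sub>C T x)" for T :: "'a \<Rightarrow>\<^sub>L 'a"
  proof
    assume i: "\<forall>x. T (\<i> *\<^sub>C x) = \<i> *\<^sub>C T x"
    show "\<forall>c x. T (c *\<^sub>C x) = c *\<^sub>C T x"
    proof (intro allI)
      fix c x
      show "T (c *\<^sub>C x) = c *\<^sub>C T x"
        unfolding scaleC_eq[of c x] scaleC_eq[of c "T x"]
        by (simp only: blinfun.add_right blinfun.scaleR_right i[rule_format])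
    qed
  qed blast
  then show c: "complex_center P = center" by (simp add: complex_center_def center_def abs)
  show "complex_center_cone P = center_cone" by (simp add: complex_center_cone_def center_cone_def c)
qed

lemma complex_unimodular:
  assumes T: "T \<in> complex_center P"
  shows "is_complex_abs (complex_center_cone P) T id_blinfun \<longleftrightarrow> (\<forall>x\<in>P. complex_abs P (blinfun_apply T x) = x)"
proof -
  interpret modulus_lattice P "\<lambda>x. \<i> *\<^sub>C x" "complex_re P" "complex_im P" by (rule complex_modulus_lattice)
  have TC: "T \<in> center" using T by (simp add: complex_defs_eq)
  show ?thesis
    unfolding complex_defs_eq complex_abs_eq_modulus
  proof
    assume "is_complex_abs center_cone T id_blinfun"
    then obtain A B where AB: "A \<in> cone_diff center_cone" "B \<in> cone_diff center_cone" "T = A + \<i> *\<^sub>C B"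
      "is_cone_sup center_cone (range (\<lambda>t. cos t *\<^sub>R A + sin t *\<^sub>R B)) id_blinfun"
      by (auto simp: is_complex_abs_def)
    have eq: "\<forall>x. T x = A x + \<i> *\<^sub>C B x" by (simp add: AB(3) blinfun.add_left blinfun_apply_scaleC)
    \<comment> \<open>\<open>A\<close> and \<open>B\<close> send \<open>P\<close> to real vectors,
      so uniqueness of the decomposition makes their values the parts of \<open>T x\<close>.\<close>
    moreover have "\<forall>x\<in>P. complex_re P (T x) = A x \<and> complex_im P (T x) = B x"
    proof
      fix x assume "x \<in> P"
      then show "complex_re P (T x) = A x \<and> complex_im P (T x) = B x"
        using complex_re_im_eqI[OF center_cone_diffD(2)[OF AB(1)] center_cone_diffD(2)[OF AB(2)] eq[rule_format]]
        by simp
    qed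
    ultimately have "unimodular_parts T A B" unfolding unimodular_parts_def using AB by (intro conjI)
    then show "\<forall>x\<in>P. m (T x) = x" using unimodular_modulus[OF TC] by blast
  next
    assume "\<forall>x\<in>P. m (T x) = x"
    then obtain A B where AB: "unimodular_parts T A B" using unimodular_parts_exist[OF TC] by blast
    have "T = A + \<i> *\<^sub>C B"
      using AB by (intro blinfun_eqI) (simp add: unimodular_parts_def blinfun.add_left blinfun_apply_scaleC)
    then show "is_complex_abs center_cone T id_blinfun"
      using AB unfolding unimodular_parts_def is_complex_abs_def by blast
  qed
qed

end

section \<open>Both implications for complex scalars\<close>

lemma complex_same_ideals_imp_central:
  fixes P :: "'a::complex_banach set"
  assumes P: "complex_banach_lattice P" and W: "complex_banach_lattice W"
    and same: "complex_closed_ideals P = complex_closed_ideals W"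
  shows "\<exists>T. T \<in> complex_center P \<and> is_complex_abs (complex_center_cone P) T id_blinfun \<and>
    (\<forall>x\<in>P. blinfun_apply T x = complex_abs W x)"
proof -
  interpret A: modulus_lattice P "\<lambda>x. \<i> *\<^sub>C x" "complex_re P" "complex_im P" by (rule complex_modulus_lattice[OF P])
  interpret B: modulus_lattice W "\<lambda>x. \<i> *\<^sub>C x" "complex_re W" "complex_im W" by (rule complex_modulus_lattice[OF W])
  interpret lattice_pair P W "\<lambda>x. \<i> *\<^sub>C x" "complex_re P" "complex_im P" "complex_re W" "complex_im W"
    using same by unfold_locales (simp add: complex_defs_eq[OF P] complex_defs_eq[OF W])
  obtain T where T: "T \<in> A.center" "\<And>x. x \<in> P \<Longrightarrow> blinfun_apply T x = B.m x"
    "\<And>x. x \<in> P \<Longrightarrow> A.m (blinfun_apply T x) = x" by (rule central_operator_exists) blast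
  then have TC: "T \<in> complex_center P" by (simp add: complex_defs_eq[OF P])
  moreover have "is_complex_abs (complex_center_cone P) T id_blinfun"
    unfolding complex_unimodular[OF P TC] complex_abs_eq_modulus[OF P] using T(3) by blast
  ultimately show ?thesis using T(2) by (intro exI[of _ T]) (simp add: complex_abs_eq_modulus[OF W])
qed

lemma is_complex_abs_image:
  fixes T :: "'a::complex_normed_vector \<Rightarrow> 'a"
  assumes T: "bounded_linear T" and bij: "bij T" and iota: "\<And>x. T (\<i> *\<^sub>C x) = \<i> *\<^sub>C T x"
  shows "is_complex_abs (T ` P) (T z) (T a) \<longleftrightarrow> is_complex_abs P z a"
proof -
  interpret T: bounded_linear T by (rule T)
  have "range (\<lambda>t. cos t *\<^sub>R T x + sin t *\<^sub>R T y) = T ` range (\<lambda>t. cos t *\<^sub>R x + sin t *\<^sub>R y)" for x y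
    by (simp add: image_image T.add T.scaleR)
  moreover have "T z = T x + \<i> *\<^sub>C T y \<longleftrightarrow> z = x + \<i> *\<^sub>C y" for x y
  proof -
    have "T x + \<i> *\<^sub>C T y = T (x + \<i> *\<^sub>C y)" by (simp add: T.add iota)
    then show ?thesis using bij by (simp add: bij_def inj_eq)
  qed
  ultimately show ?thesis
    by (simp add: is_complex_abs_def cone_diff_image[OF T bij] is_cone_sup_image[OF T bij])
qed

lemma complex_unimodular_image:
  fixes P :: "'a::complex_banach set"
  assumes P: "complex_banach_lattice P" and T: "T \<in> complex_center P"
    and abs1: "is_complex_abs (complex_center_cone P) T id_blinfun"
  shows "order_cone (blinfun_apply T ` P) \<and> complex_banach_lattice (blinfun_apply T ` P) \<and>
    complex_closed_ideals P = complex_closed_ideals (blinfun_apply T ` P)"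
proof -
  interpret modulus_lattice P "\<lambda>x. \<i> *\<^sub>C x" "complex_re P" "complex_im P" by (rule complex_modulus_lattice[OF P])
  note abs = complex_abs_eq_modulus[OF P]
  have TC: "T \<in> center" using T by (simp add: complex_defs_eq[OF P])
  have m1: "m (T x) = x" if "x \<in> P" for x
    using abs1 that unfolding complex_unimodular[OF P T] abs by blast
  have bl: "bounded_linear (blinfun_apply T)" by (rule blinfun.bounded_linear_right)
  have iota: "T (\<i> *\<^sub>C x) = \<i> *\<^sub>C T x" for x by (rule center_iota[OF TC])
  have bij: "bij (blinfun_apply T)" and norm: "norm (T x) = norm x" and mT: "m (T x) = m x" for x
    using unimodular_bij[OF TC m1] unimodular_norm[OF TC m1] unimodular_preserves_modulus[OF TC m1] by auto
  have oc: "order_cone (T ` P)" by (rule order_cone_image[OF bl bij cone])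
  have surj: "\<exists>y. x = T y" for x using bij by (meson bij_pointE)
  have dec: "T x + \<i> *\<^sub>C T y = T z \<longleftrightarrow> x + \<i> *\<^sub>C y = z" for x y z
    using bij by (simp add: bij_def inj_eq flip: iota blinfun.add_right)
  have abs_P: "is_complex_abs P z (m z)" for z by (simp add: is_complex_abs_iff[OF P] is_sup_m)
  have abs_W: "is_complex_abs (T ` P) (T z) (T a) \<longleftrightarrow> is_complex_abs P z a" for z a
    by (rule is_complex_abs_image[OF bl bij iota])
  \<comment> \<open>\<open>T\<close> commutes with \<open>\<i>\<close> and is bijective, so it
    carries the unique decomposition for \<open>P\<close> to one for the image cone.\<close>
  have "\<exists>!(x, y). x \<in> cone_diff (T ` P) \<and> y \<in> cone_diff (T ` P) \<and> z = x + \<i> *\<^sub>C y" for z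
  proof -
    obtain w where w: "z = T w" using surj by blast
    show ?thesis
    proof (rule ex1I[of _ "(T (complex_re P w), T (complex_im P w))"])
      show "case (T (complex_re P w), T (complex_im P w)) of (x, y) \<Rightarrow>
          x \<in> cone_diff (T ` P) \<and> y \<in> cone_diff (T ` P) \<and> z = x + \<i> *\<^sub>C y"
        using dec[of "complex_re P w" "complex_im P w" w] split[of w] w
        by (simp add: cone_diff_image[OF bl bij])
      fix p assume p: "case p of (x, y) \<Rightarrow> x \<in> cone_diff (T ` P) \<and> y \<in> cone_diff (T ` P) \<and> z = x + \<i> *\<^sub>C y"
      then obtain x y where xy: "p = (T x, T y)" "x \<in> X" "y \<in> X" "T w = T x + \<i> *\<^sub>C T y"
        by (auto simp: cone_diff_image[OF bl bij] w)
      then have "w = x + \<i> *\<^sub>C y" using dec[of x y w] by simp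
      then show "p = (T (complex_re P w), T (complex_im P w))"
        using complex_re_im_eqI[OF P xy(2,3)] xy(1) by simp
    qed
  qed
  moreover have "\<exists>a. is_complex_abs (T ` P) z a \<and> norm z = norm a" for z
  proof -
    obtain w where w: "z = T w" using surj by blast
    have "is_complex_abs (T ` P) z (T (m w))" unfolding w abs_W by (rule abs_P)
    moreover have "norm z = norm (T (m w))" by (simp add: w norm norm_modulus)
    ultimately show ?thesis by blast
  qed
  moreover have "banach_lattice_on (cone_diff (T ` P)) (T ` P)"
    unfolding cone_diff_image[OF bl bij] by (rule banach_lattice_on_image[OF bl bij norm complex_base[OF P]])
  ultimately have W: "complex_banach_lattice (T ` P)" unfolding complex_banach_lattice_def by blast
  \<comment> \<open>As for real scalars, preservation of the modulus replaces the preimage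
    \<open>y\<close> by \<open>x\<close>; hence the two cones define the same domination
    relation.\<close>
  have "complex_abs (T ` P) x = T (complex_abs P x)" for x
  proof -
    obtain y where y: "x = T y" using surj by blast
    have "is_complex_abs (T ` P) x (T (m y))" unfolding y abs_W by (rule abs_P)
    then have "complex_abs (T ` P) x = T (m y)"
      unfolding complex_abs_def is_complex_abs_iff[OF W] by (intro the_equality is_cone_sup_unique[OF oc])
    then show ?thesis by (simp add: y abs mT)
  qed
  then have "complex_closed_ideals (T ` P) = complex_closed_ideals P"
    by (simp add: complex_closed_ideals_def cone_le_image[OF bl bij])
  with W oc show ?thesis by simp
qed

theorem theorem4:
  shows "(\<forall>P :: 'a::banach set. real_banach_lattice P \<longrightarrow>
      (\<forall>W. order_cone W \<and> real_banach_lattice W \<and>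
           real_closed_ideals P = real_closed_ideals W \<longrightarrow>
         (\<exists>T. T \<in> real_center P \<and> is_real_abs (real_center_cone P) T id_blinfun \<and>
              (\<forall>x\<in>P. blinfun_apply T x = real_abs W x))) \<and>
      (\<forall>T. T \<in> real_center P \<and> is_real_abs (real_center_cone P) T id_blinfun \<longrightarrow>
         (let W = blinfun_apply T ` P in
            order_cone W \<and> real_banach_lattice W \<and>
            real_closed_ideals P = real_closed_ideals W)))
    \<and> (\<forall>P :: 'b::complex_banach set. complex_banach_lattice P \<longrightarrow>
      (\<forall>W. order_cone W \<and> complex_banach_lattice W \<and>
           complex_closed_ideals P = complex_closed_ideals W \<longrightarrow>
         (\<exists>T. T \<in> complex_center P \<and> is_complex_abs (complex_center_cone P) T id_blinfun \<and>
              (\<forall>x\<in>P. blinfun_apply T x = complex_abs W x))) \<and>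
      (\<forall>T. T \<in> complex_center P \<and> is_complex_abs (complex_center_cone P) T id_blinfun \<longrightarrow>
         (let W = blinfun_apply T ` P in
            order_cone W \<and> complex_banach_lattice W \<and>
            complex_closed_ideals P = complex_closed_ideals W)))"
  unfolding Let_def
  by (intro conjI allI impI; elim conjE;
      intro real_same_ideals_imp_central complex_same_ideals_imp_central
        real_unimodular_image[THEN conjunct1] real_unimodular_image[THEN conjunct2, THEN conjunct1]
        real_unimodular_image[THEN conjunct2, THEN conjunct2]
        complex_unimodular_image[THEN conjunct1] complex_unimodular_image[THEN conjunct2, THEN conjunct1]
        complex_unimodular_image[THEN conjunct2, THEN conjunct2]; assumption)

end
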